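(* Let $H,K$ be commutative, cancellative monoids, each containing at least one element of infinite order, and let $f:\mathcal{P}_{\mathrm{fin},1}(H)\to\mathcal{P}_{\mathrm{fin},1}(K)$ be an isomorphism with pullback $g$. If $H^\times\neq\{1_H\}$ or $K^\times\neq\{1_K\}$, then $g$ is a monoid isomorphism $H\to K$. In particular, if $H,K$ are such monoids with non-trivial unit groups and $\mathcal{P}_{\mathrm{fin},1}(H)\simeq\mathcal{P}_{\mathrm{fin},1}(K)$, then $H\simeq K$.
   Context: $\mathcal{P}_{\mathrm{fin},1}(H)$ is the monoid of finite subsets of $H$ containing $1_H$ under setwise multiplication; $H^\times$ is the unit group of $H$. Any isomorphism $f:\mathcal{P}_{\mathrm{fin},1}(H)\to\mathcal{P}_{\mathrm{fin},1}(K)$ maps 2-element sets bijectively onto 2-element sets; its pullback is the bijection $g:H\to K$ with $g(1_H)=1_K$ and $f(\{1_H,a\})=\{1_K,g(a)\}$ for $a\neq 1_H$. *)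

theory Defs
  imports "HOL-Algebra.Coset" "HOL-Algebra.Divisibility"
begin

definition Pfin1 :: "('a, 'm) monoid_scheme \<Rightarrow> 'a set monoid"
  where "Pfin1 H =
    \<lparr>carrier = {X. finite X \<and> X \<subseteq> carrier H \<and> \<one>\<^bsub>H\<^esub> \<in> X}, mult = set_mult H, one = {\<one>\<^bsub>H\<^esub>}\<rparr>"

definition infinite_order :: "('a, 'm) monoid_scheme \<Rightarrow> 'a \<Rightarrow> bool"
  where "infinite_order H x \<longleftrightarrow> x \<in> carrier H \<and> infinite (range (\<lambda>n::nat. x [^]\<^bsub>H\<^esub> n))"

definition pullback ::
    "('a, 'm) monoid_scheme \<Rightarrow> ('b, 'n) monoid_scheme \<Rightarrow> ('a set \<Rightarrow> 'b set) \<Rightarrow> 'a \<Rightarrow> 'b"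
  where "pullback H K f a =
    (if a = \<one>\<^bsub>H\<^esub> then \<one>\<^bsub>K\<^esub>
     else (THE b. b \<in> carrier K \<and> f {\<one>\<^bsub>H\<^esub>, a} = {\<one>\<^bsub>K\<^esub>, b}))"

text \<open>The description operator above is harmless: any map with the defining property of
  the pullback agrees with it on the carrier.\<close>

lemma pullback_eqI:
  assumes "g \<in> carrier H \<rightarrow> carrier K"
    and "g \<one>\<^bsub>H\<^esub> = \<one>\<^bsub>K\<^esub>"
    and "\<And>a. \<lbrakk>a \<in> carrier H; a \<noteq> \<one>\<^bsub>H\<^esub>\<rbrakk> \<Longrightarrow> f {\<one>\<^bsub>H\<^esub>, a} = {\<one>\<^bsub>K\<^esub>, g a}"
    and "a \<in> carrier H"
  shows "pullback H K f a = g a"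
proof (cases "a = \<one>\<^bsub>H\<^esub>")
  case True
  then show ?thesis by (simp add: pullback_def assms(2))
next
  case False
  have "(THE b. b \<in> carrier K \<and> f {\<one>\<^bsub>H\<^esub>, a} = {\<one>\<^bsub>K\<^esub>, b}) = g a"
  proof (rule the_equality)
    show "g a \<in> carrier K \<and> f {\<one>\<^bsub>H\<^esub>, a} = {\<one>\<^bsub>K\<^esub>, g a}"
      using assms(1) assms(3)[OF assms(4) False] assms(4) by auto
  next
    fix b assume "b \<in> carrier K \<and> f {\<one>\<^bsub>H\<^esub>, a} = {\<one>\<^bsub>K\<^esub>, b}"
    then show "b = g a"
      using assms(3)[OF assms(4) False] by (auto simp: doubleton_eq_iff)
  qed
  with False show ?thesis by (simp add: pullback_def)
qed

text \<open>\<^const>\<open>iso\<close> only requires a multiplicative bijection; between monoids it preserves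
  the identity automatically, so it is the usual notion of monoid isomorphism.\<close>

lemma monoid_iso_one:
  assumes "monoid G" "monoid G'" "h \<in> iso G G'"
  shows "h \<one>\<^bsub>G\<^esub> = \<one>\<^bsub>G'\<^esub>"
proof -
  interpret G: monoid G by fact
  interpret G': monoid G' by fact
  have h: "h \<in> hom G G'" "h ` carrier G = carrier G'"
    using assms(3) by (auto simp: iso_iff)
  have "h \<one>\<^bsub>G\<^esub> \<otimes>\<^bsub>G'\<^esub> y = y" if "y \<in> carrier G'" for y
  proof -
    from that have "y \<in> h ` carrier G" by (simp only: h(2))
    then obtain x where x: "x \<in> carrier G" "y = h x" by (elim imageE)
    have "h (\<one>\<^bsub>G\<^esub> \<otimes>\<^bsub>G\<^esub> x) = h \<one>\<^bsub>G\<^esub> \<otimes>\<^bsub>G'\<^esub> h x"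
      by (rule hom_mult[OF h(1) G.one_closed x(1)])
    then show ?thesis by (simp only: x(2) G.l_one[OF x(1)])
  qed
  moreover have "h \<one>\<^bsub>G\<^esub> \<in> carrier G'"
    using h(1) G.one_closed by (rule hom_in_carrier)
  ultimately show ?thesis by (rule G'.one_unique[rotated])
qed

lemma comm_monoid_Pfin1:
  assumes "comm_monoid H"
  shows "comm_monoid (Pfin1 H)"
proof -
  interpret H: comm_monoid H by fact
  have mem: "z \<in> X <#>\<^bsub>H\<^esub> Y \<longleftrightarrow> (\<exists>x\<in>X. \<exists>y\<in>Y. z = x \<otimes>\<^bsub>H\<^esub> y)" for X Y z
    by (simp add: set_mult_def)
  have closed: "X <#>\<^bsub>H\<^esub> Y \<subseteq> carrier H" if "X \<subseteq> carrier H" "Y \<subseteq> carrier H" for X Y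
    using that by (auto simp: mem subset_iff)
  have comm: "X <#>\<^bsub>H\<^esub> Y \<subseteq> Y <#>\<^bsub>H\<^esub> X" if "X \<subseteq> carrier H" "Y \<subseteq> carrier H" for X Y
  proof
    fix z assume "z \<in> X <#>\<^bsub>H\<^esub> Y"
    then obtain x y where xy: "x \<in> X" "y \<in> Y" "z = x \<otimes>\<^bsub>H\<^esub> y" unfolding mem by blast
    then have "z = y \<otimes>\<^bsub>H\<^esub> x" using that H.m_comm by (meson subsetD)
    with xy show "z \<in> Y <#>\<^bsub>H\<^esub> X" unfolding mem by blast
  qed
  have assoc: "(X <#>\<^bsub>H\<^esub> Y) <#>\<^bsub>H\<^esub> Z = X <#>\<^bsub>H\<^esub> (Y <#>\<^bsub>H\<^esub> Z)"
    if "X \<subseteq> carrier H" "Y \<subseteq> carrier H" "Z \<subseteq> carrier H" for X Y Z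
  proof -
    have eq: "(x \<otimes>\<^bsub>H\<^esub> y) \<otimes>\<^bsub>H\<^esub> z = x \<otimes>\<^bsub>H\<^esub> (y \<otimes>\<^bsub>H\<^esub> z)" if "x \<in> X" "y \<in> Y" "z \<in> Z" for x y z
      using that \<open>X \<subseteq> _\<close> \<open>Y \<subseteq> _\<close> \<open>Z \<subseteq> _\<close> by (intro H.m_assoc) auto
    have "w \<in> (X <#>\<^bsub>H\<^esub> Y) <#>\<^bsub>H\<^esub> Z \<longleftrightarrow> (\<exists>x\<in>X. \<exists>y\<in>Y. \<exists>z\<in>Z. w = (x \<otimes>\<^bsub>H\<^esub> y) \<otimes>\<^bsub>H\<^esub> z)" for w
      by (simp add: set_mult_def)
    moreover have "w \<in> X <#>\<^bsub>H\<^esub> (Y <#>\<^bsub>H\<^esub> Z) \<longleftrightarrow> (\<exists>x\<in>X. \<exists>y\<in>Y. \<exists>z\<in>Z. w = x \<otimes>\<^bsub>H\<^esub> (y \<otimes>\<^bsub>H\<^esub> z))" for w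
      by (simp add: set_mult_def)
    moreover have "(\<exists>x\<in>X. \<exists>y\<in>Y. \<exists>z\<in>Z. w = (x \<otimes>\<^bsub>H\<^esub> y) \<otimes>\<^bsub>H\<^esub> z)
        \<longleftrightarrow> (\<exists>x\<in>X. \<exists>y\<in>Y. \<exists>z\<in>Z. w = x \<otimes>\<^bsub>H\<^esub> (y \<otimes>\<^bsub>H\<^esub> z))" for w
      by (intro bex_cong refl) (simp only: eq)
    ultimately show ?thesis by (simp only: set_eq_iff simp_thms)
  qed
  show ?thesis
  proof (rule comm_monoidI)
    fix X Y assume "X \<in> carrier (Pfin1 H)" "Y \<in> carrier (Pfin1 H)"
    then have X: "finite X" "X \<subseteq> carrier H" "\<one>\<^bsub>H\<^esub> \<in> X"
      and Y: "finite Y" "Y \<subseteq> carrier H" "\<one>\<^bsub>H\<^esub> \<in> Y" by (simp_all add: Pfin1_def)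
    have "finite (X <#>\<^bsub>H\<^esub> Y)" using X(1) Y(1) by (simp add: set_mult_def)
    moreover have "\<one>\<^bsub>H\<^esub> \<in> X <#>\<^bsub>H\<^esub> Y"
      unfolding mem using X(3) Y(3) H.r_one[OF H.one_closed] by metis
    ultimately show "X \<otimes>\<^bsub>Pfin1 H\<^esub> Y \<in> carrier (Pfin1 H)"
      using closed[OF X(2) Y(2)] by (simp add: Pfin1_def)
    show "X \<otimes>\<^bsub>Pfin1 H\<^esub> Y = Y \<otimes>\<^bsub>Pfin1 H\<^esub> X"
      using comm[OF X(2) Y(2)] comm[OF Y(2) X(2)] by (simp add: Pfin1_def)
  next
    fix X Y Z
    assume "X \<in> carrier (Pfin1 H)" "Y \<in> carrier (Pfin1 H)" "Z \<in> carrier (Pfin1 H)"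
    then show "(X \<otimes>\<^bsub>Pfin1 H\<^esub> Y) \<otimes>\<^bsub>Pfin1 H\<^esub> Z = X \<otimes>\<^bsub>Pfin1 H\<^esub> (Y \<otimes>\<^bsub>Pfin1 H\<^esub> Z)"
      using assoc[of X Y Z] by (simp add: Pfin1_def)
  next
    show "\<one>\<^bsub>Pfin1 H\<^esub> \<in> carrier (Pfin1 H)" by (simp add: Pfin1_def)
  next
    fix X assume "X \<in> carrier (Pfin1 H)"
    then have X: "X \<subseteq> carrier H" by (simp add: Pfin1_def)
    have one: "\<one>\<^bsub>H\<^esub> \<otimes>\<^bsub>H\<^esub> x = x" if "x \<in> X" for x
      by (rule H.l_one) (rule subsetD[OF X that])
    have "{\<one>\<^bsub>H\<^esub>} <#>\<^bsub>H\<^esub> X = X"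
    proof -
      have "z \<in> {\<one>\<^bsub>H\<^esub>} <#>\<^bsub>H\<^esub> X \<longleftrightarrow> (\<exists>x\<in>X. z = \<one>\<^bsub>H\<^esub> \<otimes>\<^bsub>H\<^esub> x)" for z
        by (simp add: set_mult_def)
      moreover have "(\<exists>x\<in>X. z = \<one>\<^bsub>H\<^esub> \<otimes>\<^bsub>H\<^esub> x) \<longleftrightarrow> z \<in> X" for z
        using one by metis
      ultimately show ?thesis by (simp only: set_eq_iff simp_thms)
    qed
    then show "\<one>\<^bsub>Pfin1 H\<^esub> \<otimes>\<^bsub>Pfin1 H\<^esub> X = X" by (simp add: Pfin1_def)
  qed
qed

end

theory Submission
  imports Defs
begin

text \<open>
  Write \<open>a' = g a\<close>. An equation \<open>X Y = X' Y'\<close> between products of two-element sets survives the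
  application of \<open>f\<close> and then restricts the values of \<open>g\<close>. Counting solutions \<open>Z\<close> of
  \<open>Z {1, z} = X {1, z, z\<^sup>2, z\<^sup>3}\<close> shows that \<open>f\<close> preserves cardinalities, and a similar equation shows
  that \<open>xy\<close> being a nonunit forces a power of \<open>(xy)'\<close> to equal \<open>x'y'\<close>, \<open>x'/y'\<close> or \<open>y'/x'\<close>.
  Up to translation, \<open>f\<close> might still act as a reflection on sets that contain nonunits; nontrivial
  units exclude this.

  If there is a unit \<open>u\<close> of infinite order, comparing \<open>X\<close> with \<open>u\<^sup>-\<^sup>1 X\<close> gives \<open>u' \<in> f X\<close> whenever
  \<open>u \<in> X\<close>, hence multiplicativity of \<open>g\<close> on units. For a nonunit \<open>x\<close> one gets \<open>(xu)' = x' u'\<close> or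
  \<open>(xu)' = x' / u'\<close>, and the second possibility is refuted by sets whose exponents of \<open>u\<close> are not
  symmetric. Shifting \<open>x\<close> and \<open>y\<close> by powers of \<open>u\<close> then excludes the two wrong quotients.

  If all units are torsion, let \<open>V\<close> be a finite subgroup. The sets \<open>{1} \<union> xV\<close> and \<open>V \<union> {xv}\<close> are
  characterised by properties that \<open>f\<close> preserves and are told apart by their squares, so
  \<open>f (V \<union> {x}) = f V \<union> {x'}\<close>. Comparing \<open>(V \<union> {x})(V \<union> {y})(V \<union> {xy})\<close> with
  \<open>(V \<union> {x})(V \<union> {y}){1, xy}\<close> gives \<open>(xy)' \<in> x'y' f V\<close>, and the power relation above removes the
  ambiguity.
\<close>

subsection \<open>Cancellative commutative monoids\<close>

text \<open>The obstacle is that \<open>f X\<close> need not be the image of \<open>X\<close> under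
  \<open>g\<close>. On the additive monoid of naturals, sending \<open>X\<close> to
  \<open>max X - X\<close> is an automorphism that fixes every set \<open>{0, a}\<close> and still
  moves larger sets. So the membership of \<open>xy\<close> in \<open>{1, x}{1, y}\<close> does not
  simply transfer; what transfers are identities between products, cardinalities, and uniqueness or
  counting of solutions of equations. Each such identity is read off in \<open>K\<close> through
  coordinates. If \<open>p\<close> is a nonunit and \<open>a\<close> a unit of infinite order, the
  elements \<open>p^i a^j\<close> have unique exponents and behave like points of a planar grid; if
  \<open>V\<close> is a finite subgroup and \<open>x\<close> has infinite order, the sets
  \<open>x^i V\<close> are disjoint rows. The two kinds of units need separate arguments because
  they break the reflection differently: a unit of infinite order allows a set to be shifted past 1
  in both directions, whereas a torsion unit lies in a nontrivial finite subgroup, an idempotent of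
  the power monoid that \<open>f\<close> must respect.\<close>

definition seg :: "('a, 'm) monoid_scheme \<Rightarrow> 'a \<Rightarrow> nat \<Rightarrow> 'a set"
  where "seg G x n = (\<lambda>i. x [^]\<^bsub>G\<^esub> i) ` {..n}"

text \<open>The case \<open>p = q\<close> is deliberately included: for nonempty \<open>X\<close> it
  makes \<open>z\<close> an element of infinite order. Altogether the rows \<open>X\<close>,
  \<open>X z\<close>, \<open>X z^2\<close>, ... are pairwise disjoint translates of
  \<open>X\<close>.\<close>

definition step_free :: "('a, 'm) monoid_scheme \<Rightarrow> 'a \<Rightarrow> 'a set \<Rightarrow> bool"
  where "step_free G z X \<longleftrightarrow> (\<forall>p\<in>X. \<forall>q\<in>X. \<forall>i>0. q \<noteq> p \<otimes>\<^bsub>G\<^esub> z [^]\<^bsub>G\<^esub> (i::nat))"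

lemma mem_Pfin1: "X \<in> carrier (Pfin1 G) \<longleftrightarrow> finite X \<and> X \<subseteq> carrier G \<and> \<one>\<^bsub>G\<^esub> \<in> X"
  by (simp add: Pfin1_def)

lemma mult_Pfin1: "A \<otimes>\<^bsub>Pfin1 G\<^esub> B = A <#>\<^bsub>G\<^esub> B"
  by (simp add: Pfin1_def)

lemma one_Pfin1: "\<one>\<^bsub>Pfin1 G\<^esub> = {\<one>\<^bsub>G\<^esub>}"
  by (simp add: Pfin1_def)

lemma mem_set_mult: "z \<in> A <#>\<^bsub>G\<^esub> B \<longleftrightarrow> (\<exists>a\<in>A. \<exists>b\<in>B. z = a \<otimes>\<^bsub>G\<^esub> b)"
  by (auto simp: set_mult_def)

lemma set_multI: "a \<in> A \<Longrightarrow> b \<in> B \<Longrightarrow> a \<otimes>\<^bsub>G\<^esub> b \<in> A <#>\<^bsub>G\<^esub> B"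
  by (auto simp: mem_set_mult)

context comm_monoid_cancel
begin

lemma set_mult_assoc:
  assumes "A \<subseteq> carrier G" "B \<subseteq> carrier G" "C \<subseteq> carrier G"
  shows "(A <#> B) <#> C = A <#> (B <#> C)"
proof -
  have eq: "(a \<otimes> b) \<otimes> c = a \<otimes> (b \<otimes> c)" if "a \<in> A" "b \<in> B" "c \<in> C" for a b c
    using that assms by (intro m_assoc) auto
  show ?thesis
  proof (rule equalityI; rule subsetI)
    fix z assume "z \<in> (A <#> B) <#> C"
    then obtain a b c where "a \<in> A" "b \<in> B" "c \<in> C" "z = (a \<otimes> b) \<otimes> c"
      by (auto simp: mem_set_mult)
    then show "z \<in> A <#> (B <#> C)" using eq by (auto intro!: set_multI)
  next
    fix z assume "z \<in> A <#> (B <#> C)"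
    then obtain a b c where "a \<in> A" "b \<in> B" "c \<in> C" "z = a \<otimes> (b \<otimes> c)"
      by (auto simp: mem_set_mult)
    then have "a \<in> A" "b \<in> B" "c \<in> C" "z = (a \<otimes> b) \<otimes> c" using eq by auto
    then show "z \<in> (A <#> B) <#> C" by (auto intro!: set_multI)
  qed
qed

lemma Pfin1_mult_closed:
  assumes "A \<in> carrier (Pfin1 G)" "B \<in> carrier (Pfin1 G)"
  shows "A <#> B \<in> carrier (Pfin1 G)"
proof -
  interpret P: comm_monoid "Pfin1 G" by (rule comm_monoid_Pfin1) (rule comm_monoid_axioms)
  show ?thesis using P.m_closed[OF assms] by (simp add: mult_Pfin1)
qed

lemma pair_Pfin1: "x \<in> carrier G \<Longrightarrow> {\<one>, x} \<in> carrier (Pfin1 G)"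
  by (simp add: mem_Pfin1)

lemma pow_add: "x \<in> carrier G \<Longrightarrow> x [^] (m + n :: nat) = x [^] m \<otimes> x [^] n"
  by (simp add: nat_pow_mult)

lemma mult_right_cancel:
  "a \<in> carrier G \<Longrightarrow> b \<in> carrier G \<Longrightarrow> c \<in> carrier G \<Longrightarrow> a \<otimes> c = b \<otimes> c \<longleftrightarrow> a = b"
  using r_cancel by blast

lemma mult_left_cancel:
  "a \<in> carrier G \<Longrightarrow> b \<in> carrier G \<Longrightarrow> c \<in> carrier G \<Longrightarrow> c \<otimes> a = c \<otimes> b \<longleftrightarrow> a = b"
  using l_cancel by blast

lemma mult_eq_self_right:
  assumes "a \<in> carrier G" "b \<in> carrier G" shows "a \<otimes> b = a \<longleftrightarrow> b = \<one>" "a = a \<otimes> b \<longleftrightarrow> b = \<one>"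
  using assms mult_left_cancel[of b \<one> a] by auto

lemma mult_eq_self_left:
  assumes "a \<in> carrier G" "b \<in> carrier G" shows "b \<otimes> a = a \<longleftrightarrow> b = \<one>" "a = b \<otimes> a \<longleftrightarrow> b = \<one>"
  using assms mult_right_cancel[of b \<one> a] by auto

section \<open>Elements of finite and of infinite order\<close>

lemma finite_range_pow:
  assumes "x \<in> carrier G" "x [^] (n::nat) = \<one>" "n > 0"
  shows "finite (range (\<lambda>i::nat. x [^] i))"
proof -
  have "x [^] i = x [^] (i mod n)" for i :: nat
  proof -
    have "x [^] i = x [^] (n * (i div n) + i mod n)" by simp
    also have "\<dots> = (x [^] n) [^] (i div n) \<otimes> x [^] (i mod n)"
      using assms(1) by (simp only: pow_add nat_pow_pow)
    finally show ?thesis using assms by simp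
  qed
  then have "range (\<lambda>i::nat. x [^] i) \<subseteq> (\<lambda>i. x [^] i) ` {..<n}"
    using assms(3) by (metis (no_types, lifting) image_subsetI imageI lessThan_iff mod_less_divisor)
  then show ?thesis by (rule finite_subset) simp
qed

lemma infinite_order_pow_one:
  assumes "infinite_order G x" "x [^] (n::nat) = \<one>" shows "n = 0"
  using finite_range_pow[of x n] assms by (auto simp: infinite_order_def)

lemma infinite_order_closed: "infinite_order G x \<Longrightarrow> x \<in> carrier G"
  by (simp add: infinite_order_def)

lemma pow_eq_pow:
  assumes "x \<in> carrier G" "x [^] (i::nat) = x [^] j" "i \<le> j" shows "x [^] (j - i) = \<one>"
proof -
  have "x [^] i \<otimes> x [^] (j - i) = x [^] i \<otimes> \<one>"
    using assms pow_add[of x i "j - i"] by simp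
  then show ?thesis using assms(1) by (simp add: mult_eq_self_right)
qed

lemma infinite_order_inj:
  assumes "infinite_order G x" shows "x [^] (i::nat) = x [^] j \<longleftrightarrow> i = j"
proof
  assume eq: "x [^] i = x [^] j"
  have "j - i = 0 \<or> \<not> i \<le> j"
    using pow_eq_pow[of x i j] eq infinite_order_pow_one[OF assms] assms infinite_order_closed by blast
  moreover have "i - j = 0 \<or> \<not> j \<le> i"
    using pow_eq_pow[of x j i] eq infinite_order_pow_one[OF assms] assms infinite_order_closed by metis
  ultimately show "i = j" by auto
qed simp

lemma not_infinite_orderE:
  assumes "x \<in> carrier G" "\<not> infinite_order G x"
  obtains n :: nat where "n > 0" "x [^] n = \<one>"
proof -
  have "\<not> inj (\<lambda>i::nat. x [^] i)"
    using assms finite_imageD[of "\<lambda>i::nat. x [^] i" UNIV] unfolding infinite_order_def by blast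
  then obtain i0 j0 :: nat where "x [^] i0 = x [^] j0" "i0 \<noteq> j0" unfolding inj_def by blast
  then obtain i j :: nat where ij: "x [^] i = x [^] j" "i < j" by (metis linorder_neqE_nat)
  then show ?thesis using that[of "j - i"] pow_eq_pow[of x i j] assms(1) by auto
qed

lemma infinite_orderI:
  assumes "x \<in> carrier G" "\<And>n::nat. x [^] n = \<one> \<Longrightarrow> n = 0" shows "infinite_order G x"
  using assms not_infinite_orderE by blast

lemma infinite_order_pow:
  assumes "infinite_order G x" "n > 0" shows "infinite_order G (x [^] (n::nat))"
proof (rule infinite_orderI)
  show "x [^] n \<in> carrier G" using assms infinite_order_closed by simp
  fix m :: nat assume "(x [^] n) [^] m = \<one>"
  then have "x [^] (n * m) = \<one>" using assms infinite_order_closed by (simp add: nat_pow_pow)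
  then show "m = 0" using infinite_order_pow_one[OF assms(1)] assms(2) by fastforce
qed

lemma torsion_mult:
  assumes "x \<in> carrier G" "y \<in> carrier G" "\<not> infinite_order G x" "\<not> infinite_order G y"
  shows "\<not> infinite_order G (x \<otimes> y)"
proof -
  obtain m :: nat where m: "m > 0" "x [^] m = \<one>" using assms not_infinite_orderE by blast
  obtain n :: nat where n: "n > 0" "y [^] n = \<one>" using assms not_infinite_orderE by blast
  have "(x \<otimes> y) [^] (m * n) = x [^] (m * n) \<otimes> y [^] (n * m)"
    using assms by (simp add: nat_pow_distrib mult.commute)
  also have "\<dots> = (x [^] m) [^] n \<otimes> (y [^] n) [^] m"
    using assms by (simp only: nat_pow_pow)
  also have "\<dots> = \<one>" by (simp add: m n)
  finally show ?thesis using infinite_order_pow_one m(1) n(1) by fastforce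
qed

lemma not_infinite_order_one: "\<not> infinite_order G \<one>"
  using infinite_order_pow_one[of \<one> 1] by auto

lemma infinite_order_not_one: "infinite_order G x \<Longrightarrow> x \<noteq> \<one>"
  using not_infinite_order_one by blast

lemma torsion_unit:
  assumes "x \<in> carrier G" "\<not> infinite_order G x" shows "x \<in> Units G"
proof -
  obtain n :: nat where n: "n > 0" "x [^] n = \<one>" using assms not_infinite_orderE by blast
  then obtain k where k: "n = Suc k" by (cases n) auto
  have "x \<otimes> x [^] k = \<one>" using n k assms by (simp add: m_comm)
  then show ?thesis using assms by (metis Units_one_closed nat_pow_closed unit_factor)
qed

lemma inv_pow:
  assumes "u \<in> Units G" shows "u [^] (n::nat) \<otimes> inv u [^] n = \<one>"
proof -
  have "u [^] n \<otimes> inv u [^] n = (u \<otimes> inv u) [^] n"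
    using assms by (simp add: nat_pow_distrib Units_closed del: Units_r_inv)
  then show ?thesis using assms by simp
qed

lemma infinite_order_inv:
  assumes "infinite_order G u" "u \<in> Units G" shows "infinite_order G (inv u)"
proof (rule infinite_orderI)
  show "inv u \<in> carrier G" using assms by simp
  fix n :: nat assume "inv u [^] n = \<one>"
  then have "u [^] n = \<one>" using inv_pow[OF assms(2), of n] assms(1) infinite_order_closed by simp
  then show "n = 0" using infinite_order_pow_one assms(1) by blast
qed

lemma torsion_inv:
  assumes "\<not> infinite_order G u" "u \<in> Units G" shows "\<not> infinite_order G (inv u)"
  using assms infinite_order_inv by fastforce

lemma infinite_order_mult_torsion:
  assumes "infinite_order G x" "t \<in> carrier G" "\<not> infinite_order G t"
  shows "infinite_order G (x \<otimes> t)"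
proof (rule ccontr)
  assume "\<not> infinite_order G (x \<otimes> t)"
  moreover have tu: "t \<in> Units G" using assms torsion_unit by blast
  moreover have xc: "x \<in> carrier G" using assms infinite_order_closed by blast
  ultimately have "\<not> infinite_order G ((x \<otimes> t) \<otimes> inv t)"
    using assms torsion_mult torsion_inv by (metis Units_inv_closed m_closed)
  moreover have "(x \<otimes> t) \<otimes> inv t = x" using tu xc by (simp add: m_assoc Units_closed)
  ultimately show False using assms by simp
qed

lemma nonunit_infinite_order: "x \<in> carrier G \<Longrightarrow> x \<notin> Units G \<Longrightarrow> infinite_order G x"
  using torsion_unit by blast

lemma mult_unit_iff:
  assumes "x \<in> carrier G" "y \<in> carrier G" shows "x \<otimes> y \<in> Units G \<longleftrightarrow> x \<in> Units G \<and> y \<in> Units G"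
  using assms unit_factor by (metis Units_m_closed m_comm)

lemma pow_unit: "u \<in> Units G \<Longrightarrow> u [^] (n::nat) \<in> Units G"
  by (induction n) auto

text \<open>If \<open>i < j\<close>, cancelling \<open>p^i\<close> would make a positive power of
  \<open>p\<close> a divisor of a unit, hence \<open>p\<close> a unit. The exponent of a nonunit is
  therefore a well-defined level, which later comparisons of products rely on.\<close>

lemma level_unique:
  assumes "p \<in> carrier G" "p \<notin> Units G" "s \<in> Units G" "t \<in> Units G"
    "p [^] (i::nat) \<otimes> s = p [^] j \<otimes> t"
  shows "i = j \<and> s = t"
proof -
  have le: "j \<le> i" if "p [^] (i::nat) \<otimes> s = p [^] j \<otimes> t" "s \<in> Units G" "t \<in> Units G" for i j s t
  proof (rule ccontr)
    assume "\<not> j \<le> i"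
    then obtain k where k: "j = i + Suc k" by (metis add_Suc_right less_imp_Suc_add not_le)
    have "p [^] i \<otimes> s = p [^] i \<otimes> (p [^] Suc k \<otimes> t)"
      using that assms k by (simp only: pow_add m_assoc Units_closed nat_pow_closed)
    then have "s = p [^] Suc k \<otimes> t"
      by (meson l_cancel m_closed nat_pow_closed Units_closed that(2,3) assms(1))
    then have "p [^] Suc k \<in> Units G"
      using that(2,3) assms(1) mult_unit_iff by (metis Units_closed nat_pow_closed)
    then show False using assms(1,2) by (simp add: mult_unit_iff)
  qed
  have "i = j" using le[OF assms(5,3,4)] le[OF assms(5)[symmetric] assms(4,3)] by simp
  then show ?thesis using assms
    by (metis Units_closed nat_pow_closed l_cancel)
qed

lemma seg_in: "i \<le> n \<Longrightarrow> x [^] i \<in> seg G x n"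
  by (auto simp: seg_def)

lemma seg_Pfin1: "x \<in> carrier G \<Longrightarrow> seg G x n \<in> carrier (Pfin1 G)"
  unfolding mem_Pfin1 seg_def using image_eqI[of \<one> "\<lambda>i. x [^] i" 0 "{..n}"] by auto

lemma seg_0: "seg G x 0 = {\<one>}"
  by (simp add: seg_def)

lemma seg_1: "x \<in> carrier G \<Longrightarrow> seg G x (Suc 0) = {\<one>, x}"
  by (auto simp: seg_def atMost_Suc)

lemma seg_2: "x \<in> carrier G \<Longrightarrow> seg G x 2 = {\<one>, x, x \<otimes> x}"
  by (auto simp: seg_def atMost_Suc numeral_2_eq_2)

text \<open>So \<open>seg G x n\<close> is the \<open>n\<close>-th power of \<open>{1, x}\<close> in
  the power monoid, and \<open>f\<close> is known on it as soon as it is known on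
  \<open>{1, x}\<close>.\<close>

lemma seg_mult:
  assumes "x \<in> carrier G" shows "seg G x m <#> seg G x n = seg G x (m + n)"
proof
  show "seg G x m <#> seg G x n \<subseteq> seg G x (m + n)"
  proof
    fix z assume "z \<in> seg G x m <#> seg G x n"
    then obtain i j where "i \<le> m" "j \<le> n" "z = x [^] i \<otimes> x [^] j"
      by (auto simp: seg_def mem_set_mult)
    then show "z \<in> seg G x (m + n)"
      using assms seg_in[of "i + j" "m + n" x] by (simp add: nat_pow_mult)
  qed
  show "seg G x (m + n) \<subseteq> seg G x m <#> seg G x n"
  proof
    fix z assume "z \<in> seg G x (m + n)"
    then obtain k where k: "k \<le> m + n" "z = x [^] k" by (auto simp: seg_def)
    then have "z = x [^] min k m \<otimes> x [^] (k - min k m)" using assms by (simp add: nat_pow_mult)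
    moreover have "min k m \<le> m" "k - min k m \<le> n" using k by auto
    ultimately show "z \<in> seg G x m <#> seg G x n" unfolding mem_set_mult using seg_in by blast
  qed
qed

lemma seg_Suc: "x \<in> carrier G \<Longrightarrow> seg G x (Suc n) = seg G x n <#> {\<one>, x}"
  using seg_mult[of x n "Suc 0"] seg_1[of x] by simp

section \<open>Equations over disjoint translates of a finite set\<close>

lemma step_free_bound:
  assumes "infinite_order G z" "finite X" "X \<subseteq> carrier G"
  obtains N :: nat where "\<And>i p q. i \<ge> N \<Longrightarrow> p \<in> X \<Longrightarrow> q \<in> X \<Longrightarrow> q \<noteq> p \<otimes> z [^] i"
proof -
  \<comment> \<open>\<open>B\<close> collects the exponents by which two elements of
    \<open>X\<close> can differ. Since \<open>z\<close> has infinite order, each pair contributes at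
    most one.\<close>
  define B where "B = (\<Union>p\<in>X. \<Union>q\<in>X. {i::nat. q = p \<otimes> z [^] i})"
  have zc: "z \<in> carrier G" using assms infinite_order_closed by blast
  have "finite {i::nat. q = p \<otimes> z [^] i}" if "p \<in> X" "q \<in> X" for p q
  proof -
    have pc: "p \<in> carrier G" using that assms by blast
    have *: "i = j" if "q = p \<otimes> z [^] i" "q = p \<otimes> z [^] j" for i j :: nat
      using that pc zc by (simp add: mult_left_cancel infinite_order_inj[OF assms(1)])
    show ?thesis
    proof (cases "\<exists>i::nat. q = p \<otimes> z [^] i")
      case True
      then obtain i :: nat where "q = p \<otimes> z [^] i" by blast
      then have "{i::nat. q = p \<otimes> z [^] i} \<subseteq> {i}" using * by blast
      then show ?thesis by (rule finite_subset) simp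
    qed simp
  qed
  then have "finite B" unfolding B_def using assms(2) by blast
  then obtain N where N: "\<And>i. i \<in> B \<Longrightarrow> i < N"
    by (metis finite_nat_set_iff_bounded)
  show ?thesis
  proof (rule that[of N])
    fix i p q assume "N \<le> i" "p \<in> X" "q \<in> X"
    then show "q \<noteq> p \<otimes> z [^] i" using N[of i] unfolding B_def by force
  qed
qed

lemma step_free_exponent:
  assumes "step_free G w X" "p \<otimes> w [^] (i::nat) = q \<otimes> w [^] (j::nat)" "X \<subseteq> carrier G"
    "w \<in> carrier G" "p \<in> X" "q \<in> X"
  shows "i = j"
proof -
  have "\<not> i < j" if "p \<otimes> w [^] i = q \<otimes> w [^] j" "p \<in> X" "q \<in> X" for p q and i j :: nat
  proof
    assume "i < j"
    have c: "p \<in> carrier G" "q \<in> carrier G" using that assms(3) by auto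
    have "q \<otimes> w [^] j = (q \<otimes> w [^] (j - i)) \<otimes> w [^] i"
      using \<open>i < j\<close> c assms(4) by (simp add: m_assoc nat_pow_mult)
    then have "p = q \<otimes> w [^] (j - i)" using that(1) c assms(4) by (simp add: mult_right_cancel)
    then show False using assms(1) that(2,3) \<open>i < j\<close> unfolding step_free_def by (metis zero_less_diff)
  qed
  from this[OF assms(2,5,6)] this[OF assms(2)[symmetric] assms(6,5)] show ?thesis by simp
qed

text \<open>Write \<open>Z\<close> in rows \<open>X w^i\<close>. Since \<open>Z w\<close> stays
  within rows 0 to 2, \<open>Z\<close> lies in rows 0 and 1. Row 0 of the product cannot come from
  \<open>Z w\<close>, and row 2 cannot come from \<open>Z\<close> itself, so both rows of
  \<open>Z\<close> are full.\<close>

lemma step_free_unique: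
  assumes "X \<in> carrier (Pfin1 G)" "w \<in> carrier G" "step_free G w X"
    "Z \<subseteq> carrier G" "Z <#> {\<one>, w} = X <#> seg G w 2"
  shows "Z = X <#> {\<one>, w}"
proof -
  have Xc: "p \<in> carrier G" if "p \<in> X" for p using that assms(1) by (auto simp: mem_Pfin1)
  have shift: "p \<otimes> w [^] i \<otimes> w = p \<otimes> w [^] Suc i" if "p \<in> X" for p and i :: nat
    using Xc[OF that] assms(2) by (simp add: m_assoc)
  have XG: "X \<subseteq> carrier G" using assms(1) by (simp add: mem_Pfin1)
  note sep = step_free_exponent[OF assms(3) _ XG assms(2)]
  have one: "1 = Suc 0" by simp
  have rhs: "z \<in> X <#> seg G w 2 \<longleftrightarrow> (\<exists>p\<in>X. \<exists>i\<le>(2::nat). z = p \<otimes> w [^] i)" for z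
    by (auto simp: mem_set_mult seg_def)
  have lhs: "z \<in> Z \<Longrightarrow> z \<in> X <#> seg G w 2" "z \<in> Z \<Longrightarrow> z \<otimes> w \<in> X <#> seg G w 2" for z
  proof -
    assume z: "z \<in> Z"
    then have "z \<otimes> \<one> \<in> Z <#> {\<one>, w}" "z \<otimes> w \<in> Z <#> {\<one>, w}" by (auto intro: set_multI)
    moreover have "z \<otimes> \<one> = z" using z assms(4) by auto
    ultimately show "z \<in> X <#> seg G w 2" "z \<otimes> w \<in> X <#> seg G w 2" using assms(5) by auto
  qed
  have repr: "\<exists>p\<in>X. \<exists>i\<le>(1::nat). z = p \<otimes> w [^] i" if z: "z \<in> Z" for z
  proof -
    obtain p and i :: nat where p: "p \<in> X" "i \<le> 2" "z = p \<otimes> w [^] i" using lhs(1)[OF z] rhs by blast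
    obtain q and j :: nat where q: "q \<in> X" "j \<le> 2" "z \<otimes> w = q \<otimes> w [^] j" using lhs(2)[OF z] rhs by blast
    have "Suc i = j" using sep[of p "Suc i" q j] p q shift[of p i] by simp
    then show ?thesis using p q by (metis Suc_le_mono Suc_1 one)
  qed
  have inZ: "p \<otimes> w [^] i \<in> Z" if p: "p \<in> X" and i: "i \<le> 1" for p and i :: nat
  proof (cases "i = 0")
    case True
    have "p \<otimes> w [^] i \<in> Z <#> {\<one>, w}" unfolding assms(5) using p i by (intro set_multI seg_in) auto
    then obtain z e where z: "z \<in> Z" "e \<in> {\<one>, w}" "p \<otimes> w [^] i = z \<otimes> e" by (auto simp: mem_set_mult)
    obtain q and j :: nat where q: "q \<in> X" "z = q \<otimes> w [^] j" using repr[OF z(1)] by blast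
    have "e \<noteq> w"
    proof
      assume "e = w"
      then have "p \<otimes> w [^] i = q \<otimes> w [^] Suc j" using z q shift[of q j] by simp
      then show False using sep[of p i q "Suc j"] p q True by simp
    qed
    then show ?thesis using z assms(4) by auto
  next
    case False
    then have i1: "i = 1" using i by simp
    have "p \<otimes> w [^] Suc i \<in> Z <#> {\<one>, w}" unfolding assms(5) using p i by (intro set_multI seg_in) auto
    then obtain z e where z: "z \<in> Z" "e \<in> {\<one>, w}" "p \<otimes> w [^] Suc i = z \<otimes> e" by (auto simp: mem_set_mult)
    obtain q and j :: nat where q: "q \<in> X" "j \<le> 1" "z = q \<otimes> w [^] j" using repr[OF z(1)] by blast
    have zc: "z \<in> carrier G" using z assms(4) by blast
    have "e \<noteq> \<one>"
    proof
      assume "e = \<one>"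
      then have "p \<otimes> w [^] Suc i = q \<otimes> w [^] j" using z q zc by simp
      then show False using sep[of p "Suc i" q j] p q i1 by simp
    qed
    then have "p \<otimes> w [^] i \<otimes> w = z \<otimes> w" using z shift[OF p, of i] by simp
    then have "p \<otimes> w [^] i = z" using Xc[OF p] zc assms(2) by (simp add: mult_right_cancel)
    then show ?thesis using z by simp
  qed
  have "z \<in> X <#> {\<one>, w} \<longleftrightarrow> (\<exists>p\<in>X. \<exists>i\<le>(1::nat). z = p \<otimes> w [^] i)" for z
  proof -
    have "z \<in> X <#> seg G w (Suc 0) \<longleftrightarrow> (\<exists>p\<in>X. \<exists>i\<le>(1::nat). z = p \<otimes> w [^] i)"
      by (auto simp: mem_set_mult seg_def)
    then show ?thesis using seg_1[OF assms(2)] by simp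
  qed
  note mem = this
  show ?thesis
  proof (rule equalityI; rule subsetI)
    fix y assume "y \<in> Z"
    then show "y \<in> X <#> {\<one>, w}" unfolding mem by (rule repr)
  next
    fix y assume "y \<in> X <#> {\<one>, w}"
    then show "y \<in> Z" unfolding mem using inZ by auto
  qed
qed

text \<open>One more row than in the uniqueness lemma creates freedom. \<open>Z\<close> occupies
  rows 0, 1, 2; rows 0 and 2 must be full to produce the outer rows of the product, and they already
  cover its inner rows. Row 1 of \<open>Z\<close> may thus be any subset, one choice for each subset
  of \<open>X\<close>.\<close>

lemma step_free_count:
  assumes "X \<in> carrier (Pfin1 G)" "z \<in> carrier G" "step_free G z X"
  shows "card {Z \<in> carrier (Pfin1 G). Z <#> {\<one>, z} = X <#> seg G z 3} = 2 ^ card X"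
proof -
  define E where "E i = (\<lambda>p. p \<otimes> z [^] i) ` X" for i :: nat
  \<comment> \<open>\<open>Phi S\<close> is the solution whose middle row is the translate of
    \<open>S\<close>.\<close>
  define Phi where "Phi S = E 0 \<union> E 2 \<union> (\<lambda>p. p \<otimes> z [^] (1::nat)) ` S" for S
  have Xc: "p \<in> carrier G" if "p \<in> X" for p using that assms(1) by (auto simp: mem_Pfin1)
  have shift: "p \<otimes> z [^] i \<otimes> z = p \<otimes> z [^] Suc i" if "p \<in> X" for p and i :: nat
    using Xc[OF that] assms(2) by (simp add: m_assoc)
  have XG: "X \<subseteq> carrier G" using assms(1) by (simp add: mem_Pfin1)
  note sep = step_free_exponent[OF assms(3) _ XG assms(2)]
  have cancel: "p = q" if "p \<otimes> z [^] i = q \<otimes> z [^] i" "p \<in> X" "q \<in> X" for p q and i :: nat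
    using that Xc assms(2) by (simp add: mult_right_cancel)
  have rhs: "y \<in> X <#> seg G z 3 \<longleftrightarrow> (\<exists>p\<in>X. \<exists>i\<le>(3::nat). y = p \<otimes> z [^] i)" for y
    by (auto simp: mem_set_mult seg_def)
  have Zz: "y \<in> Z <#> {\<one>, z} \<longleftrightarrow> y \<in> Z \<or> (\<exists>x\<in>Z. y = x \<otimes> z)" if "Z \<subseteq> carrier G" for y Z
    using that by (force simp: mem_set_mult)
  have Phi_mem: "p \<otimes> z [^] i \<in> Phi S \<longleftrightarrow> i = 0 \<or> i = 2 \<or> (i = 1 \<and> p \<in> S)"
    if p: "p \<in> X" and S: "S \<subseteq> X" for p S and i :: nat
  proof
    assume "p \<otimes> z [^] i \<in> Phi S"
    then obtain q and j :: nat where q: "p \<otimes> z [^] i = q \<otimes> z [^] j" "q \<in> X" "j = 0 \<or> j = 2 \<or> (j = 1 \<and> q \<in> S)"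
      using S unfolding Phi_def E_def by blast
    then show "i = 0 \<or> i = 2 \<or> (i = 1 \<and> p \<in> S)"
      using sep[OF q(1) p q(2)] cancel[of p i q] p by auto
  next
    assume "i = 0 \<or> i = 2 \<or> (i = 1 \<and> p \<in> S)"
    then show "p \<otimes> z [^] i \<in> Phi S" using p unfolding Phi_def E_def by blast
  qed
  have Phi_form: "\<exists>p\<in>X. \<exists>i\<le>(2::nat). y = p \<otimes> z [^] i" if y: "y \<in> Phi S" "S \<subseteq> X" for y S
  proof -
    obtain p and i :: nat where "p \<in> X" "y = p \<otimes> z [^] i" "i = 0 \<or> i = 2 \<or> i = 1"
      using y unfolding Phi_def E_def by blast
    then show ?thesis by (intro bexI[of _ p] exI[of _ i]) auto
  qed
  have Phi_carr: "Phi S \<subseteq> carrier G" if "S \<subseteq> X" for S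
    using Phi_form[OF _ that] Xc assms(2) by fastforce
  have "bij_betw Phi (Pow X) {Z \<in> carrier (Pfin1 G). Z <#> {\<one>, z} = X <#> seg G z 3}"
  proof (rule bij_betw_imageI)
    show "inj_on Phi (Pow X)"
    proof (rule inj_onI)
      fix S T assume ST: "S \<in> Pow X" "T \<in> Pow X" "Phi S = Phi T"
      have "p \<in> S \<longleftrightarrow> p \<in> T" if "p \<in> X" for p
        using Phi_mem[of p S 1] Phi_mem[of p T 1] ST that by auto
      then show "S = T" using ST by blast
    qed
    show "Phi ` Pow X = {Z \<in> carrier (Pfin1 G). Z <#> {\<one>, z} = X <#> seg G z 3}"
    proof (rule equalityI; rule subsetI)
      fix Z assume "Z \<in> Phi ` Pow X"
      then obtain S where S: "S \<subseteq> X" "Z = Phi S" by blast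
      have c: "Phi S \<subseteq> carrier G" using Phi_carr S by blast
      have "finite (Phi S)" unfolding Phi_def E_def
        using assms(1) S finite_subset[of S X] by (auto simp: mem_Pfin1)
      moreover have "\<one> \<in> Phi S"
        using Phi_mem[of \<one> S 0] S assms(1,2) by (simp add: mem_Pfin1)
      moreover have "Phi S <#> {\<one>, z} = X <#> seg G z 3"
      proof (rule equalityI; rule subsetI)
        fix y assume "y \<in> Phi S <#> {\<one>, z}"
        then consider "y \<in> Phi S" | x where "x \<in> Phi S" "y = x \<otimes> z" using Zz[OF c] by blast
        then show "y \<in> X <#> seg G z 3"
        proof cases
          case 1
          then obtain p and i :: nat where "p \<in> X" "i \<le> 2" "y = p \<otimes> z [^] i" using Phi_form S by blast
          then show ?thesis using set_multI[of p X "z [^] i" "seg G z 3" G] seg_in[of i 3 z] by simp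
        next
          case 2
          then obtain p and i :: nat where "p \<in> X" "i \<le> 2" "x = p \<otimes> z [^] i" using Phi_form S by blast
          then show ?thesis unfolding 2(2) using shift set_multI[of p X "z [^] Suc i" "seg G z 3" G] seg_in[of "Suc i" 3 z]
            by simp
        qed
      next
        fix y assume "y \<in> X <#> seg G z 3"
        then obtain p and i :: nat where p: "p \<in> X" "i \<le> 3" "y = p \<otimes> z [^] i" using rhs by blast
        have "i = 0 \<or> i = 2 \<or> i = Suc 0 \<or> i = Suc 2" using p by auto
        then show "y \<in> Phi S <#> {\<one>, z}"
        proof (elim disjE)
          assume "i = 0" then show ?thesis unfolding Zz[OF c] using Phi_mem[OF p(1) S(1), of i] p by blast
        next
          assume "i = 2" then show ?thesis unfolding Zz[OF c] using Phi_mem[OF p(1) S(1), of i] p by blast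
        next
          assume "i = Suc 0"
          then show ?thesis unfolding Zz[OF c] using Phi_mem[OF p(1) S(1), of 0] shift[OF p(1), of 0] p by metis
        next
          assume "i = Suc 2"
          then show ?thesis unfolding Zz[OF c] using Phi_mem[OF p(1) S(1), of 2] shift[OF p(1), of 2] p by metis
        qed
      qed
      ultimately show "Z \<in> {Z \<in> carrier (Pfin1 G). Z <#> {\<one>, z} = X <#> seg G z 3}"
        using c S by (simp add: mem_Pfin1)
    next
      fix Z assume "Z \<in> {Z \<in> carrier (Pfin1 G). Z <#> {\<one>, z} = X <#> seg G z 3}"
      then have Z: "Z \<subseteq> carrier G" "Z <#> {\<one>, z} = X <#> seg G z 3" by (auto simp: mem_Pfin1)
      define S where "S = {p \<in> X. p \<otimes> z [^] (1::nat) \<in> Z}"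
      have SX: "S \<subseteq> X" by (auto simp: S_def)
      have lhs: "y \<in> Z \<Longrightarrow> y \<in> X <#> seg G z 3" "y \<in> Z \<Longrightarrow> y \<otimes> z \<in> X <#> seg G z 3" for y
        using Z(2) Zz[OF Z(1)] by blast+
      have repr: "\<exists>p\<in>X. \<exists>i\<le>(2::nat). y = p \<otimes> z [^] i" if y: "y \<in> Z" for y
      proof -
        obtain p and i :: nat where p: "p \<in> X" "i \<le> 3" "y = p \<otimes> z [^] i" using lhs(1)[OF y] rhs by blast
        obtain q and j :: nat where q: "q \<in> X" "j \<le> 3" "y \<otimes> z = q \<otimes> z [^] j" using lhs(2)[OF y] rhs by blast
        have "Suc i = j" using sep[of p "Suc i" q j] p q shift[of p i] by simp
        then show ?thesis using p q by (intro bexI[of _ p] exI[of _ i]) auto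
      qed
      have in0: "p \<otimes> z [^] (0::nat) \<in> Z" if p: "p \<in> X" for p
      proof (rule ccontr)
        assume "p \<otimes> z [^] (0::nat) \<notin> Z"
        moreover have "p \<otimes> z [^] (0::nat) \<in> Z <#> {\<one>, z}" unfolding Z(2) using p by (intro set_multI seg_in) auto
        ultimately obtain y where y: "y \<in> Z" "p \<otimes> z [^] (0::nat) = y \<otimes> z" using Zz[OF Z(1)] by blast
        obtain q and j :: nat where q: "q \<in> X" "y = q \<otimes> z [^] j" using repr[OF y(1)] by blast
        show False using sep[of p 0 q "Suc j"] p q y shift[of q j] by simp
      qed
      have in2: "p \<otimes> z [^] (2::nat) \<in> Z" if p: "p \<in> X" for p
      proof -
        have "p \<otimes> z [^] Suc 2 \<in> Z <#> {\<one>, z}" unfolding Z(2) using p by (intro set_multI seg_in) auto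
        moreover have "p \<otimes> z [^] Suc 2 \<notin> Z" using repr[of "p \<otimes> z [^] Suc 2"] sep[of p "Suc 2"] p by force
        ultimately obtain y where y: "y \<in> Z" "p \<otimes> z [^] Suc 2 = y \<otimes> z" using Zz[OF Z(1)] by blast
        have "y \<in> carrier G" using y Z by blast
        then have "p \<otimes> z [^] (2::nat) = y"
          using y shift[OF p, of 2] Xc[OF p] assms(2) mult_right_cancel[of "p \<otimes> z [^] (2::nat)" y z] by simp
        then show ?thesis using y by simp
      qed
      have "Z = Phi S"
      proof (rule equalityI; rule subsetI)
        fix y assume y: "y \<in> Z"
        obtain p and i :: nat where p: "p \<in> X" "i \<le> 2" "y = p \<otimes> z [^] i" using repr[OF y] by blast
        have "i = 0 \<or> i = 2 \<or> i = 1" using p(2) by auto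
        then have "i = 0 \<or> i = 2 \<or> (i = 1 \<and> p \<in> S)" using p(1) y unfolding p(3) S_def by blast
        then show "y \<in> Phi S" using Phi_mem[OF p(1) SX, of i] p(3) by simp
      next
        fix y assume "y \<in> Phi S"
        then show "y \<in> Z" using in0 in2 unfolding Phi_def E_def S_def by auto
      qed
      then show "Z \<in> Phi ` Pow X" using SX by blast
    qed
  qed
  then have "card (Pow X) = card {Z \<in> carrier (Pfin1 G). Z <#> {\<one>, z} = X <#> seg G z 3}"
    by (rule bij_betw_same_card)
  then show ?thesis using assms(1) by (simp add: card_Pow mem_Pfin1)
qed

lemma step_free_pow:
  assumes "infinite_order G z" "finite X" "X \<subseteq> carrier G"
  obtains N :: nat where "\<And>n::nat. n \<ge> N \<Longrightarrow> n > 0 \<Longrightarrow> step_free G (z [^] n) X"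
proof -
  obtain N where N: "\<And>(i::nat) p q. i \<ge> N \<Longrightarrow> p \<in> X \<Longrightarrow> q \<in> X \<Longrightarrow> q \<noteq> p \<otimes> z [^] i"
    using step_free_bound[OF assms] by blast
  show ?thesis
  proof (rule that[of N])
    fix n :: nat assume n: "N \<le> n" "0 < n"
    show "step_free G (z [^] n) X"
      unfolding step_free_def
    proof (intro ballI allI impI)
      fix p q and i :: nat assume *: "p \<in> X" "q \<in> X" "0 < i"
      have "n * i \<ge> N" using n *(3) by (metis le_trans mult_le_mono1 mult.commute nat_mult_1 Suc_leI One_nat_def)
      then show "q \<noteq> p \<otimes> (z [^] n) [^] i"
        using N * assms(1) infinite_order_closed by (simp add: nat_pow_pow)
    qed
  qed
qed

lemma pair_mult:
  assumes "x \<in> carrier G" "y \<in> carrier G"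
  shows "{\<one>, x} <#> {\<one>, y} = {\<one>, x, y, x \<otimes> y}"
  using assms by (auto simp: set_mult_def)

text \<open>Uniqueness of the level handles \<open>p\<close>, infinite order handles
  \<open>a\<close>. Products of such elements can then be compared as sums of exponent
  pairs.\<close>

lemma level_pow_unique:
  assumes "p \<in> carrier G" "p \<notin> Units G" "a \<in> Units G" "infinite_order G a"
  shows "p [^] (i::nat) \<otimes> a [^] (j::nat) = p [^] (k::nat) \<otimes> a [^] (l::nat) \<longleftrightarrow> i = k \<and> j = l"
  using level_unique[of p "a [^] j" "a [^] l" i k] assms pow_unit infinite_order_inj[OF assms(4)]
  by metis

lemma level_pow_mult:
  assumes "p \<in> carrier G" "a \<in> carrier G"
  shows "(p [^] (i::nat) \<otimes> a [^] (j::nat)) \<otimes> (p [^] (k::nat) \<otimes> a [^] (l::nat))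
    = p [^] (i + k) \<otimes> a [^] (j + l)"
  using assms by (simp add: pow_add m_ac)

end

subsection \<open>Finite submonoids\<close>

text \<open>Only products, a cardinality and the uniqueness of a factor occur, so \<open>f\<close>
  transports the notion. The condition \<open>Z V = V\<close> says that \<open>Z\<close> is
  contained in \<open>V\<close>. For \<open>x\<close> of infinite order, \<open>X\<close> splits
  into a part \<open>A\<close> of \<open>V\<close> and a part \<open>x B\<close> of
  \<open>x V\<close> with \<open>card A + card B = card V + 1\<close>; for nontrivial
  \<open>V\<close> the last clause forces \<open>A\<close> or \<open>B\<close> to be a
  singleton.\<close>

definition thick :: "('a, 'm) monoid_scheme \<Rightarrow> 'a set \<Rightarrow> 'a \<Rightarrow> 'a set \<Rightarrow> bool"
  where "thick G V x X \<longleftrightarrow> X \<in> carrier (Pfin1 G) \<and> X <#>\<^bsub>G\<^esub> V = {\<one>\<^bsub>G\<^esub>, x} <#>\<^bsub>G\<^esub> V \<and> card X = Suc (card V)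
    \<and> (\<forall>Z\<in>carrier (Pfin1 G). Z <#>\<^bsub>G\<^esub> V = V \<and> X <#>\<^bsub>G\<^esub> Z = {\<one>\<^bsub>G\<^esub>, x} <#>\<^bsub>G\<^esub> V \<longrightarrow> Z = V)"

text \<open>These are the idempotents of the power monoid, and as such visible to \<open>f\<close>.
  By finiteness and cancellation, translation by an element of \<open>V\<close> permutes
  \<open>V\<close>, so \<open>V\<close> is in fact a finite group of units.\<close>

locale finite_submonoid = comm_monoid_cancel G for G (structure) +
  fixes V
  assumes V_Pfin1: "V \<in> carrier (Pfin1 G)" and V_idem: "V <#> V = V"
begin

lemma V_finite: "finite V" and V_closed: "v \<in> V \<Longrightarrow> v \<in> carrier G" and V_one: "\<one> \<in> V"
  using V_Pfin1 by (auto simp: mem_Pfin1)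

lemma V_mult: "v \<in> V \<Longrightarrow> w \<in> V \<Longrightarrow> v \<otimes> w \<in> V"
  using set_multI V_idem by metis

lemma V_translate: "v \<in> V \<Longrightarrow> (\<lambda>w. v \<otimes> w) ` V = V"
proof (rule card_subset_eq[OF V_finite])
  assume v: "v \<in> V"
  show "(\<lambda>w. v \<otimes> w) ` V \<subseteq> V" using V_mult v by blast
  have "inj_on (\<lambda>w. v \<otimes> w) V" using v V_closed by (auto simp: inj_on_def mult_left_cancel)
  then show "card ((\<lambda>w. v \<otimes> w) ` V) = card V" by (rule card_image)
qed

lemma V_divide: "v \<in> V \<Longrightarrow> t \<in> V \<Longrightarrow> \<exists>w\<in>V. t = v \<otimes> w"
  using V_translate by blast

lemma V_torsion: "v \<in> V \<Longrightarrow> \<not> infinite_order G v"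
proof
  assume v: "v \<in> V" "infinite_order G v"
  have "v [^] (i::nat) \<in> V" for i
    using V_one V_mult v by (induction i) auto
  then have "range (\<lambda>i::nat. v [^] i) \<subseteq> V" by blast
  then show False using v V_finite finite_subset unfolding infinite_order_def by blast
qed

lemma V_units: "v \<in> V \<Longrightarrow> v \<in> Units G"
  using V_torsion V_closed torsion_unit by blast

lemma V_inv: "v \<in> V \<Longrightarrow> inv v \<in> V"
  using V_divide[OF _ V_one] V_units V_closed by (metis inv_unique Units_l_inv Units_inv_closed)

text \<open>Elements of \<open>V\<close> are torsion, whereas a positive power of \<open>x\<close>
  times a torsion element has infinite order. Hence the cosets \<open>x^i V\<close> are pairwise
  disjoint.\<close>

lemma row_unique:
  assumes x: "infinite_order G x" and "s \<in> V" "t \<in> V" "x [^] (i::nat) \<otimes> s = x [^] (j::nat) \<otimes> t"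
  shows "i = j \<and> s = t"
proof -
  have xc: "x \<in> carrier G" using x infinite_order_closed by blast
  have aux: "\<not> i < j" if "s \<in> V" "t \<in> V" "x [^] i \<otimes> s = x [^] j \<otimes> t" for s t and i j :: nat
  proof
    assume ij: "i < j"
    have "x [^] j \<otimes> t = x [^] i \<otimes> (x [^] (j - i) \<otimes> t)"
      using ij xc V_closed[OF that(2)] pow_add[of x i "j - i"] by (simp add: m_assoc)
    then have "s = x [^] (j - i) \<otimes> t"
      using that(3) xc V_closed that by (simp add: mult_left_cancel)
    moreover have "infinite_order G (x [^] (j - i) \<otimes> t)"
      using infinite_order_mult_torsion[OF infinite_order_pow[OF x]] V_torsion V_closed that ij by simp
    ultimately show False using V_torsion that by blast
  qed
  have "i = j" using aux[OF assms(2-4)] aux[OF assms(3,2) assms(4)[symmetric]] by simp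
  then show ?thesis using assms xc V_closed by (simp add: mult_left_cancel)
qed

lemma row_unique0:
  assumes x: "infinite_order G x" and "s \<in> V" "t \<in> V"
  shows "x \<otimes> s \<noteq> t" "x \<otimes> s = x \<otimes> t \<longleftrightarrow> s = t"
  using row_unique[OF assms, of 1 0] row_unique[OF assms, of 1 1] x infinite_order_closed V_closed assms
  by auto

lemma pair_mult_V:
  assumes "x \<in> carrier G" shows "{\<one>, x} <#> V = V \<union> (\<lambda>v. x \<otimes> v) ` V"
  using V_closed assms by (force simp: set_mult_def)

text \<open>Uniqueness of the factor comes from row 0: the only element of the set in
  \<open>V\<close> is 1, so row 0 of its product with \<open>Z\<close> is exactly
  \<open>Z\<close>.\<close>

lemma thick_bottom:
  assumes x: "infinite_order G x" shows "thick G V x (insert \<one> ((\<lambda>v. x \<otimes> v) ` V))" (is "thick G V x ?X")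
proof -
  have xc: "x \<in> carrier G" using x infinite_order_closed by blast
  have X: "?X \<in> carrier (Pfin1 G)" using V_finite V_closed xc by (auto simp: mem_Pfin1)
  have "inj_on (\<lambda>v. x \<otimes> v) V" using V_closed xc by (auto simp: inj_on_def mult_left_cancel)
  moreover have "\<one> \<notin> (\<lambda>v. x \<otimes> v) ` V" using row_unique0(1)[OF x _ V_one] by (metis imageE)
  ultimately have card: "card ?X = Suc (card V)" using V_finite by (simp add: card_image)
  have XV: "?X <#> V = {\<one>, x} <#> V"
    unfolding pair_mult_V[OF xc]
  proof (rule equalityI; rule subsetI)
    fix z assume "z \<in> ?X <#> V"
    then obtain w where w: "w \<in> V" "z = \<one> \<otimes> w \<or> (\<exists>v\<in>V. z = (x \<otimes> v) \<otimes> w)" by (auto simp: mem_set_mult)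
    then consider "z = w" | v where "v \<in> V" "z = x \<otimes> (v \<otimes> w)" using V_closed xc by (auto simp: m_assoc)
    then show "z \<in> V \<union> (\<lambda>v. x \<otimes> v) ` V" using w V_mult by cases auto
  next
    fix z assume "z \<in> V \<union> (\<lambda>v. x \<otimes> v) ` V"
    then consider "z \<in> V" | "z \<in> (\<lambda>v. x \<otimes> v) ` V" by blast
    then show "z \<in> ?X <#> V"
    proof cases
      case 1
      then have "\<one> \<otimes> z \<in> ?X <#> V" by (intro set_multI) auto
      then show ?thesis using 1 V_closed by simp
    next
      case 2
      then have "z \<otimes> \<one> \<in> ?X <#> V" using V_one by (intro set_multI) auto
      then show ?thesis using 2 V_closed xc by auto
    qed
  qed
  have "Z = V" if Z: "Z \<in> carrier (Pfin1 G)" "Z <#> V = V" "?X <#> Z = {\<one>, x} <#> V" for Z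
  proof
    show ZV: "Z \<subseteq> V"
    proof
      fix z assume z: "z \<in> Z"
      then have "z \<otimes> \<one> \<in> V" using Z(2) V_one set_multI by metis
      then show "z \<in> V" using z Z(1) by (auto simp: mem_Pfin1)
    qed
    show "V \<subseteq> Z"
    proof
      fix t assume t: "t \<in> V"
      then have "t \<in> ?X <#> Z" unfolding Z(3) pair_mult_V[OF xc] by blast
      then obtain z where z: "z \<in> Z" "t = \<one> \<otimes> z \<or> (\<exists>v\<in>V. t = (x \<otimes> v) \<otimes> z)" by (auto simp: mem_set_mult)
      have zV: "z \<in> V" using z ZV by blast
      have "t \<noteq> (x \<otimes> v) \<otimes> z" if "v \<in> V" for v
        using row_unique0(1)[OF x V_mult[OF that zV] t] that zV V_closed xc by (simp add: m_assoc)
      then show "t \<in> Z" using z zV V_closed by auto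
    qed
  qed
  then show ?thesis unfolding thick_def using X XV card by blast
qed

text \<open>Uniqueness of the factor comes from row 1: the only element of the set in
  \<open>x V\<close> is \<open>x v\<close>, so row 1 of its product with \<open>Z\<close> is
  \<open>x v Z\<close>, and this must be all of \<open>x V\<close>.\<close>

lemma thick_top:
  assumes x: "infinite_order G x" and v: "v \<in> V" shows "thick G V x (insert (x \<otimes> v) V)" (is "thick G V x ?X")
proof -
  have xc: "x \<in> carrier G" using x infinite_order_closed by blast
  have X: "?X \<in> carrier (Pfin1 G)" using V_finite V_closed V_one v xc by (auto simp: mem_Pfin1)
  have card: "card ?X = Suc (card V)" using V_finite row_unique0(1)[OF x v] by (metis card_insert_disjoint)
  have XV: "?X <#> V = {\<one>, x} <#> V"
    unfolding pair_mult_V[OF xc]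
  proof (rule equalityI; rule subsetI)
    fix z assume "z \<in> ?X <#> V"
    then obtain w where w: "w \<in> V" "z = (x \<otimes> v) \<otimes> w \<or> (\<exists>t\<in>V. z = t \<otimes> w)" by (auto simp: mem_set_mult)
    moreover have "(x \<otimes> v) \<otimes> w = x \<otimes> (v \<otimes> w)" using w v V_closed xc by (simp add: m_assoc)
    ultimately show "z \<in> V \<union> (\<lambda>v. x \<otimes> v) ` V" using V_mult v by auto
  next
    fix z assume "z \<in> V \<union> (\<lambda>v. x \<otimes> v) ` V"
    then consider "z \<in> V" | t where "t \<in> V" "z = x \<otimes> t" by blast
    then show "z \<in> ?X <#> V"
    proof cases
      case 1
      then have "\<one> \<otimes> z \<in> ?X <#> V" using V_one by (intro set_multI) auto
      then show ?thesis using 1 V_closed by simp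
    next
      case 2
      obtain w where w: "w \<in> V" "t = v \<otimes> w" using V_divide v 2 by blast
      then have "(x \<otimes> v) \<otimes> w \<in> ?X <#> V" by (intro set_multI) auto
      then show ?thesis using 2 w v V_closed xc by (simp add: m_assoc)
    qed
  qed
  have "Z = V" if Z: "Z \<in> carrier (Pfin1 G)" "Z <#> V = V" "?X <#> Z = {\<one>, x} <#> V" for Z
  proof
    show ZV: "Z \<subseteq> V"
    proof
      fix z assume z: "z \<in> Z"
      then have "z \<otimes> \<one> \<in> V" using Z(2) V_one set_multI by metis
      then show "z \<in> V" using z Z(1) by (auto simp: mem_Pfin1)
    qed
    show "V \<subseteq> Z"
    proof
      fix t assume t: "t \<in> V"
      then have vt: "v \<otimes> t \<in> V" using v V_mult by blast
      then have "x \<otimes> (v \<otimes> t) \<in> ?X <#> Z" unfolding Z(3) pair_mult_V[OF xc] by blast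
      then obtain z where z: "z \<in> Z"
        "x \<otimes> (v \<otimes> t) = (x \<otimes> v) \<otimes> z \<or> (\<exists>w\<in>V. x \<otimes> (v \<otimes> t) = w \<otimes> z)" by (auto simp: mem_set_mult)
      have zV: "z \<in> V" using z ZV by blast
      have "x \<otimes> (v \<otimes> t) \<noteq> w \<otimes> z" if "w \<in> V" for w
        using row_unique0(1)[OF x vt V_mult[OF that zV]] .
      then have "x \<otimes> (v \<otimes> t) = x \<otimes> (v \<otimes> z)" using z zV v xc V_closed by (auto simp: m_assoc)
      then have "t = z" using xc v t zV V_closed by (simp add: mult_left_cancel)
      then show "t \<in> Z" using z by simp
    qed
  qed
  then show ?thesis unfolding thick_def using X XV card by blast
qed

text \<open>With \<open>A\<close> and \<open>B\<close> the traces of \<open>X\<close> on the two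
  rows, it remains to exclude that both have at least two elements; in that case
  \<open>V - {u}\<close> would be a second admissible factor.\<close>

lemma thick_cases:
  assumes x: "infinite_order G x" and X: "thick G V x X" and u: "u \<in> V" "u \<noteq> \<one>"
  shows "X = insert \<one> ((\<lambda>v. x \<otimes> v) ` V) \<or> (\<exists>v\<in>V. X = insert (x \<otimes> v) V)"
proof -
  have xc: "x \<in> carrier G" using x infinite_order_closed by blast
  have X': "finite X" "X \<subseteq> carrier G" "\<one> \<in> X" "X <#> V = {\<one>, x} <#> V" "card X = Suc (card V)"
    using X by (auto simp: thick_def mem_Pfin1)
  have sub: "X \<subseteq> V \<union> (\<lambda>v. x \<otimes> v) ` V"
  proof
    fix z assume z: "z \<in> X"
    then have "z \<otimes> \<one> \<in> X <#> V" using V_one by (intro set_multI)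
    then show "z \<in> V \<union> (\<lambda>v. x \<otimes> v) ` V" using z X' by (auto simp: pair_mult_V[OF xc])
  qed
  define A where "A = X \<inter> V"
  define B where "B = {v \<in> V. x \<otimes> v \<in> X}"
  have XAB: "X = A \<union> (\<lambda>v. x \<otimes> v) ` B" using sub unfolding A_def B_def by blast
  have fin: "finite A" "finite B" using V_finite by (auto simp: A_def B_def)
  have AB: "A \<subseteq> V" "B \<subseteq> V" "\<one> \<in> A" using X' V_one by (auto simp: A_def B_def)
  have "A \<inter> (\<lambda>v. x \<otimes> v) ` B = {}" using row_unique0(1)[OF x] AB by blast
  moreover have "inj_on (\<lambda>v. x \<otimes> v) B" using V_closed xc AB by (auto simp: inj_on_def mult_left_cancel subset_iff)
  ultimately have card: "card A + card B = Suc (card V)"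
    using X'(5) fin unfolding XAB by (simp add: card_Un_disjoint card_image)
  have le: "card A \<le> card V" "card B \<le> card V" using AB V_finite by (auto intro: card_mono)
  have A1: "card A \<ge> 1" using AB fin by (metis One_nat_def Suc_leI card_gt_0_iff empty_iff)
  consider "card A = 1" | "card B = 1" | "card A \<ge> 2" "card B \<ge> 2" using A1 card le by linarith
  then show ?thesis
  proof cases
    case 1
    then have "A = {\<one>}" using AB by (auto simp: card_1_singleton_iff)
    moreover have "B = V" using 1 card AB V_finite by (intro card_subset_eq) auto
    ultimately show ?thesis using XAB by simp
  next
    case 2
    then obtain v where v: "B = {v}" by (auto simp: card_1_singleton_iff)
    moreover have "A = V" using 2 card AB V_finite by (intro card_subset_eq) auto
    ultimately show ?thesis using XAB AB by auto
  next
    case 3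
    \<comment> \<open>Given two elements \<open>s1\<close>, \<open>s2\<close> of a trace, every
      \<open>t\<close> in \<open>V\<close> can be written as \<open>s1 w1\<close> and as
      \<open>s2 w2\<close> with \<open>w1\<close>, \<open>w2\<close> distinct, so at least one of
      these factors avoids \<open>u\<close>. As \<open>u\<close> is not 1, the set still contains
      1.\<close>
    define Z where "Z = V - {u}"
    have hit: "\<exists>s\<in>S. \<exists>w\<in>Z. t = s \<otimes> w" if S: "S \<subseteq> V" "card S \<ge> 2" and t: "t \<in> V" for S t
    proof -
      obtain s1 s2 where s: "s1 \<in> S" "s2 \<in> S" "s1 \<noteq> s2"
        using S(2) by (metis One_nat_def Suc_1 card_le_Suc_iff card_le_Suc0_iff_eq card.infinite
            not_less_eq_eq zero_le le0)
      obtain w1 where w1: "w1 \<in> V" "t = s1 \<otimes> w1" using V_divide s S t by blast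
      obtain w2 where w2: "w2 \<in> V" "t = s2 \<otimes> w2" using V_divide s S t by blast
      have "w1 \<noteq> w2"
      proof
        assume "w1 = w2"
        then have "s1 \<otimes> w1 = s2 \<otimes> w1" using w1 w2 by simp
        then show False using s S w1 V_closed by (simp add: mult_right_cancel subset_iff)
      qed
      then have "w1 \<in> Z \<or> w2 \<in> Z" using w1 w2 unfolding Z_def by blast
      then show ?thesis using s w1 w2 by blast
    qed
    have Z: "Z \<in> carrier (Pfin1 G)" using u V_Pfin1 by (auto simp: Z_def mem_Pfin1)
    then have Z1: "\<one> \<in> Z" by (simp add: mem_Pfin1)
    have ZV: "Z <#> V = V"
    proof
      show "Z <#> V \<subseteq> V" using V_idem unfolding Z_def set_mult_def by blast
      show "V \<subseteq> Z <#> V"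
      proof
        fix t assume t: "t \<in> V"
        then have "\<one> \<otimes> t \<in> Z <#> V" using Z1 by (intro set_multI)
        then show "t \<in> Z <#> V" using t V_closed by simp
      qed
    qed
    have "X <#> Z = {\<one>, x} <#> V"
    proof
      show "X <#> Z \<subseteq> {\<one>, x} <#> V" using X'(4) unfolding Z_def set_mult_def by blast
      show "{\<one>, x} <#> V \<subseteq> X <#> Z"
      proof
        fix z assume "z \<in> {\<one>, x} <#> V"
        then consider "z \<in> V" | t where "t \<in> V" "z = x \<otimes> t" by (auto simp: pair_mult_V[OF xc])
        then show "z \<in> X <#> Z"
        proof cases
          case a: 1
          then obtain s w where "s \<in> A" "w \<in> Z" "z = s \<otimes> w" using hit[OF AB(1) 3(1)] by blast
          then show ?thesis unfolding A_def by (auto intro: set_multI)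
        next
          case b: 2
          then obtain s w where sw: "s \<in> B" "w \<in> Z" "t = s \<otimes> w" using hit[OF AB(2) 3(2)] by blast
          then have "(x \<otimes> s) \<otimes> w \<in> X <#> Z" unfolding B_def by (auto intro: set_multI)
          moreover have "(x \<otimes> s) \<otimes> w = z" using b sw AB V_closed xc
            unfolding Z_def by (auto simp: m_assoc)
          ultimately show ?thesis by simp
        qed
      qed
    qed
    then have "Z = V" using X Z ZV by (simp add: thick_def)
    then show ?thesis using u by (auto simp: Z_def)
  qed
qed

text \<open>This property separates the sets \<open>V \<union> {xv}\<close> from \<open>{1} \<union> xV\<close>.\<close>

lemma thick_top_square:
  assumes x: "infinite_order G x" and v: "v \<in> V" and u: "u \<in> V" "u \<noteq> \<one>"
  shows "\<exists>X Y. thick G V x X \<and> thick G V x Y \<and> X \<noteq> insert (x \<otimes> v) V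
    \<and> X <#> Y = insert (x \<otimes> v) V <#> insert (x \<otimes> v) V"
proof -
  have xc: "x \<in> carrier G" using x infinite_order_closed by blast
  \<comment> \<open>\<open>t\<close> is the inverse of \<open>u\<close>, so
    \<open>(x v u)(x v t)\<close> equals \<open>(x v)^2\<close>. The product of two top sets depends
    only on this corner element, which gives the second factorization.\<close>
  obtain t where t: "t \<in> V" "\<one> = u \<otimes> t" using V_divide u V_one by blast
  have cl: "x \<in> carrier G" "v \<in> carrier G" "u \<in> carrier G" "t \<in> carrier G" using xc v u t V_closed by auto
  have vu: "v \<otimes> u \<in> V" "v \<otimes> t \<in> V" using v u t V_mult by auto
  have form: "insert (x \<otimes> a) V <#> insert (x \<otimes> b) V
      = V \<union> (\<lambda>v. x \<otimes> v) ` V \<union> {(x \<otimes> a) \<otimes> (x \<otimes> b)}" if "a \<in> V" "b \<in> V" for a b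
  proof -
    have 1: "(\<lambda>w. (x \<otimes> c) \<otimes> w) ` V = (\<lambda>v. x \<otimes> v) ` V" if "c \<in> V" for c
    proof -
      have "(\<lambda>w. (x \<otimes> c) \<otimes> w) ` V = (\<lambda>v. x \<otimes> v) ` ((\<lambda>w. c \<otimes> w) ` V)"
        unfolding image_image using V_closed that xc by (intro image_cong) (auto simp: m_assoc)
      then show ?thesis using V_translate[OF that] by simp
    qed
    have 2: "(\<lambda>w. w \<otimes> (x \<otimes> c)) ` V = (\<lambda>w. (x \<otimes> c) \<otimes> w) ` V" if "c \<in> V" for c
      using V_closed that xc by (intro image_cong) (auto simp: m_comm)
    have "insert (x \<otimes> a) V <#> insert (x \<otimes> b) V = (V <#> V) \<union> (\<lambda>w. w \<otimes> (x \<otimes> b)) ` V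
        \<union> (\<lambda>w. (x \<otimes> a) \<otimes> w) ` V \<union> {(x \<otimes> a) \<otimes> (x \<otimes> b)}"
      unfolding set_mult_def by blast
    then show ?thesis using that by (simp add: V_idem 1 2)
  qed
  have "(x \<otimes> (v \<otimes> u)) \<otimes> (x \<otimes> (v \<otimes> t)) = (x \<otimes> v) \<otimes> (x \<otimes> v) \<otimes> (u \<otimes> t)"
    using cl by (simp add: m_ac)
  then have "insert (x \<otimes> (v \<otimes> u)) V <#> insert (x \<otimes> (v \<otimes> t)) V = insert (x \<otimes> v) V <#> insert (x \<otimes> v) V"
    using t(2)[symmetric] cl by (simp add: form vu v)
  moreover have "insert (x \<otimes> (v \<otimes> u)) V \<noteq> insert (x \<otimes> v) V"
  proof
    assume "insert (x \<otimes> (v \<otimes> u)) V = insert (x \<otimes> v) V"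
    then have "x \<otimes> (v \<otimes> u) = x \<otimes> v" using row_unique0(1)[OF x vu(1)] by blast
    then show False using row_unique0(2)[OF x vu(1) v] cl u by (simp add: mult_eq_self_right)
  qed
  ultimately show ?thesis using thick_top[OF x vu(1)] thick_top[OF x vu(2)] by blast
qed

text \<open>The square of \<open>{1}\<close> joined with \<open>x V\<close> meets \<open>V\<close>
  only in 1. A thick factor of top shape would contain all of \<open>V\<close>, so the product would
  contain \<open>u\<close>.\<close>

lemma thick_bottom_square:
  assumes x: "infinite_order G x" and u: "u \<in> V" "u \<noteq> \<one>"
    and X: "thick G V x X" and Y: "Y \<in> carrier (Pfin1 G)"
    and eq: "X <#> Y = insert \<one> ((\<lambda>v. x \<otimes> v) ` V) <#> insert \<one> ((\<lambda>v. x \<otimes> v) ` V)"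
  shows "X = insert \<one> ((\<lambda>v. x \<otimes> v) ` V)"
proof (rule ccontr)
  assume "X \<noteq> insert \<one> ((\<lambda>v. x \<otimes> v) ` V)"
  then have "u \<in> X" using thick_cases[OF x X u] u by blast
  then have "u \<otimes> \<one> \<in> X <#> Y" using Y by (intro set_multI) (auto simp: mem_Pfin1)
  then have "u \<in> X <#> Y" using u V_closed by simp
  then obtain p q where pq: "p \<in> insert \<one> ((\<lambda>v. x \<otimes> v) ` V)" "q \<in> insert \<one> ((\<lambda>v. x \<otimes> v) ` V)" "u = p \<otimes> q"
    unfolding eq mem_set_mult by blast
  have xc: "x \<in> carrier G" using x infinite_order_closed by blast
  have no1: "u \<noteq> x \<otimes> v" if "v \<in> V" for v using row_unique0(1)[OF x that u(1)] by metis
  have no2: "u \<noteq> (x \<otimes> v) \<otimes> (x \<otimes> w)" if "v \<in> V" "w \<in> V" for v w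
  proof
    assume "u = (x \<otimes> v) \<otimes> (x \<otimes> w)"
    then have "x [^] (0::nat) \<otimes> u = x [^] (2::nat) \<otimes> (v \<otimes> w)"
      using that u V_closed xc by (simp add: numeral_2_eq_2 m_ac)
    then show False using row_unique[OF x u(1) V_mult[OF that]] by fastforce
  qed
  have pqc: "p \<in> carrier G" "q \<in> carrier G" using pq(1,2) V_closed xc by auto
  have "p = \<one> \<Longrightarrow> u = q" "q = \<one> \<Longrightarrow> u = p" using pq(3) pqc by simp_all
  then show False using pq u(2) no1 no2 by blast
qed

end

lemma (in comm_monoid_cancel) torsion_powers_submonoid:
  assumes "t \<in> carrier G" "\<not> infinite_order G t"
  shows "finite_submonoid G (range (\<lambda>i::nat. t [^] i))"
proof -
  obtain n :: nat where n: "n > 0" "t [^] n = \<one>" using assms not_infinite_orderE by blast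
  have "finite (range (\<lambda>i::nat. t [^] i))" using finite_range_pow[OF assms(1) n(2,1)] .
  moreover have "\<one> \<in> range (\<lambda>i::nat. t [^] i)" using rangeI[of "\<lambda>i::nat. t [^] i" 0] by simp
  ultimately have P: "range (\<lambda>i::nat. t [^] i) \<in> carrier (Pfin1 G)" using assms by (auto simp: mem_Pfin1)
  have "range (\<lambda>i::nat. t [^] i) <#> range (\<lambda>i::nat. t [^] i) = range (\<lambda>i::nat. t [^] i)" (is "?V <#> ?V = ?V")
  proof (rule equalityI; rule subsetI)
    fix z assume "z \<in> ?V <#> ?V"
    then obtain i j :: nat where "z = t [^] i \<otimes> t [^] j" by (auto simp: mem_set_mult)
    then have "z = t [^] (i + j)" using assms by (simp add: pow_add)
    then show "z \<in> ?V" by blast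
  next
    fix z assume z: "z \<in> ?V"
    then have "z \<otimes> \<one> \<in> ?V <#> ?V" using P by (intro set_multI) (auto simp: mem_Pfin1)
    then show "z \<in> ?V <#> ?V" using z assms by auto
  qed
  then show ?thesis using P
    by (intro finite_submonoid.intro finite_submonoid_axioms.intro comm_monoid_cancel_axioms)
qed

subsection \<open>Two-element sets and cardinalities\<close>

text \<open>The assumptions are symmetric in \<open>H\<close> and \<open>K\<close>, so every result
  also applies to the inverse of \<open>f\<close>; this turns preservation statements into
  equivalences.\<close>

locale pfin_iso = H: comm_monoid_cancel H + K: comm_monoid_cancel K
  for H :: "('a, 'm) monoid_scheme" and K :: "('b, 'n) monoid_scheme" +
  fixes f :: "'a set \<Rightarrow> 'b set"
  assumes f_iso: "f \<in> iso (Pfin1 H) (Pfin1 K)"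
    and ex_infinite_H: "\<exists>x. infinite_order H x"
    and ex_infinite_K: "\<exists>y. infinite_order K y"
begin

abbreviation PH where "PH \<equiv> carrier (Pfin1 H)"
abbreviation PK where "PK \<equiv> carrier (Pfin1 K)"
abbreviation oneH ("\<one>\<^sub>H") where "\<one>\<^sub>H \<equiv> \<one>\<^bsub>H\<^esub>"
abbreviation oneK ("\<one>\<^sub>K") where "\<one>\<^sub>K \<equiv> \<one>\<^bsub>K\<^esub>"
abbreviation multH (infixl "\<cdot>" 70) where "x \<cdot> y \<equiv> x \<otimes>\<^bsub>H\<^esub> y"
abbreviation multK (infixl "\<star>" 70) where "x \<star> y \<equiv> x \<otimes>\<^bsub>K\<^esub> y"
abbreviation smultH (infixl "\<odot>" 70) where "X \<odot> Y \<equiv> X <#>\<^bsub>H\<^esub> Y"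
abbreviation smultK (infixl "\<circledast>" 70) where "X \<circledast> Y \<equiv> X <#>\<^bsub>K\<^esub> Y"
abbreviation g where "g \<equiv> pullback H K f"

lemma bij_f: "bij_betw f PH PK"
  using f_iso by (simp add: iso_def)

lemma f_closed: "X \<in> PH \<Longrightarrow> f X \<in> PK"
  using bij_f bij_betwE by blast

lemma f_mult: "X \<in> PH \<Longrightarrow> Y \<in> PH \<Longrightarrow> f (X \<odot> Y) = f X \<circledast> f Y"
  using f_iso hom_mult[of f "Pfin1 H" "Pfin1 K" X Y] by (simp add: iso_def mult_Pfin1)

lemma f_inj: "X \<in> PH \<Longrightarrow> Y \<in> PH \<Longrightarrow> f X = f Y \<longleftrightarrow> X = Y"
  using bij_f by (auto simp: bij_betw_def inj_on_def)

lemma f_surj: "Y \<in> PK \<Longrightarrow> \<exists>X\<in>PH. f X = Y"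
  using bij_f unfolding bij_betw_def by (metis imageE)

lemma f_one: "f {\<one>\<^sub>H} = {\<one>\<^sub>K}"
proof -
  have "monoid (Pfin1 H)" "monoid (Pfin1 K)"
    using comm_monoid_Pfin1[OF H.comm_monoid_axioms] comm_monoid_Pfin1[OF K.comm_monoid_axioms]
    by (simp_all add: comm_monoid.axioms(1))
  then show ?thesis using monoid_iso_one[OF _ _ f_iso] by (simp add: one_Pfin1)
qed

lemma swap: "pfin_iso K H (inv_into PH f)"
proof -
  have "inv_into PH f \<in> iso (Pfin1 K) (Pfin1 H)"
    unfolding iso_def
  proof (intro CollectI conjI)
    show b: "bij_betw (inv_into PH f) PK PH" using bij_f by (rule bij_betw_inv_into)
    show "inv_into PH f \<in> hom (Pfin1 K) (Pfin1 H)"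
    proof (rule homI)
      fix X assume "X \<in> PK"
      then show "inv_into PH f X \<in> PH" using b bij_betwE by blast
    next
      fix X Y assume XY: "X \<in> PK" "Y \<in> PK"
      then obtain A B where AB: "A \<in> PH" "X = f A" "B \<in> PH" "Y = f B" using f_surj by metis
      then have "X \<otimes>\<^bsub>Pfin1 K\<^esub> Y = f (A \<odot> B)" by (simp add: f_mult mult_Pfin1)
      moreover have "A \<odot> B \<in> PH" using AB H.Pfin1_mult_closed by blast
      moreover have inj: "inj_on f PH" using bij_f by (simp add: bij_betw_def)
      ultimately show "inv_into PH f (X \<otimes>\<^bsub>Pfin1 K\<^esub> Y) = inv_into PH f X \<otimes>\<^bsub>Pfin1 H\<^esub> inv_into PH f Y"
        using AB by (simp add: inv_into_f_f mult_Pfin1)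
    qed
  qed
  then show ?thesis
    using ex_infinite_H ex_infinite_K
    by (intro pfin_iso.intro pfin_iso_axioms.intro H.comm_monoid_cancel_axioms K.comm_monoid_cancel_axioms)
qed

lemma inv_f: "X \<in> PH \<Longrightarrow> inv_into PH f (f X) = X"
  using bij_f by (simp add: bij_betw_def inv_into_f_f)

lemma f_seg:
  assumes "x \<in> carrier H" "y \<in> carrier K" "f {\<one>\<^sub>H, x} = {\<one>\<^sub>K, y}"
  shows "f (seg H x n) = seg K y n"
proof (induction n)
  case 0
  then show ?case by (simp add: H.seg_0 K.seg_0 f_one)
next
  case (Suc n)
  then show ?case
    using assms by (simp add: H.seg_Suc K.seg_Suc f_mult H.seg_Pfin1 H.pair_Pfin1)
qed

text \<open>For any \<open>Y\<close> and \<open>y \<in> Y\<close> with \<open>y \<noteq> 1\<close>, removing \<open>y\<close> from \<open>Y\<^sup>2\<close> does not change the product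
  with \<open>Y\<close>; hence \<open>Z Y = Y\<^sup>3\<close> has at least \<open>card Y\<close> solutions \<open>Z\<close>, while it has exactly two
  for \<open>Y = {1, x}\<close> when \<open>x\<close> has infinite order.\<close>

lemma cube_remove:
  assumes "Y \<in> PK" "y \<in> Y" "y \<noteq> \<one>\<^sub>K"
  shows "(Y \<circledast> Y - {y}) \<circledast> Y = (Y \<circledast> Y) \<circledast> Y"
proof (rule equalityI)
  show "(Y \<circledast> Y - {y}) \<circledast> Y \<subseteq> (Y \<circledast> Y) \<circledast> Y"
    unfolding set_mult_def by blast
  have Y: "Y \<subseteq> carrier K" "\<one>\<^sub>K \<in> Y" using assms(1) by (auto simp: mem_Pfin1)
  show "(Y \<circledast> Y) \<circledast> Y \<subseteq> (Y \<circledast> Y - {y}) \<circledast> Y"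
  proof
    fix z assume "z \<in> (Y \<circledast> Y) \<circledast> Y"
    then obtain w c where w: "w \<in> Y \<circledast> Y" "c \<in> Y" "z = w \<star> c" by (auto simp: mem_set_mult)
    have c: "c \<in> carrier K" "y \<in> carrier K" using w Y assms by auto
    show "z \<in> (Y \<circledast> Y - {y}) \<circledast> Y"
    proof (cases "w = y")
      case False
      then show ?thesis using w by (auto intro: set_multI)
    next
      case wy: True
      show ?thesis
      proof (cases "c = \<one>\<^sub>K")
        case True
        have "\<one>\<^sub>K \<star> \<one>\<^sub>K \<in> Y \<circledast> Y" using Y by (intro set_multI)
        then have "\<one>\<^sub>K \<in> Y \<circledast> Y - {y}" using assms(3) by simp
        then have "\<one>\<^sub>K \<star> y \<in> (Y \<circledast> Y - {y}) \<circledast> Y" using assms by (intro set_multI)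
        then show ?thesis using w wy True c by simp
      next
        case False
        then have "y \<star> c \<in> Y \<circledast> Y - {y}"
          using w assms c by (auto simp: K.mult_eq_self_right intro: set_multI)
        then have "(y \<star> c) \<star> \<one>\<^sub>K \<in> (Y \<circledast> Y - {y}) \<circledast> Y" using Y by (intro set_multI)
        then show ?thesis using w wy c by simp
      qed
    qed
  qed
qed

text \<open>The top power \<open>x^3\<close> can only arise as \<open>x^2 x\<close>, so
  \<open>x^2\<close> belongs to \<open>Z\<close>; whether \<open>x\<close> does is the one remaining
  choice.\<close>

lemma cube_solutions:
  assumes "infinite_order H x" "Z \<in> PH" "Z \<odot> {\<one>\<^sub>H, x} = seg H x 3"
  shows "Z = seg H x 2 \<or> Z = {\<one>\<^sub>H, x [^]\<^bsub>H\<^esub> (2::nat)}"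
proof -
  have xc: "x \<in> carrier H" using assms(1) H.infinite_order_closed by blast
  have Z: "Z \<subseteq> carrier H" "\<one>\<^sub>H \<in> Z" using assms(2) by (auto simp: mem_Pfin1)
  have sub: "Z \<subseteq> seg H x 2"
  proof
    fix z assume z: "z \<in> Z"
    then have zc: "z \<in> carrier H" using Z by blast
    have "z \<cdot> \<one>\<^sub>H \<in> seg H x 3" "z \<cdot> x \<in> seg H x 3"
      unfolding assms(3)[symmetric] using z by (auto intro: set_multI)
    then obtain i j :: nat where ij: "z = x [^]\<^bsub>H\<^esub> i" "j \<le> 3" "z \<cdot> x = x [^]\<^bsub>H\<^esub> j"
      using zc by (auto simp: seg_def)
    then have "x [^]\<^bsub>H\<^esub> Suc i = x [^]\<^bsub>H\<^esub> j" by simp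
    then have "Suc i = j" using assms(1) H.infinite_order_inj by blast
    then show "z \<in> seg H x 2" using ij H.seg_in[of i 2 x] by simp
  qed
  have "x [^]\<^bsub>H\<^esub> (3::nat) \<in> Z \<odot> {\<one>\<^sub>H, x}" unfolding assms(3) by (intro H.seg_in) simp
  then obtain z where z: "z \<in> Z" "x [^]\<^bsub>H\<^esub> (3::nat) = z \<cdot> \<one>\<^sub>H \<or> x [^]\<^bsub>H\<^esub> (3::nat) = z \<cdot> x"
    by (auto simp: mem_set_mult)
  obtain i :: nat where i: "z = x [^]\<^bsub>H\<^esub> i" "i \<le> 2" using z sub by (auto simp: seg_def)
  have "3 = i \<or> 3 = Suc i" using z i xc H.infinite_order_inj[OF assms(1), of 3 i]
      H.infinite_order_inj[OF assms(1), of 3 "Suc i"] by auto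
  then have "i = 2" using i by auto
  then have "x [^]\<^bsub>H\<^esub> (2::nat) \<in> Z" using z i by simp
  moreover have "seg H x 2 = {\<one>\<^sub>H, x, x [^]\<^bsub>H\<^esub> (2::nat)}"
    using xc H.seg_2[of x] by (simp add: numeral_2_eq_2)
  ultimately show ?thesis using sub Z by auto
qed

text \<open>Arbitrary two-element sets have to wait for the preservation of cardinalities, whose
  proof already needs a pair \<open>{1, z}\<close> with known image. Elements of infinite order
  break this circle.\<close>

lemma infinite_pair_image:
  assumes "infinite_order H x"
  shows "\<exists>y. infinite_order K y \<and> f {\<one>\<^sub>H, x} = {\<one>\<^sub>K, y}"
proof -
  have xc: "x \<in> carrier H" using assms H.infinite_order_closed by blast
  have x1: "x \<noteq> \<one>\<^sub>H" using assms H.infinite_order_not_one by blast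
  define X where "X = {\<one>\<^sub>H, x}"
  have X: "X \<in> PH" using xc by (simp add: X_def H.pair_Pfin1)
  define Y where "Y = f X"
  have Y: "Y \<in> PK" unfolding Y_def using X by (rule f_closed)
  then have Y': "finite Y" "Y \<subseteq> carrier K" "\<one>\<^sub>K \<in> Y" by (auto simp: mem_Pfin1)
  have YY: "Y \<circledast> Y \<in> PK" using Y K.Pfin1_mult_closed by blast
  have X3: "(X \<odot> X) \<odot> X = seg H x 3"
    using H.seg_Suc[OF xc, of 0] H.seg_Suc[OF xc, of 1] H.seg_Suc[OF xc, of 2] H.seg_1[OF xc]
    by (simp add: X_def numeral_3_eq_3 numeral_2_eq_2)
  have Y3: "f (seg H x 3) = (Y \<circledast> Y) \<circledast> Y"
    unfolding X3[symmetric] Y_def using X H.Pfin1_mult_closed by (simp add: f_mult)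
  have sol: "f Z = f (seg H x 2) \<or> f Z = f {\<one>\<^sub>H, x [^]\<^bsub>H\<^esub> (2::nat)}"
    if Z: "Z \<in> PH" "f Z \<circledast> Y = (Y \<circledast> Y) \<circledast> Y" for Z
  proof -
    have "f (Z \<odot> X) = f (seg H x 3)" using Z X Y3 by (simp add: f_mult Y_def)
    then have "Z \<odot> X = seg H x 3" using f_inj Z X H.Pfin1_mult_closed H.seg_Pfin1[OF xc] by metis
    then show ?thesis using cube_solutions[OF assms Z(1)] unfolding X_def by blast
  qed
  have sol': "W = f (seg H x 2) \<or> W = f {\<one>\<^sub>H, x [^]\<^bsub>H\<^esub> (2::nat)}"
    if "W \<in> PK" "W \<circledast> Y = (Y \<circledast> Y) \<circledast> Y" for W
    using sol f_surj that by metis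
  have rem: "Y \<circledast> Y - {y} \<in> PK" if "y \<noteq> \<one>\<^sub>K" for y
    using YY that by (auto simp: mem_Pfin1)
  \<comment> \<open>\<open>Y^2\<close>, \<open>Y^2 - {y1}\<close> and \<open>Y^2 - {y2}\<close> all
    solve the cubic equation. For distinct \<open>y1\<close>, \<open>y2\<close> they would be three
    different sets, but only two solutions exist.\<close>
  have unique: "y1 = y2" if y: "y1 \<in> Y" "y1 \<noteq> \<one>\<^sub>K" "y2 \<in> Y" "y2 \<noteq> \<one>\<^sub>K" for y1 y2
  proof -
    have inYY: "y \<in> Y \<circledast> Y" if "y \<in> Y" for y
      using set_multI[OF that Y'(3), of K] that Y'(2) by auto
    note s0 = sol'[OF YY refl]
    note s1 = sol'[OF rem[OF y(2)] cube_remove[OF Y y(1,2)]]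
    note s2 = sol'[OF rem[OF y(4)] cube_remove[OF Y y(3,4)]]
    show ?thesis using s0 s1 s2 inYY[OF y(1)] inYY[OF y(3)] by (metis Diff_iff singletonD singletonI)
  qed
  have "Y \<noteq> {\<one>\<^sub>K}"
  proof
    assume "Y = {\<one>\<^sub>K}"
    then have "f X = f {\<one>\<^sub>H}" by (simp add: f_one Y_def)
    then have "X = {\<one>\<^sub>H}" using f_inj X by (simp add: mem_Pfin1)
    then show False using x1 by (simp add: X_def)
  qed
  then obtain y where y: "y \<in> Y" "y \<noteq> \<one>\<^sub>K" using Y' by blast
  have Yy: "Y = {\<one>\<^sub>K, y}"
  proof (rule equalityI; rule subsetI)
    fix z assume "z \<in> Y"
    then show "z \<in> {\<one>\<^sub>K, y}" using unique[of z y] y by blast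
  next
    fix z assume "z \<in> {\<one>\<^sub>K, y}"
    then show "z \<in> Y" using y Y' by blast
  qed
  have yc: "y \<in> carrier K" using y Y' by blast
  have fs: "f (seg H x n) = seg K y n" for n
    using f_seg[OF xc yc] Yy by (simp add: X_def Y_def)
  \<comment> \<open>If \<open>y^n = 1\<close> with \<open>n > 0\<close>, the segments of
    \<open>y\<close> would stop growing at \<open>n - 1\<close>, while those of \<open>x\<close>
    grow strictly.\<close>
  have "infinite_order K y"
  proof (rule K.infinite_orderI[OF yc])
    fix n :: nat assume n: "y [^]\<^bsub>K\<^esub> n = \<one>\<^sub>K"
    show "n = 0"
    proof (rule ccontr)
      assume "n \<noteq> 0"
      then obtain m where m: "n = Suc m" by (cases n) auto
      have "seg K y n = seg K y m"
      proof -
        have "seg K y n = insert (y [^]\<^bsub>K\<^esub> n) (seg K y m)"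
          unfolding seg_def m by (simp add: atMost_Suc del: nat_pow_Suc)
        also have "\<dots> = seg K y m" using K.seg_Pfin1[OF yc, of m] n by (auto simp: mem_Pfin1)
        finally show ?thesis .
      qed
      then have "seg H x n = seg H x m" using fs f_inj H.seg_Pfin1[OF xc] by metis
      then have "x [^]\<^bsub>H\<^esub> n \<in> seg H x m" using H.seg_in[of n n x] by simp
      then obtain i :: nat where "i \<le> m" "x [^]\<^bsub>H\<^esub> n = x [^]\<^bsub>H\<^esub> i" by (auto simp: seg_def)
      then show False using m H.infinite_order_inj[OF assms, of n i] by simp
    qed
  qed
  then show ?thesis using Yy unfolding X_def Y_def by blast
qed

text \<open>The element \<open>x^(n+1)\<close> is recognised by
  \<open>{1, x^(n+1)} seg n = seg (2n+1)\<close>: two blocks of length \<open>n+1\<close> tile an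
  interval of length \<open>2n+2\<close> without gap or overlap.\<close>

lemma infinite_pair_pow:
  assumes "infinite_order H x" "infinite_order K y" "f {\<one>\<^sub>H, x} = {\<one>\<^sub>K, y}"
  shows "f {\<one>\<^sub>H, x [^]\<^bsub>H\<^esub> Suc n} = {\<one>\<^sub>K, y [^]\<^bsub>K\<^esub> Suc n}"
proof -
  have xc: "x \<in> carrier H" "y \<in> carrier K"
    using assms H.infinite_order_closed K.infinite_order_closed by auto
  obtain w where w: "infinite_order K w" "f {\<one>\<^sub>H, x [^]\<^bsub>H\<^esub> Suc n} = {\<one>\<^sub>K, w}"
    using infinite_pair_image[OF H.infinite_order_pow[OF assms(1)]] by blast
  have wc: "w \<in> carrier K" using w K.infinite_order_closed by blast
  have "{\<one>\<^sub>H, x [^]\<^bsub>H\<^esub> Suc n} \<odot> seg H x n = seg H x (Suc n + n)"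
  proof (rule equalityI; rule subsetI)
    fix z assume "z \<in> {\<one>\<^sub>H, x [^]\<^bsub>H\<^esub> Suc n} \<odot> seg H x n"
    then obtain a and i :: nat where ai: "a \<in> {\<one>\<^sub>H, x [^]\<^bsub>H\<^esub> Suc n}" "i \<le> n" "z = a \<cdot> x [^]\<^bsub>H\<^esub> i"
      by (auto simp: mem_set_mult seg_def simp del: nat_pow_Suc)
    then consider "z = x [^]\<^bsub>H\<^esub> i" | "z = x [^]\<^bsub>H\<^esub> (Suc n + i)"
      using xc by (auto simp: H.pow_add simp del: nat_pow_Suc add_Suc)
    then show "z \<in> seg H x (Suc n + n)"
      using ai(2) H.seg_in[of i "Suc n + n" x] H.seg_in[of "Suc n + i" "Suc n + n" x] by cases auto
  next
    fix z assume "z \<in> seg H x (Suc n + n)"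
    then obtain k :: nat where k: "k \<le> Suc n + n" "z = x [^]\<^bsub>H\<^esub> k" by (auto simp: seg_def)
    show "z \<in> {\<one>\<^sub>H, x [^]\<^bsub>H\<^esub> Suc n} \<odot> seg H x n"
    proof (cases "k \<le> n")
      case True
      then have "\<one>\<^sub>H \<cdot> x [^]\<^bsub>H\<^esub> k \<in> {\<one>\<^sub>H, x [^]\<^bsub>H\<^esub> Suc n} \<odot> seg H x n" by (intro set_multI H.seg_in) auto
      then show ?thesis using xc k by simp
    next
      case False
      then have "x [^]\<^bsub>H\<^esub> Suc n \<cdot> x [^]\<^bsub>H\<^esub> (k - Suc n) \<in> {\<one>\<^sub>H, x [^]\<^bsub>H\<^esub> Suc n} \<odot> seg H x n"
        using k by (intro set_multI H.seg_in) auto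
      moreover have "x [^]\<^bsub>H\<^esub> Suc n \<cdot> x [^]\<^bsub>H\<^esub> (k - Suc n) = z"
        using False k xc H.pow_add[of x "Suc n" "k - Suc n"] by (simp del: nat_pow_Suc)
      ultimately show ?thesis by simp
    qed
  qed
  then have eq: "{\<one>\<^sub>K, w} \<circledast> seg K y n = seg K y (Suc n + n)"
    using f_mult[of "{\<one>\<^sub>H, x [^]\<^bsub>H\<^esub> Suc n}" "seg H x n"] w f_seg[OF xc assms(3)] xc
    by (simp add: H.pair_Pfin1 H.seg_Pfin1 del: nat_pow_Suc)
  have "w \<star> y [^]\<^bsub>K\<^esub> (0::nat) \<in> {\<one>\<^sub>K, w} \<circledast> seg K y n" by (intro set_multI K.seg_in) auto
  then obtain j :: nat where j: "w = y [^]\<^bsub>K\<^esub> j"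
    unfolding eq using wc by (auto simp: seg_def)
  have split: "\<exists>i\<le>n. k = i \<or> k = j + i" if k: "k \<le> Suc n + n" for k
  proof -
    have "y [^]\<^bsub>K\<^esub> k \<in> {\<one>\<^sub>K, w} \<circledast> seg K y n" unfolding eq using k by (rule K.seg_in)
    then obtain i :: nat where i: "i \<le> n" "y [^]\<^bsub>K\<^esub> k = \<one>\<^sub>K \<star> y [^]\<^bsub>K\<^esub> i \<or> y [^]\<^bsub>K\<^esub> k = w \<star> y [^]\<^bsub>K\<^esub> i"
      by (auto simp: mem_set_mult seg_def)
    then have "y [^]\<^bsub>K\<^esub> k = y [^]\<^bsub>K\<^esub> i \<or> y [^]\<^bsub>K\<^esub> k = y [^]\<^bsub>K\<^esub> (j + i)"
      using xc by (auto simp: j K.pow_add)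
    then show ?thesis using i K.infinite_order_inj[OF assms(2)] by blast
  qed
  \<comment> \<open>Covering exponent \<open>n+1\<close> gives \<open>j <= n+1\<close>, and covering
    \<open>2n+1\<close> gives \<open>j >= n+1\<close>.\<close>
  have "j = Suc n" using split[of "Suc n"] split[of "Suc n + n"] by auto
  then show ?thesis using w j by simp
qed

text \<open>The equation counted in \<open>step_free_count\<close> is formulated by products only,
  so it has equally many solutions on both sides, and the counts are powers of two with exponents
  \<open>card X\<close> and \<open>card (f X)\<close>.\<close>

lemma card_image_f:
  assumes "X \<in> PH" shows "card (f X) = card X"
proof -
  obtain x where x: "infinite_order H x" using ex_infinite_H by blast
  obtain y where y: "infinite_order K y" "f {\<one>\<^sub>H, x} = {\<one>\<^sub>K, y}" using infinite_pair_image[OF x] by blast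
  have X: "finite X" "X \<subseteq> carrier H" using assms by (auto simp: mem_Pfin1)
  have fX: "f X \<in> PK" using assms f_closed by blast
  then have fX': "finite (f X)" "f X \<subseteq> carrier K" by (auto simp: mem_Pfin1)
  obtain M :: nat where M: "\<And>n::nat. n \<ge> M \<Longrightarrow> n > 0 \<Longrightarrow> step_free H (x [^]\<^bsub>H\<^esub> n) X"
    using H.step_free_pow[OF x X] by metis
  obtain N :: nat where N: "\<And>n::nat. n \<ge> N \<Longrightarrow> n > 0 \<Longrightarrow> step_free K (y [^]\<^bsub>K\<^esub> n) (f X)"
    using K.step_free_pow[OF y(1) fX'] by metis
  \<comment> \<open>One positive exponent beyond both bounds makes the power step-free for
    \<open>X\<close> and, simultaneously, the matching power in \<open>K\<close> step-free for
    \<open>f X\<close>.\<close>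
  define z where "z = x [^]\<^bsub>H\<^esub> Suc (M + N)"
  define w where "w = y [^]\<^bsub>K\<^esub> Suc (M + N)"
  have zc: "z \<in> carrier H" unfolding z_def using x H.infinite_order_closed by blast
  have wc: "w \<in> carrier K" unfolding w_def using y K.infinite_order_closed by blast
  have zw: "f {\<one>\<^sub>H, z} = {\<one>\<^sub>K, w}" unfolding z_def w_def using infinite_pair_pow[OF x y] .
  have free: "step_free H z X" "step_free K w (f X)"
    unfolding z_def w_def by (rule M; simp) (rule N; simp)
  define A where "A = {Z \<in> PH. Z \<odot> {\<one>\<^sub>H, z} = X \<odot> seg H z 3}"
  define B where "B = {Z \<in> PK. Z \<circledast> {\<one>\<^sub>K, w} = f X \<circledast> seg K w 3}"
  have iff: "Z \<in> A \<longleftrightarrow> f Z \<in> B" if "Z \<in> PH" for Z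
  proof -
    have "f (Z \<odot> {\<one>\<^sub>H, z}) = f Z \<circledast> {\<one>\<^sub>K, w}" "f (X \<odot> seg H z 3) = f X \<circledast> seg K w 3"
      using that assms zw zc f_seg[OF zc wc zw] by (simp_all add: f_mult H.pair_Pfin1 H.seg_Pfin1)
    moreover have "Z \<odot> {\<one>\<^sub>H, z} \<in> PH" "X \<odot> seg H z 3 \<in> PH"
      using that assms zc by (simp_all add: H.Pfin1_mult_closed H.pair_Pfin1 H.seg_Pfin1)
    ultimately show ?thesis using f_inj[of "Z \<odot> {\<one>\<^sub>H, z}" "X \<odot> seg H z 3"] that f_closed
      unfolding A_def B_def by simp
  qed
  have "bij_betw f A B"
  proof (rule bij_betw_imageI)
    show "inj_on f A" using f_inj by (auto simp: inj_on_def A_def)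
    show "f ` A = B"
    proof (rule equalityI; rule subsetI)
      fix W assume "W \<in> f ` A"
      then show "W \<in> B" using iff unfolding A_def by blast
    next
      fix W assume W: "W \<in> B"
      then obtain Z where "Z \<in> PH" "W = f Z" using f_surj unfolding B_def by blast
      then show "W \<in> f ` A" using iff W by blast
    qed
  qed
  then have "card A = card B" by (rule bij_betw_same_card)
  then have "(2::nat) ^ card X = 2 ^ card (f X)"
    using H.step_free_count[OF assms zc free(1)] K.step_free_count[OF fX wc free(2)]
    by (simp add: A_def B_def)
  then show ?thesis by simp
qed

section \<open>The pullback: bijectivity, powers, inverses\<close>

lemma g_pair_closed:
  assumes "x \<in> carrier H" shows "f {\<one>\<^sub>H, x} = {\<one>\<^sub>K, g x} \<and> g x \<in> carrier K"
proof (cases "x = \<one>\<^sub>H")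
  case True
  then show ?thesis by (simp add: pullback_def f_one)
next
  case False
  have P: "f {\<one>\<^sub>H, x} \<in> PK" using assms by (simp add: f_closed H.pair_Pfin1)
  have "card (f {\<one>\<^sub>H, x}) = 2" using assms False by (simp add: card_image_f H.pair_Pfin1)
  then obtain y where y: "f {\<one>\<^sub>H, x} = {\<one>\<^sub>K, y}"
    using P unfolding card_2_iff mem_Pfin1 by (metis insert_commute insert_iff singletonD)
  then have yc: "y \<in> carrier K" using P by (auto simp: mem_Pfin1)
  have "(THE b. b \<in> carrier K \<and> f {\<one>\<^sub>H, x} = {\<one>\<^sub>K, b}) = y"
    using y yc by (intro the_equality) (auto simp: doubleton_eq_iff)
  then show ?thesis using False y yc by (simp add: pullback_def)
qed

lemma g_pair: "x \<in> carrier H \<Longrightarrow> f {\<one>\<^sub>H, x} = {\<one>\<^sub>K, g x}"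
  using g_pair_closed by blast

lemma g_closed [simp]: "x \<in> carrier H \<Longrightarrow> g x \<in> carrier K"
  using g_pair_closed by blast

lemma g_one [simp]: "g \<one>\<^sub>H = \<one>\<^sub>K"
  by (simp add: pullback_def)

lemma swap_g: "x \<in> carrier H \<Longrightarrow> pullback K H (inv_into PH f) (g x) = x"
proof -
  interpret S: pfin_iso K H "inv_into PH f" by (rule swap)
  assume x: "x \<in> carrier H"
  have "{\<one>\<^sub>H, S.g (g x)} = {\<one>\<^sub>H, x}"
    using S.g_pair[of "g x"] g_pair[OF x] x inv_f[of "{\<one>\<^sub>H, x}"] by (simp add: H.pair_Pfin1)
  then show ?thesis by (auto simp: doubleton_eq_iff)
qed

lemma g_inj: "x \<in> carrier H \<Longrightarrow> y \<in> carrier H \<Longrightarrow> g x = g y \<longleftrightarrow> x = y"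
  using swap_g by metis

lemma g_eq_one: "x \<in> carrier H \<Longrightarrow> g x = \<one>\<^sub>K \<longleftrightarrow> x = \<one>\<^sub>H"
  using g_inj[of x "\<one>\<^sub>H"] by simp

lemma g_surj: "y \<in> carrier K \<Longrightarrow> \<exists>x\<in>carrier H. g x = y"
proof -
  interpret S: pfin_iso K H "inv_into PH f" by (rule swap)
  assume y: "y \<in> carrier K"
  obtain X where X: "X \<in> PH" "f X = {\<one>\<^sub>K, y}" using f_surj K.pair_Pfin1[OF y] by blast
  then have "X = {\<one>\<^sub>H, S.g y}" using S.g_pair[OF y] inv_f[OF X(1)] by simp
  then have "{\<one>\<^sub>K, g (S.g y)} = {\<one>\<^sub>K, y}" using X g_pair[of "S.g y"] y by simp
  then have "g (S.g y) = y" by (auto simp: doubleton_eq_iff)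
  then show ?thesis using S.g_closed[OF y] by blast
qed

lemma bij_g: "bij_betw g (carrier H) (carrier K)"
proof (rule bij_betw_imageI)
  show "inj_on g (carrier H)" using g_inj by (auto simp: inj_on_def)
  show "g ` carrier H = carrier K"
  proof (rule equalityI; rule subsetI)
    fix y assume "y \<in> carrier K"
    then show "y \<in> g ` carrier H" using g_surj by (metis imageI)
  qed auto
qed

lemma f_seg_g: "x \<in> carrier H \<Longrightarrow> f (seg H x n) = seg K (g x) n"
  by (simp add: f_seg g_pair)

lemma g_infinite_imp: "infinite_order H x \<Longrightarrow> infinite_order K (g x)"
proof -
  assume x: "infinite_order H x"
  obtain y where "infinite_order K y" "f {\<one>\<^sub>H, x} = {\<one>\<^sub>K, y}" using infinite_pair_image[OF x] by blast
  moreover then have "g x = y"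
    using g_pair[of x] x H.infinite_order_closed by (auto simp: doubleton_eq_iff)
  ultimately show ?thesis by simp
qed

lemma g_pow:
  assumes "infinite_order H x" shows "g (x [^]\<^bsub>H\<^esub> (n::nat)) = g x [^]\<^bsub>K\<^esub> n"
proof (cases n)
  case (Suc m)
  have xc: "x \<in> carrier H" using assms H.infinite_order_closed by blast
  have "{\<one>\<^sub>K, g (x [^]\<^bsub>H\<^esub> Suc m)} = {\<one>\<^sub>K, g x [^]\<^bsub>K\<^esub> Suc m}"
    using infinite_pair_pow[OF assms g_infinite_imp[OF assms] g_pair[OF xc], of m]
      g_pair[of "x [^]\<^bsub>H\<^esub> Suc m"] xc by simp
  then show ?thesis using Suc by (auto simp: doubleton_eq_iff)
qed simp

lemma f_pair_mult:
  assumes "x \<in> carrier H" "y \<in> carrier H"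
  shows "f ({\<one>\<^sub>H, x} \<odot> {\<one>\<^sub>H, y}) = {\<one>\<^sub>K, g x} \<circledast> {\<one>\<^sub>K, g y}"
  using assms by (simp add: f_mult g_pair H.pair_Pfin1)

text \<open>With \<open>v\<close> the inverse of \<open>u\<close>, the element \<open>u\<close> is
  already in \<open>{1, u^2}{1, v}\<close> as \<open>u^2 v\<close>, so enlarging
  \<open>{1, u^2}\<close> to \<open>{1, u, u^2}\<close> leaves the product unchanged. After applying
  \<open>f\<close>, \<open>g u\<close> must be one of the four elements of the smaller product, and
  only \<open>g (u^2) g v = (g u)^2 g v\<close> is possible.\<close>

lemma g_inv_infinite:
  assumes "infinite_order H u" "u \<in> Units H"
  shows "g u \<star> g (inv\<^bsub>H\<^esub> u) = \<one>\<^sub>K"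
proof -
  define v where "v = inv\<^bsub>H\<^esub> u"
  have uc: "u \<in> carrier H" and vc: "v \<in> carrier H" and uv: "u \<cdot> v = \<one>\<^sub>H"
    using assms by (auto simp: v_def)
  have u2: "u [^]\<^bsub>H\<^esub> (2::nat) = u \<cdot> u" using uc by (simp add: numeral_2_eq_2)
  have uuv: "u \<cdot> u \<cdot> v = u" using uc vc uv by (simp add: H.m_assoc)
  have "{\<one>\<^sub>H, u \<cdot> u} \<odot> {\<one>\<^sub>H, v} = {\<one>\<^sub>H, u \<cdot> u, v, u}"
    using uc vc uuv by (simp add: H.pair_mult)
  also have "\<dots> = seg H u 2 \<odot> {\<one>\<^sub>H, v}"
    unfolding H.seg_2[OF uc] set_mult_def using uc vc uv uuv by auto
  finally have "f ({\<one>\<^sub>H, u \<cdot> u} \<odot> {\<one>\<^sub>H, v}) = f (seg H u 2 \<odot> {\<one>\<^sub>H, v})" by simp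
  then have "{\<one>\<^sub>K, g (u \<cdot> u)} \<circledast> {\<one>\<^sub>K, g v} = seg K (g u) 2 \<circledast> {\<one>\<^sub>K, g v}"
    using uc vc by (simp add: f_mult H.pair_Pfin1 H.seg_Pfin1 g_pair f_seg_g)
  moreover have "g u \<star> \<one>\<^sub>K \<in> seg K (g u) 2 \<circledast> {\<one>\<^sub>K, g v}"
    using uc by (intro set_multI) (auto simp: K.seg_2)
  ultimately have "g u \<in> {\<one>\<^sub>K, g (u \<cdot> u), g v, g (u \<cdot> u) \<star> g v}"
    using uc vc by (simp add: K.pair_mult)
  moreover have "g (u \<cdot> u) = g u \<star> g u"
    using g_pow[OF assms(1), of 2] uc by (simp add: numeral_2_eq_2)
  moreover have "g u \<noteq> \<one>\<^sub>K" "g u \<star> g u \<noteq> g u"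
    using uc H.infinite_order_not_one[OF assms(1)] by (auto simp: g_eq_one K.mult_eq_self_right)
  moreover have "g u \<noteq> g v"
  proof
    assume "g u = g v"
    then have "u [^]\<^bsub>H\<^esub> (2::nat) = \<one>\<^sub>H" using uc vc uv u2 by (simp add: g_inj)
    then show False using H.infinite_order_pow_one[OF assms(1)] by fastforce
  qed
  ultimately have "g u = g u \<star> (g u \<star> g v)" using uc vc by (auto simp: K.m_assoc)
  then show ?thesis using uc vc K.mult_eq_self_right(2)[of "g u" "g u \<star> g v"] by (simp add: v_def)
qed

lemma g_unit_infinite:
  assumes "infinite_order H u" shows "g u \<in> Units K \<longleftrightarrow> u \<in> Units H"
proof -
  interpret S: pfin_iso K H "inv_into PH f" by (rule swap)
  have imp: "g u \<in> Units K" if "infinite_order H u" "u \<in> Units H"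
    using g_inv_infinite[OF that] that
    by (metis H.Units_closed H.Units_inv_closed K.Units_one_closed K.unit_factor g_closed)
  have uc: "u \<in> carrier H" using assms H.infinite_order_closed by blast
  have "u \<in> Units H" if "g u \<in> Units K"
    using S.g_inv_infinite[OF g_infinite_imp[OF assms] that] uc that swap_g[OF uc]
    by (metis K.Units_inv_closed H.Units_one_closed H.unit_factor S.g_closed)
  then show ?thesis using imp assms by blast
qed

lemma g_nonunit:
  assumes "x \<in> carrier H" "x \<notin> Units H" shows "g x \<notin> Units K"
  using g_unit_infinite[OF H.nonunit_infinite_order[OF assms]] assms by blast

text \<open>The set \<open>{1, x, y, xy}{1, xy} - {xy}\<close> witnesses that \<open>{1, x, y, xy}\<close> contains two elements
  whose quotient is a power of \<open>xy\<close>.\<close>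

lemma product_step:
  assumes "x \<in> carrier H" "y \<in> carrier H" "x \<noteq> \<one>\<^sub>H" "y \<noteq> \<one>\<^sub>H" "x \<cdot> y \<noteq> \<one>\<^sub>H"
  shows "\<not> step_free K (g (x \<cdot> y)) {\<one>\<^sub>K, g x, g y, g x \<star> g y}"
proof
  assume free: "step_free K (g (x \<cdot> y)) {\<one>\<^sub>K, g x, g y, g x \<star> g y}"
  define c where "c = x \<cdot> y"
  have cc: "c \<in> carrier H" using assms by (simp add: c_def)
  define X where "X = {\<one>\<^sub>H, x, y, c}"
  have X: "X \<in> PH" using assms cc by (simp add: X_def mem_Pfin1)
  have fX: "f X = {\<one>\<^sub>K, g x, g y, g x \<star> g y}"
    using f_pair_mult[of x y] assms by (simp add: X_def c_def H.pair_mult K.pair_mult)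
  define W where "W = X \<odot> {\<one>\<^sub>H, c}"
  have W: "W \<in> PH" using X cc by (simp add: W_def H.Pfin1_mult_closed H.pair_Pfin1)
  have cW: "c \<in> W" using cc unfolding W_def X_def by (auto simp: set_mult_def)
  define Z where "Z = W - {c}"
  have Z: "Z \<in> PH" using W assms by (auto simp: Z_def c_def mem_Pfin1)
  have Wc: "w \<in> carrier H" if "w \<in> W" for w using W that by (auto simp: mem_Pfin1)
  \<comment> \<open>Removing \<open>c\<close> costs nothing: \<open>c\<close> is still obtained as
    \<open>1 c\<close>, and \<open>c c\<close> as \<open>(c c) 1\<close>.\<close>
  have "Z \<odot> {\<one>\<^sub>H, c} = W \<odot> {\<one>\<^sub>H, c}"
  proof (rule equalityI)
    show "Z \<odot> {\<one>\<^sub>H, c} \<subseteq> W \<odot> {\<one>\<^sub>H, c}" unfolding Z_def set_mult_def by blast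
    show "W \<odot> {\<one>\<^sub>H, c} \<subseteq> Z \<odot> {\<one>\<^sub>H, c}"
    proof
      fix z assume "z \<in> W \<odot> {\<one>\<^sub>H, c}"
      then obtain w e where w: "w \<in> W" "e \<in> {\<one>\<^sub>H, c}" "z = w \<cdot> e" by (auto simp: mem_set_mult)
      show "z \<in> Z \<odot> {\<one>\<^sub>H, c}"
      proof (cases "w = c")
        case False
        then show ?thesis using w unfolding Z_def by (auto intro: set_multI)
      next
        case True
        have "\<one>\<^sub>H \<in> Z" using Z by (simp add: mem_Pfin1)
        then have 1: "\<one>\<^sub>H \<cdot> c \<in> Z \<odot> {\<one>\<^sub>H, c}" by (intro set_multI) auto
        have "c \<cdot> c \<in> W" unfolding W_def X_def by (intro set_multI) auto
        moreover have "c \<cdot> c \<noteq> c" using cc assms by (simp add: H.mult_eq_self_right c_def)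
        ultimately have "c \<cdot> c \<in> Z" by (simp add: Z_def)
        then have "(c \<cdot> c) \<cdot> \<one>\<^sub>H \<in> Z \<odot> {\<one>\<^sub>H, c}" by (intro set_multI) auto
        then show ?thesis using 1 True w cc by auto
      qed
    qed
  qed
  also have "\<dots> = X \<odot> ({\<one>\<^sub>H, c} \<odot> {\<one>\<^sub>H, c})"
    unfolding W_def using X cc by (intro H.set_mult_assoc) (auto simp: mem_Pfin1)
  also have "{\<one>\<^sub>H, c} \<odot> {\<one>\<^sub>H, c} = seg H c 2" using cc by (simp add: H.pair_mult H.seg_2)
  finally have "f (Z \<odot> {\<one>\<^sub>H, c}) = f (X \<odot> seg H c 2)" by simp
  then have "f Z \<circledast> {\<one>\<^sub>K, g c} = f X \<circledast> seg K (g c) 2"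
    using X Z cc by (simp add: f_mult H.pair_Pfin1 H.seg_Pfin1 g_pair f_seg_g)
  moreover have "step_free K (g c) (f X)" using free by (simp add: fX c_def)
  \<comment> \<open>Step-freeness would make the solution unique, hence \<open>f Z = f W\<close>,
    although \<open>Z\<close> and \<open>W\<close> differ by \<open>c\<close>.\<close>
  ultimately have "f Z = f X \<circledast> {\<one>\<^sub>K, g c}"
    using K.step_free_unique[of "f X" "g c" "f Z"] f_closed X Z cc by (simp add: mem_Pfin1)
  also have "\<dots> = f W" unfolding W_def using X cc by (simp add: f_mult H.pair_Pfin1 g_pair)
  finally have "Z = W" using f_inj Z W by blast
  then show False using cW by (auto simp: Z_def)
qed

text \<open>The preceding lemma yields \<open>p\<close>, \<open>q\<close> among the four elements of
  \<open>{1, g x}{1, g y}\<close> with \<open>q\<close> equal to \<open>p\<close> times a positive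
  power of \<open>g (x y)\<close>. All other pairs would make \<open>g (x y)\<close> a unit, or make
  \<open>x\<close> or \<open>y\<close> a power of \<open>x y\<close>, or contradict
  cancellation.\<close>

lemma nonunit_product_step:
  assumes "x \<in> carrier H" "y \<in> carrier H" "x \<noteq> \<one>\<^sub>H" "y \<noteq> \<one>\<^sub>H" "x \<cdot> y \<notin> Units H"
  shows "\<exists>i>0. g x \<star> g y = g (x \<cdot> y) [^]\<^bsub>K\<^esub> (i::nat) \<or> g y = g x \<star> g (x \<cdot> y) [^]\<^bsub>K\<^esub> i
    \<or> g x = g y \<star> g (x \<cdot> y) [^]\<^bsub>K\<^esub> i"
proof -
  define c where "c = x \<cdot> y"
  have cc: "c \<in> carrier H" "c \<notin> Units H" using assms by (auto simp: c_def)
  have ci: "infinite_order H c" using cc H.nonunit_infinite_order by blast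
  have gc: "g c \<in> carrier K" "g c \<notin> Units K" using cc g_nonunit by auto
  have c1: "c \<noteq> \<one>\<^sub>H" using cc by auto
  have pu: "w \<star> g c [^]\<^bsub>K\<^esub> i \<noteq> \<one>\<^sub>K" if "w \<in> carrier K" "i > 0" for w and i :: nat
  proof
    assume "w \<star> g c [^]\<^bsub>K\<^esub> i = \<one>\<^sub>K"
    then have "g c [^]\<^bsub>K\<^esub> i \<in> Units K"
      using that gc K.mult_unit_iff[of w "g c [^]\<^bsub>K\<^esub> i"] by simp
    moreover obtain j where "i = Suc j" using \<open>i > 0\<close> gr0_implies_Suc by blast
    ultimately show False using gc by (simp add: K.mult_unit_iff)
  qed
  \<comment> \<open>As \<open>g\<close> respects powers of \<open>c\<close>, the equation pulls back
    to \<open>z = c^i\<close>. Cancelling \<open>c\<close> in \<open>z w = c\<close> then leaves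
    \<open>c^(i-1) w = 1\<close>, so that \<open>w = 1\<close> or \<open>c\<close> is a
    unit.\<close>
  have gx: "g z \<noteq> g c [^]\<^bsub>K\<^esub> i" if z: "z \<in> carrier H" "w \<in> carrier H" "z \<cdot> w = c" "w \<noteq> \<one>\<^sub>H" and "i > 0"
    for z w and i :: nat
  proof
    assume "g z = g c [^]\<^bsub>K\<^esub> i"
    then have "g z = g (c [^]\<^bsub>H\<^esub> i)" using g_pow[OF ci] by simp
    then have zc: "z = c [^]\<^bsub>H\<^esub> i" using z cc by (simp add: g_inj)
    then have "c [^]\<^bsub>H\<^esub> i \<cdot> w = c [^]\<^bsub>H\<^esub> (1::nat) \<cdot> \<one>\<^sub>H" using z cc by simp
    moreover obtain j where j: "i = Suc j" using \<open>i > 0\<close> by (cases i) auto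
    ultimately have "c \<cdot> (c [^]\<^bsub>H\<^esub> j \<cdot> w) = c" using z cc by (simp add: H.m_ac)
    then have jw: "c [^]\<^bsub>H\<^esub> j \<cdot> w = \<one>\<^sub>H" using z cc by (simp add: H.mult_eq_self_right)
    show False
    proof (cases j)
      case 0
      then show ?thesis using jw z by simp
    next
      case (Suc k)
      have "c [^]\<^bsub>H\<^esub> j \<in> Units H" using jw z cc H.mult_unit_iff[of "c [^]\<^bsub>H\<^esub> j" w] by simp
      then show ?thesis using Suc cc by (simp add: H.mult_unit_iff)
    qed
  qed
  obtain p q and i :: nat where pq: "p \<in> {\<one>\<^sub>K, g x, g y, g x \<star> g y}" "q \<in> {\<one>\<^sub>K, g x, g y, g x \<star> g y}"
    and i: "i > 0" "q = p \<star> g c [^]\<^bsub>K\<^esub> i"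
    using product_step[OF assms(1-4)] c1 unfolding step_free_def c_def by blast
  have A: "\<And>w. w \<in> carrier K \<Longrightarrow> w \<star> g c [^]\<^bsub>K\<^esub> i \<noteq> \<one>\<^sub>K" using pu i by blast
  have C: "g c [^]\<^bsub>K\<^esub> i \<noteq> \<one>\<^sub>K" using A[of "\<one>\<^sub>K"] gc by simp
  have B: "g x \<noteq> g c [^]\<^bsub>K\<^esub> i" "g y \<noteq> g c [^]\<^bsub>K\<^esub> i"
    using gx[of x y i] gx[of y x i] assms i by (auto simp: c_def H.m_comm)
  have cl: "g x \<in> carrier K" "g y \<in> carrier K" "g c [^]\<^bsub>K\<^esub> i \<in> carrier K" using assms gc by auto
  have D: "g y \<noteq> \<one>\<^sub>K" "g x \<noteq> \<one>\<^sub>K" using assms by (auto simp: g_eq_one)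
  have E: "g x \<star> g y \<star> g c [^]\<^bsub>K\<^esub> i \<noteq> g x" "g x \<star> g y \<star> g c [^]\<^bsub>K\<^esub> i \<noteq> g y"
  proof -
    have "g x \<star> g y \<star> g c [^]\<^bsub>K\<^esub> i = g x \<star> (g y \<star> g c [^]\<^bsub>K\<^esub> i)"
      "g x \<star> g y \<star> g c [^]\<^bsub>K\<^esub> i = g y \<star> (g x \<star> g c [^]\<^bsub>K\<^esub> i)" using cl by (simp_all add: K.m_ac)
    then show "g x \<star> g y \<star> g c [^]\<^bsub>K\<^esub> i \<noteq> g x" "g x \<star> g y \<star> g c [^]\<^bsub>K\<^esub> i \<noteq> g y"
      using A[of "g y"] A[of "g x"] cl K.mult_eq_self_right(1)[of "g x" "g y \<star> g c [^]\<^bsub>K\<^esub> i"]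
        K.mult_eq_self_right(1)[of "g y" "g x \<star> g c [^]\<^bsub>K\<^esub> i"] by (metis K.m_closed)+
  qed
  have F: "g y \<star> g c [^]\<^bsub>K\<^esub> i \<noteq> g x \<star> g y" "g x \<star> g c [^]\<^bsub>K\<^esub> i \<noteq> g x \<star> g y"
    using B cl K.m_comm[of "g x" "g y"] K.l_cancel[of "g y" "g c [^]\<^bsub>K\<^esub> i" "g x"]
      K.l_cancel[of "g x" "g c [^]\<^bsub>K\<^esub> i" "g y"] by metis+
  have S: "w \<star> g c [^]\<^bsub>K\<^esub> i \<noteq> w" if "w \<in> carrier K" for w
    using C cl that by (simp add: K.mult_eq_self_right)
  have "g x \<star> g y = g c [^]\<^bsub>K\<^esub> i \<or> g y = g x \<star> g c [^]\<^bsub>K\<^esub> i \<or> g x = g y \<star> g c [^]\<^bsub>K\<^esub> i"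
  proof -
    have "q \<noteq> p" using S[of p] i(2) pq(1) cl by auto
    moreover have "q \<noteq> \<one>\<^sub>K" using A[of p] i(2) pq(1) cl by auto
    moreover have "p = \<one>\<^sub>K \<Longrightarrow> q = g c [^]\<^bsub>K\<^esub> i" using i(2) cl by simp
    ultimately show ?thesis using pq i(2) B E F by (metis empty_iff insert_iff)
  qed
  then show ?thesis using i(1) unfolding c_def by blast
qed

subsection \<open>A unit of infinite order\<close>

text \<open>With \<open>N\<close> large and \<open>v = inv u\<close>, the sets \<open>E = {1, u\<^sup>N\<^sup>-\<^sup>1}{1, v\<^sup>N}\<close> and
  \<open>u E = {1, u\<^sup>N}{1, v\<^sup>N\<^sup>-\<^sup>1}\<close> are both products of two-element sets, and \<open>X E = (v X) (u E)\<close>.\<close>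

lemma infinite_unit_mem:
  assumes u: "infinite_order H u" "u \<in> Units H" and X: "X \<in> PH" "u \<in> X"
  shows "g u \<in> f X"
proof -
  define v where "v = inv\<^bsub>H\<^esub> u"
  define a where "a = g u"
  define b where "b = g v"
  have uc: "u \<in> carrier H" "v \<in> carrier H" and uv: "u \<cdot> v = \<one>\<^sub>H" and vU: "v \<in> Units H"
    using u by (auto simp: v_def)
  have vi: "infinite_order H v" unfolding v_def using u H.infinite_order_inv by blast
  have ab: "a \<star> b = \<one>\<^sub>K" unfolding a_def b_def v_def using g_inv_infinite[OF u] .
  have ac: "a \<in> carrier K" "b \<in> carrier K" unfolding a_def b_def using uc by auto
  have ai: "infinite_order K a" unfolding a_def using g_infinite_imp u by blast
  have fX: "f X \<in> PK" using X f_closed by blast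
  then have fX': "finite (f X)" "f X \<subseteq> carrier K" "\<one>\<^sub>K \<in> f X" by (auto simp: mem_Pfin1)
  \<comment> \<open>From exponent \<open>M\<close> on, no quotient of two elements of
    \<open>f X\<close> is a power of \<open>a\<close>. The exponents in \<open>E\<close> and
    \<open>F\<close> are chosen so that every unwanted alternative below has exponent at least
    \<open>M\<close>.\<close>
  obtain M :: nat where M: "\<And>i p q. i \<ge> M \<Longrightarrow> p \<in> f X \<Longrightarrow> q \<in> f X \<Longrightarrow> q \<noteq> p \<star> a [^]\<^bsub>K\<^esub> i"
    using K.step_free_bound[OF ai fX'(1,2)] by metis
  define E where "E = {\<one>\<^sub>H, u [^]\<^bsub>H\<^esub> Suc M} \<odot> {\<one>\<^sub>H, v [^]\<^bsub>H\<^esub> Suc (Suc M)}"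
  define F where "F = {\<one>\<^sub>H, u [^]\<^bsub>H\<^esub> Suc (Suc M)} \<odot> {\<one>\<^sub>H, v [^]\<^bsub>H\<^esub> Suc M}"
  define X' where "X' = (\<lambda>x. v \<cdot> x) ` X"
  have Xc: "x \<in> carrier H" if "x \<in> X" for x using X that by (auto simp: mem_Pfin1)
  have X': "X' \<in> PH" unfolding X'_def mem_Pfin1
    using X Xc uc uv by (auto simp: H.m_comm mem_Pfin1 intro!: image_eqI[of _ _ u])
  have pw: "u [^]\<^bsub>H\<^esub> n \<cdot> v [^]\<^bsub>H\<^esub> n = \<one>\<^sub>H" for n :: nat unfolding v_def using H.inv_pow[OF u(2)] .
  have pwK: "a [^]\<^bsub>K\<^esub> n \<star> b [^]\<^bsub>K\<^esub> n = \<one>\<^sub>K" for n :: nat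
    using K.nat_pow_distrib[of a b n] ab ac by simp
  have Eset: "E = {\<one>\<^sub>H, u [^]\<^bsub>H\<^esub> Suc M, v [^]\<^bsub>H\<^esub> Suc (Suc M), v}"
  proof -
    have "u [^]\<^bsub>H\<^esub> Suc M \<cdot> v [^]\<^bsub>H\<^esub> Suc (Suc M) = (u [^]\<^bsub>H\<^esub> Suc M \<cdot> v [^]\<^bsub>H\<^esub> Suc M) \<cdot> v"
      using uc by (simp add: H.m_assoc)
    then show ?thesis unfolding E_def using uc pw[of "Suc M"] by (simp add: H.pair_mult del: nat_pow_Suc)
  qed
  have Fset: "F = {\<one>\<^sub>H, u [^]\<^bsub>H\<^esub> Suc (Suc M), v [^]\<^bsub>H\<^esub> Suc M, u}"
  proof -
    have "u [^]\<^bsub>H\<^esub> Suc (Suc M) \<cdot> v [^]\<^bsub>H\<^esub> Suc M = u \<cdot> (u [^]\<^bsub>H\<^esub> Suc M \<cdot> v [^]\<^bsub>H\<^esub> Suc M)"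
      using uc by (simp add: H.m_ac)
    then show ?thesis unfolding F_def using uc pw[of "Suc M"] by (simp add: H.pair_mult del: nat_pow_Suc)
  qed
  have FE: "F = (\<lambda>e. u \<cdot> e) ` E"
  proof -
    have "u \<cdot> v [^]\<^bsub>H\<^esub> Suc (Suc M) = (u \<cdot> v) \<cdot> v [^]\<^bsub>H\<^esub> Suc M" using uc H.nat_pow_Suc2[of v "Suc M"]
      by (simp add: H.m_assoc del: nat_pow_Suc)
    moreover have "u \<cdot> u [^]\<^bsub>H\<^esub> Suc M = u [^]\<^bsub>H\<^esub> Suc (Suc M)" using uc H.nat_pow_Suc2[of u "Suc M"] by simp
    ultimately show ?thesis unfolding Eset Fset using uc uv by (auto simp del: nat_pow_Suc)
  qed
  have Ec: "e \<in> carrier H" if "e \<in> E" for e using that uc unfolding Eset by auto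
  have "X' \<odot> F = X \<odot> E"
  proof -
    have eq: "(v \<cdot> x) \<cdot> (u \<cdot> e) = x \<cdot> e" if "x \<in> X" "e \<in> E" for x e
    proof -
      have "(v \<cdot> x) \<cdot> (u \<cdot> e) = (u \<cdot> v) \<cdot> (x \<cdot> e)" using Xc Ec that uc by (simp add: H.m_ac)
      then show ?thesis using Xc Ec that uv by simp
    qed
    show ?thesis unfolding X'_def FE set_mult_def using eq by auto
  qed
  then have "f (X' \<odot> F) = f (X \<odot> E)" by simp
  moreover have "E \<in> PH" "F \<in> PH" unfolding E_def F_def using uc
    by (simp_all add: H.Pfin1_mult_closed H.pair_Pfin1 del: nat_pow_Suc)
  ultimately have "f X' \<circledast> f F = f X \<circledast> f E" using X X' by (simp add: f_mult)
  moreover have gEF: "f ({\<one>\<^sub>H, u [^]\<^bsub>H\<^esub> i} \<odot> {\<one>\<^sub>H, v [^]\<^bsub>H\<^esub> j})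
      = {\<one>\<^sub>K, a [^]\<^bsub>K\<^esub> i} \<circledast> {\<one>\<^sub>K, b [^]\<^bsub>K\<^esub> j}" for i j :: nat
    using f_pair_mult[of "u [^]\<^bsub>H\<^esub> i" "v [^]\<^bsub>H\<^esub> j"] g_pow[OF u(1), of i] g_pow[OF vi, of j] uc
    by (simp add: a_def b_def)
  moreover have fE: "f E = {\<one>\<^sub>K, a [^]\<^bsub>K\<^esub> Suc M, b [^]\<^bsub>K\<^esub> Suc (Suc M), a [^]\<^bsub>K\<^esub> Suc M \<star> b [^]\<^bsub>K\<^esub> Suc (Suc M)}"
    unfolding E_def gEF using ac by (intro K.pair_mult K.nat_pow_closed)
  moreover have fF: "b [^]\<^bsub>K\<^esub> Suc M \<in> f F"
    unfolding F_def gEF K.pair_mult[OF K.nat_pow_closed[OF ac(1)] K.nat_pow_closed[OF ac(2)]] by blast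
  moreover have "\<one>\<^sub>K \<in> f X'" using f_closed[OF X'] by (simp add: mem_Pfin1)
  ultimately have "\<one>\<^sub>K \<star> b [^]\<^bsub>K\<^esub> Suc M \<in> f X \<circledast> f E" using set_multI by metis
  then obtain y e where y: "y \<in> f X" "e \<in> f E" "b [^]\<^bsub>K\<^esub> Suc M = y \<star> e" using ac
    by (auto simp: mem_set_mult simp del: nat_pow_Suc)
  have yc: "y \<in> carrier K" using y fX' by blast
  have ec: "e \<in> carrier K" using y(2) ac unfolding fE by auto
  \<comment> \<open>The element \<open>b^(M+1)\<close> of \<open>f X' f F\<close> is rewritten in
    \<open>f X f E\<close>. Multiplied by \<open>a^(M+1)\<close>, the four choices of
    \<open>e\<close> become \<open>a\<close> to the exponents \<open>M+1\<close>,
    \<open>2M+2\<close>, \<open>-1\<close>, \<open>M\<close>. As 1 is in \<open>f X\<close>, only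
    \<open>-1\<close> survives, and then \<open>y = a\<close>.\<close>
  have one: "\<one>\<^sub>K = y \<star> (e \<star> a [^]\<^bsub>K\<^esub> Suc M)"
  proof -
    have "\<one>\<^sub>K = b [^]\<^bsub>K\<^esub> Suc M \<star> a [^]\<^bsub>K\<^esub> Suc M" using pwK[of "Suc M"] ac K.m_comm by (metis K.nat_pow_closed)
    then show ?thesis using yc ec ac unfolding y(3) by (simp add: K.m_assoc del: nat_pow_Suc)
  qed
  have no: "\<one>\<^sub>K \<noteq> y \<star> a [^]\<^bsub>K\<^esub> i" if "i \<ge> M" for i :: nat using M[OF that y(1) fX'(3)] .
  consider "e = \<one>\<^sub>K" | "e = a [^]\<^bsub>K\<^esub> Suc M" | "e = b [^]\<^bsub>K\<^esub> Suc (Suc M)"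
    | "e = a [^]\<^bsub>K\<^esub> Suc M \<star> b [^]\<^bsub>K\<^esub> Suc (Suc M)"
    using y(2) unfolding fE by blast
  then show ?thesis
  proof cases
    case 1
    have "e \<star> a [^]\<^bsub>K\<^esub> Suc M = a [^]\<^bsub>K\<^esub> Suc M" unfolding 1 using ac by (intro K.l_one K.nat_pow_closed)
    then have "\<one>\<^sub>K = y \<star> a [^]\<^bsub>K\<^esub> Suc M" using one by metis
    then show ?thesis using no[of "Suc M"] by simp
  next
    case 2
    then have "\<one>\<^sub>K = y \<star> a [^]\<^bsub>K\<^esub> (Suc M + Suc M)" using one ac K.pow_add[of a "Suc M" "Suc M"] by metis
    then show ?thesis using no[of "Suc M + Suc M"] by linarith
  next
    case 3
    have "e \<star> a [^]\<^bsub>K\<^esub> Suc M = b \<star> (a [^]\<^bsub>K\<^esub> Suc M \<star> b [^]\<^bsub>K\<^esub> Suc M)"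
      unfolding 3 using ac by (simp add: K.m_ac)
    also have "\<dots> = b" using pwK[of "Suc M"] ac by (metis K.r_one)
    finally have "\<one>\<^sub>K = y \<star> b" using one by metis
    then have "y \<star> b = a \<star> b" using ab by simp
    then have "y = a" using yc ac by (simp add: K.mult_right_cancel)
    then show ?thesis using y(1) by (simp add: a_def)
  next
    case 4
    have "e \<star> a [^]\<^bsub>K\<^esub> Suc M = a [^]\<^bsub>K\<^esub> M \<star> (a [^]\<^bsub>K\<^esub> Suc (Suc M) \<star> b [^]\<^bsub>K\<^esub> Suc (Suc M))"
      unfolding 4 using ac by (simp add: K.m_ac)
    also have "\<dots> = a [^]\<^bsub>K\<^esub> M" using pwK[of "Suc (Suc M)"] ac by (metis K.r_one K.nat_pow_closed)
    finally have "\<one>\<^sub>K = y \<star> a [^]\<^bsub>K\<^esub> M" using one by metis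
    then show ?thesis using no[of M] by simp
  qed
qed

lemma infinite_unit_mem_iff:
  assumes u: "infinite_order H u" "u \<in> Units H" and X: "X \<in> PH"
  shows "g u \<in> f X \<longleftrightarrow> u \<in> X"
proof -
  interpret S: pfin_iso K H "inv_into PH f" by (rule swap)
  have "u \<in> X" if "g u \<in> f X"
    using S.infinite_unit_mem[of "g u" "f X"] that u X g_unit_infinite g_infinite_imp f_closed
      inv_f swap_g H.Units_closed by metis
  then show ?thesis using infinite_unit_mem[OF u X] by blast
qed

text \<open>Unit membership does transfer: \<open>x y\<close> lies in \<open>{1, x}{1, y}\<close>,
  so \<open>g (x y)\<close> lies in the image product, and injectivity of \<open>g\<close> excludes
  1, \<open>g x\<close> and \<open>g y\<close>.\<close>

lemma g_mult_eq_infinite_unit: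
  assumes "x \<in> carrier H" "y \<in> carrier H" "infinite_order H (x \<cdot> y)" "x \<cdot> y \<in> Units H"
  shows "g (x \<cdot> y) = g x \<star> g y"
proof (cases "x = \<one>\<^sub>H \<or> y = \<one>\<^sub>H")
  case True
  then show ?thesis using assms by auto
next
  case False
  have "x \<cdot> y \<in> {\<one>\<^sub>H, x} \<odot> {\<one>\<^sub>H, y}" by (intro set_multI) auto
  moreover have "{\<one>\<^sub>H, x} \<odot> {\<one>\<^sub>H, y} \<in> PH"
    using assms by (simp add: H.Pfin1_mult_closed H.pair_Pfin1)
  ultimately have "g (x \<cdot> y) \<in> f ({\<one>\<^sub>H, x} \<odot> {\<one>\<^sub>H, y})"
    using infinite_unit_mem assms by blast
  then have "g (x \<cdot> y) \<in> {\<one>\<^sub>K, g x, g y, g x \<star> g y}"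
    using assms by (simp add: f_pair_mult K.pair_mult)
  moreover have "g (x \<cdot> y) \<noteq> \<one>\<^sub>K"
    using assms H.infinite_order_not_one by (simp add: g_eq_one)
  moreover have "g (x \<cdot> y) \<noteq> g x" "g (x \<cdot> y) \<noteq> g y"
    using assms False by (simp_all add: g_inj H.mult_eq_self_right H.mult_eq_self_left)
  ultimately show ?thesis by blast
qed

text \<open>If \<open>x y\<close> is torsion, a unit \<open>u\<close> is chosen such that
  \<open>u\<close>, \<open>y u\<close> and hence \<open>x y u\<close> have infinite order;
  associativity and cancellation of \<open>g u\<close> reduce to the previous lemma. The unit
  \<open>y\<close> itself serves when it has infinite order.\<close>

lemma g_mult_units:
  assumes "\<exists>u. infinite_order H u \<and> u \<in> Units H" "x \<in> Units H" "y \<in> Units H"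
  shows "g (x \<cdot> y) = g x \<star> g y"
proof (cases "infinite_order H (x \<cdot> y)")
  case True
  then show ?thesis using assms g_mult_eq_infinite_unit by (simp add: H.Units_closed)
next
  case False
  have c: "x \<in> carrier H" "y \<in> carrier H" using assms by auto
  obtain u where u: "infinite_order H u" "u \<in> Units H" "infinite_order H (y \<cdot> u)"
  proof (cases "infinite_order H y")
    case True
    have "infinite_order H (y \<cdot> y)"
      using H.infinite_order_pow[OF True, of 2] c by (simp add: numeral_2_eq_2)
    then show ?thesis using that[of y] True assms by blast
  next
    case F: False
    obtain u where u: "infinite_order H u" "u \<in> Units H" using assms by blast
    then have "infinite_order H (u \<cdot> y)" using H.infinite_order_mult_torsion F c by blast
    then show ?thesis using that[of u] u c by (simp add: H.m_comm H.Units_closed)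
  qed
  have uc: "u \<in> carrier H" using u by blast
  have "infinite_order H (u \<cdot> (x \<cdot> y))" using H.infinite_order_mult_torsion u False c by simp
  then have inf: "infinite_order H (x \<cdot> y \<cdot> u)" using c uc by (simp add: H.m_comm)
  have U: "x \<cdot> y \<cdot> u \<in> Units H" "y \<cdot> u \<in> Units H" using assms u by auto
  have "g (x \<cdot> y) \<star> g u = g (x \<cdot> y \<cdot> u)"
    using g_mult_eq_infinite_unit[of "x \<cdot> y" u] inf U c uc by simp
  also have "\<dots> = g (x \<cdot> (y \<cdot> u))" using c uc by (simp add: H.m_assoc)
  also have "\<dots> = g x \<star> g (y \<cdot> u)"
    using g_mult_eq_infinite_unit[of x "y \<cdot> u"] inf U c uc by (simp add: H.m_assoc)
  also have "g (y \<cdot> u) = g y \<star> g u" using g_mult_eq_infinite_unit[of y u] u U c uc by simp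
  finally have "g (x \<cdot> y) \<star> g u = (g x \<star> g y) \<star> g u" using c uc by (simp add: K.m_assoc)
  then show ?thesis using c uc K.mult_right_cancel[of "g (x \<cdot> y)" "g x \<star> g y" "g u"] by simp
qed

text \<open>Of the three alternatives for the pair \<open>(x, u)\<close>, the one making
  \<open>g x\<close> a divisor of the unit \<open>g u\<close> is impossible.\<close>

lemma nonunit_unit_power:
  assumes x: "x \<in> carrier H" "x \<notin> Units H" and u: "infinite_order H u" "u \<in> Units H"
  shows "\<exists>i>0. \<exists>s\<in>Units K. g (x \<cdot> u) [^]\<^bsub>K\<^esub> (i::nat) = g x \<star> s \<and> (s = g u \<or> s \<star> g u = \<one>\<^sub>K)"
proof -
  have uc: "u \<in> carrier H" using u by blast
  have gu: "g u \<in> Units K" using g_unit_infinite u by blast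
  have gx: "g x \<notin> Units K" "g x \<in> carrier K" using g_nonunit x by auto
  have "x \<cdot> u \<notin> Units H" using x uc H.mult_unit_iff by blast
  moreover have "x \<noteq> \<one>\<^sub>H" using x by auto
  moreover have "u \<noteq> \<one>\<^sub>H" using u H.infinite_order_not_one by blast
  ultimately obtain i :: nat where i: "i > 0" "g x \<star> g u = g (x \<cdot> u) [^]\<^bsub>K\<^esub> i
      \<or> g u = g x \<star> g (x \<cdot> u) [^]\<^bsub>K\<^esub> i \<or> g x = g u \<star> g (x \<cdot> u) [^]\<^bsub>K\<^esub> i"
    using nonunit_product_step[of x u] x uc by blast
  have pc: "g (x \<cdot> u) [^]\<^bsub>K\<^esub> i \<in> carrier K" using x uc by simp
  have "g u \<noteq> g x \<star> g (x \<cdot> u) [^]\<^bsub>K\<^esub> i"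
    using gu gx pc K.mult_unit_iff by metis
  then consider "g (x \<cdot> u) [^]\<^bsub>K\<^esub> i = g x \<star> g u" | "g x = g u \<star> g (x \<cdot> u) [^]\<^bsub>K\<^esub> i" using i(2) by auto
  then show ?thesis
  proof cases
    case 1
    then show ?thesis using i(1) gu by blast
  next
    case 2
    have "g x \<star> inv\<^bsub>K\<^esub> g u = (g u \<star> inv\<^bsub>K\<^esub> g u) \<star> g (x \<cdot> u) [^]\<^bsub>K\<^esub> i"
      unfolding 2 using pc gu by (simp add: K.m_ac K.Units_closed del: K.Units_r_inv K.Units_l_inv)
    then have "g (x \<cdot> u) [^]\<^bsub>K\<^esub> i = g x \<star> inv\<^bsub>K\<^esub> g u" using gu pc by simp
    moreover have "inv\<^bsub>K\<^esub> g u \<star> g u = \<one>\<^sub>K" "inv\<^bsub>K\<^esub> g u \<in> Units K" using gu by auto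
    ultimately show ?thesis using i(1) by blast
  qed
qed

text \<open>Applying the previous lemma to \<open>(x, u)\<close> and to \<open>(xu, inv u)\<close>, the two exponents
  multiply to \<open>1\<close>.\<close>

lemma nonunit_unit_sign:
  assumes x: "x \<in> carrier H" "x \<notin> Units H" and u: "infinite_order H u" "u \<in> Units H"
  shows "g (x \<cdot> u) = g x \<star> g u \<or> g (x \<cdot> u) \<star> g u = g x"
proof -
  have uc: "u \<in> carrier H" "inv\<^bsub>H\<^esub> u \<in> carrier H" using u by auto
  define c where "c = x \<cdot> u"
  have c: "c \<in> carrier H" "c \<notin> Units H" using x uc H.mult_unit_iff by (auto simp: c_def)
  have cu: "c \<cdot> inv\<^bsub>H\<^esub> u = x" unfolding c_def using x uc u by (simp add: H.m_assoc)
  obtain i :: nat and s where i: "i > 0" "s \<in> Units K" "g c [^]\<^bsub>K\<^esub> i = g x \<star> s" "s = g u \<or> s \<star> g u = \<one>\<^sub>K"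
    using nonunit_unit_power[OF x u] unfolding c_def by blast
  obtain j :: nat and t where j: "j > 0" "t \<in> Units K" "g x [^]\<^bsub>K\<^esub> j = g c \<star> t"
    using nonunit_unit_power[OF c H.infinite_order_inv[OF u] H.Units_inv_Units[OF u(2)]] unfolding cu by blast
  have gx: "g x \<in> carrier K" "g x \<notin> Units K" "g c \<in> carrier K" using x c g_nonunit by auto
  have st: "s \<in> carrier K" "t \<in> carrier K" using i j by auto
  have "g x [^]\<^bsub>K\<^esub> (1::nat) \<star> (s \<star> t [^]\<^bsub>K\<^esub> i) = g c [^]\<^bsub>K\<^esub> i \<star> t [^]\<^bsub>K\<^esub> i"
    using i gx st by (simp add: K.m_assoc)
  also have "\<dots> = (g c \<star> t) [^]\<^bsub>K\<^esub> i" using gx st by (simp add: K.nat_pow_distrib)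
  also have "\<dots> = g x [^]\<^bsub>K\<^esub> (j * i) \<star> \<one>\<^sub>K" using gx j(3)[symmetric] by (simp add: K.nat_pow_pow)
  finally have "1 = j * i"
    using K.level_unique[OF gx(1,2), of "s \<star> t [^]\<^bsub>K\<^esub> i" "\<one>\<^sub>K" 1 "j * i"] i(2) j(2) K.pow_unit
    by (metis K.Units_m_closed K.Units_one_closed)
  then have "i = 1" by simp
  then have "g c = g x \<star> s" using i gx by simp
  then show ?thesis using i(4) gx st uc by (auto simp: c_def K.m_assoc)
qed

text \<open>In the situation of this lemma the product of \<open>{1, w, y}\<close> and \<open>{1, y, y inv w}\<close> is
  \<open>{1, w}{1, y}{1, y inv w}\<close>; comparing exponents pins down the image of the first factor.\<close>

lemma f_triple_reflected:
  assumes y: "y \<in> carrier H" "y \<notin> Units H" and w: "infinite_order H w" "w \<in> Units H"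
    and refl: "g (y \<cdot> inv\<^bsub>H\<^esub> w) = g y \<star> g w"
  shows "f {\<one>\<^sub>H, w, y} = {\<one>\<^sub>K, g w, g y \<star> g w}"
proof -
  define v where "v = inv\<^bsub>H\<^esub> w"
  define a where "a = g w"
  define p where "p = g y"
  \<comment> \<open>Grid coordinates: \<open>L (i, j)\<close> is injective and turns products into
    sums of pairs.\<close>
  define L where "L = (\<lambda>(i, j). p [^]\<^bsub>K\<^esub> (i::nat) \<star> a [^]\<^bsub>K\<^esub> (j::nat))"
  have wc: "w \<in> carrier H" "v \<in> carrier H" "w \<cdot> v = \<one>\<^sub>H" using w by (auto simp: v_def)
  have w1: "w \<noteq> \<one>\<^sub>H" using w H.infinite_order_not_one by blast
  have pc: "p \<in> carrier K" "p \<notin> Units K" unfolding p_def using y g_nonunit by auto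
  have aU: "a \<in> Units K" "infinite_order K a" unfolding a_def using w g_unit_infinite g_infinite_imp by auto
  have ac: "a \<in> carrier K" using aU by blast
  have L_inj: "L m = L n \<longleftrightarrow> m = n" for m n
    unfolding L_def using K.level_pow_unique[OF pc aU] by (cases m; cases n) auto
  have L_mult: "L (i, j) \<star> L (k, l) = L (i + k, j + l)" for i j k l
    unfolding L_def using K.level_pow_mult[OF pc(1) ac] by simp
  have L0: "L (0, 0) = \<one>\<^sub>K" "L (0, 1) = a" "L (1, 0) = p" "L (1, 1) = p \<star> a"
    unfolding L_def using pc ac by auto
  define T where "T = {\<one>\<^sub>H, w, y}"
  define S where "S = {\<one>\<^sub>H, y, y \<cdot> v}"
  have T: "T \<in> PH" and S: "S \<in> PH" using y wc by (auto simp: T_def S_def mem_Pfin1)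
  have yv: "w \<cdot> (y \<cdot> v) = y"
  proof -
    have "w \<cdot> (y \<cdot> v) = (w \<cdot> v) \<cdot> y" using y wc(1,2) by (simp add: H.m_ac)
    then show ?thesis using y wc by simp
  qed
  have yyv: "w \<cdot> y \<cdot> (y \<cdot> v) = y \<cdot> y"
  proof -
    have "w \<cdot> y \<cdot> (y \<cdot> v) = (w \<cdot> v) \<cdot> (y \<cdot> y)" using y wc(1,2) by (simp add: H.m_ac)
    then show ?thesis using y wc by simp
  qed
  have "T \<odot> S = ({\<one>\<^sub>H, w} \<odot> {\<one>\<^sub>H, y}) \<odot> {\<one>\<^sub>H, y \<cdot> v}"
    unfolding H.pair_mult[OF wc(1) y(1)] T_def S_def set_mult_def using y wc(1,2) yv yyv by auto
  then have "f T \<circledast> f S = ({\<one>\<^sub>K, a} \<circledast> {\<one>\<^sub>K, p}) \<circledast> {\<one>\<^sub>K, p \<star> a}"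
    using f_mult[OF T S] f_mult[of "{\<one>\<^sub>H, w} \<odot> {\<one>\<^sub>H, y}" "{\<one>\<^sub>H, y \<cdot> v}"] y wc(1,2) refl
    by (simp add: f_pair_mult H.Pfin1_mult_closed H.pair_Pfin1 g_pair a_def p_def v_def)
  also have "\<dots> = L ` {(0,0), (0,1), (1,0), (1,1), (1,2), (2,1), (2,2)}"
  proof -
    have "{\<one>\<^sub>K, a} = L ` {(0,0), (0,1)}" "{\<one>\<^sub>K, p} = L ` {(0,0), (1,0)}"
      "{\<one>\<^sub>K, p \<star> a} = L ` {(0,0), (1,1)}"
      using L0 by auto
    then show ?thesis by (simp add: set_mult_def L_mult numeral_2_eq_2 insert_commute)
  qed
  finally have prod: "f T \<circledast> f S = L ` {(0,0), (0,1), (1,0), (1,1), (1,2), (2,1), (2,2)}" .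
  have fT: "f T \<in> PK" "f S \<in> PK" using T S f_closed by auto
  then have one: "\<one>\<^sub>K \<in> f T" "\<one>\<^sub>K \<in> f S" and sub: "f T \<subseteq> carrier K" "f S \<subseteq> carrier K"
    by (auto simp: mem_Pfin1)
  have yw: "y \<noteq> w" "y \<cdot> v \<noteq> w" "y \<noteq> \<one>\<^sub>H" "y \<cdot> v \<noteq> \<one>\<^sub>H"
    using y w wc(1,2) H.mult_unit_iff[of y v] by auto
  have "v \<noteq> \<one>\<^sub>H" using wc w1 by auto
  then have card: "card T = 3" "card S = 3"
    using yw w1 y wc(1,2) by (auto simp: T_def S_def H.mult_eq_self_right)
  have aT: "a \<in> f T" unfolding a_def using infinite_unit_mem[OF w T] by (simp add: T_def)
  have "a \<noteq> \<one>\<^sub>K" using aU K.infinite_order_not_one by blast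
  have aS: "a \<notin> f S" unfolding a_def using infinite_unit_mem_iff[OF w S] yw w1 by (auto simp: S_def)
  have fT3: "card (f T) = 3" "card (f S) = 3" using card card_image_f T S by auto
  have "\<exists>q. f T = {\<one>\<^sub>K, a, q}"
  proof -
    have "card (f T - {\<one>\<^sub>K, a}) = 1"
      using fT3 one aT \<open>a \<noteq> \<one>\<^sub>K\<close> by (subst card_Diff_subset) auto
    then obtain q where "f T - {\<one>\<^sub>K, a} = {q}" by (auto simp: card_1_singleton_iff)
    then show ?thesis using one aT by blast
  qed
  then obtain q where q: "f T = {\<one>\<^sub>K, a, q}" by blast
  have qn: "q \<noteq> \<one>\<^sub>K" "q \<noteq> a" using fT3(1) \<open>a \<noteq> \<one>\<^sub>K\<close> unfolding q by (auto simp: card_insert_if split: if_splits)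
  have "card (f S - {\<one>\<^sub>K}) = 2" using fT3 one by simp
  then obtain r s where rs: "f S - {\<one>\<^sub>K} = {r, s}" "r \<noteq> s" by (auto simp: card_2_iff)
  then have rs': "r \<in> f S" "s \<in> f S" "r \<noteq> \<one>\<^sub>K" "s \<noteq> \<one>\<^sub>K" by auto
  have in_prod: "x \<in> f T \<Longrightarrow> z \<in> f S \<Longrightarrow> x \<star> z \<in> L ` {(0,0), (0,1), (1,0), (1,1), (1,2), (2,1), (2,2)}" for x z
    using prod set_multI by metis
  have inT: "x \<in> f T \<Longrightarrow> x \<in> L ` {(0,0), (0,1), (1,0), (1,1), (1,2), (2,1), (2,2)}" for x
    using in_prod[of x "\<one>\<^sub>K"] one sub by auto
  have inS: "x \<in> f S \<Longrightarrow> x \<in> L ` {(0,0), (0,1), (1,0), (1,1), (1,2), (2,1), (2,2)}" for x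
    using in_prod[of "\<one>\<^sub>K" x] one sub by auto
  have "q \<in> f T" "q \<noteq> L (0, 0)" "q \<noteq> L (0, 1)" using q qn L0(1,2) by auto
  then obtain i j where ij: "q = L (i, j)" "(i, j) \<in> {(1,0), (1,1), (1,2), (2,1), (2,2)}"
    using inT[of q] by blast
  have rs_L: "r \<noteq> L (0, 0)" "s \<noteq> L (0, 0)" "r \<noteq> L (0, 1)" "s \<noteq> L (0, 1)"
    using rs' aS L0(1,2) by auto
  obtain k l where kl: "r = L (k, l)" "(k, l) \<in> {(1,0), (1,1), (1,2), (2,1), (2,2)}"
    using inS[OF rs'(1)] rs_L by blast
  obtain m n where mn: "s = L (m, n)" "(m, n) \<in> {(1,0), (1,1), (1,2), (2,1), (2,2)}"
    using inS[OF rs'(2)] rs_L by blast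
  have L_mem: "L x \<in> L ` A \<longleftrightarrow> x \<in> A" for x A using L_inj by (auto simp: image_iff)
  have 1: "(i + k, j + l) \<in> {(0,0), (0,1), (1,0), (1,1), (1,2), (2,1), (2,2)}"
    using in_prod[of q r] rs' q L_mult[of i j k l] unfolding ij(1) kl(1) by (simp only: L_mem insert_iff simp_thms)
  have 2: "(i + m, j + n) \<in> {(0,0), (0,1), (1,0), (1,1), (1,2), (2,1), (2,2)}"
    using in_prod[of q s] rs' q L_mult[of i j m n] unfolding ij(1) mn(1) by (simp only: L_mem insert_iff simp_thms)
  have 3: "(0 + k, 1 + l) \<in> {(0,0), (0,1), (1,0), (1,1), (1,2), (2,1), (2,2)}"
    using in_prod[OF aT rs'(1)] L_mult[of 0 1 k l] unfolding L0(2)[symmetric] kl(1) by (simp only: L_mem)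
  have 4: "(0 + m, 1 + n) \<in> {(0,0), (0,1), (1,0), (1,1), (1,2), (2,1), (2,2)}"
    using in_prod[OF aT rs'(2)] L_mult[of 0 1 m n] unfolding L0(2)[symmetric] mn(1) by (simp only: L_mem)
  have ne: "(k, l) \<noteq> (m, n)" using rs kl mn by auto
  \<comment> \<open>The product reaches only level 2, so \<open>q\<close>, \<open>r\<close> and
    \<open>s\<close> all lie on level 1. The products \<open>a r\<close> and \<open>a s\<close>
    bound \<open>l\<close> and \<open>n\<close> by 1, and since these differ they are 0 and 1. Both
    \<open>j\<close> and \<open>j + 1\<close> are then among the level-2 exponents 1 and 2, whence
    \<open>j = 1\<close>.\<close>
  have "i \<ge> 1" "k \<ge> 1" "m \<ge> 1" using ij(2) kl(2) mn(2) by auto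
  moreover have "i + k \<le> 2" using 1 by auto
  moreover have "i + m \<le> 2" using 2 by auto
  ultimately have lev: "i = 1" "k = 1" "m = 1" by auto
  have "l \<le> 1" using 3 lev by auto
  moreover have "n \<le> 1" using 4 lev by auto
  moreover have "l \<noteq> n" using ne lev by auto
  moreover have "j + l \<ge> 1" "j + l \<le> 2" using 1 unfolding lev by auto
  moreover have "j + n \<ge> 1" "j + n \<le> 2" using 2 unfolding lev by auto
  ultimately have "(i, j) = (1, 1)" using lev by auto
  then have "q = p \<star> a" using ij L0 by simp
  then show ?thesis using q unfolding T_def a_def p_def by simp
qed

text \<open>The powers \<open>u^0\<close> and \<open>u^3\<close> times a segment of length 2 already
  give all powers up to 5, so further powers of \<open>u\<close> between them add nothing. This
  transfers knowledge about \<open>{1, u^3, x}\<close> to sets with intermediate powers.\<close>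

lemma seg_fill:
  assumes u: "u \<in> carrier H" and x: "x \<in> carrier H"
    and X: "{\<one>\<^sub>H, u [^]\<^bsub>H\<^esub> (3::nat), x} \<subseteq> X" "X \<subseteq> insert x (seg H u 3)"
  shows "X \<odot> seg H u 2 = {\<one>\<^sub>H, u [^]\<^bsub>H\<^esub> (3::nat), x} \<odot> seg H u 2"
proof (rule equalityI; rule subsetI)
  fix z assume "z \<in> X \<odot> seg H u 2"
  then obtain p and j :: nat where p: "p \<in> X" "j \<le> 2" "z = p \<cdot> u [^]\<^bsub>H\<^esub> j"
    by (auto simp: mem_set_mult seg_def)
  then consider "p = x" | i :: nat where "i \<le> 3" "p = u [^]\<^bsub>H\<^esub> i" using X(2) by (auto simp: seg_def)
  then show "z \<in> {\<one>\<^sub>H, u [^]\<^bsub>H\<^esub> (3::nat), x} \<odot> seg H u 2"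
  proof cases
    case 1
    then show ?thesis unfolding p(3) using p(2) by (intro set_multI H.seg_in) auto
  next
    case 2
    then have z: "z = u [^]\<^bsub>H\<^esub> (i + j)" using p u by (simp add: H.pow_add)
    show ?thesis
    proof (cases "i + j \<le> 2")
      case True
      then have "\<one>\<^sub>H \<cdot> u [^]\<^bsub>H\<^esub> (i + j) \<in> {\<one>\<^sub>H, u [^]\<^bsub>H\<^esub> (3::nat), x} \<odot> seg H u 2"
        by (intro set_multI H.seg_in) auto
      then show ?thesis using z u by simp
    next
      case False
      have "u [^]\<^bsub>H\<^esub> (3::nat) \<cdot> u [^]\<^bsub>H\<^esub> (i + j - 3) \<in> {\<one>\<^sub>H, u [^]\<^bsub>H\<^esub> (3::nat), x} \<odot> seg H u 2"
        using 2 p(2) by (intro set_multI H.seg_in) auto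
      moreover have "u [^]\<^bsub>H\<^esub> (3::nat) \<cdot> u [^]\<^bsub>H\<^esub> (i + j - 3) = z"
        unfolding z using H.pow_add[of u 3 "i + j - 3"] u False by simp
      ultimately show ?thesis by simp
    qed
  qed
next
  fix z assume "z \<in> {\<one>\<^sub>H, u [^]\<^bsub>H\<^esub> (3::nat), x} \<odot> seg H u 2"
  then show "z \<in> X \<odot> seg H u 2" using X(1) unfolding set_mult_def by blast
qed

text \<open>Once the sign is wrong it stays wrong along all translates by the inverse of
  \<open>u\<close>: if it were right at \<open>y\<close> with the inverse \<open>v\<close>, then
  \<open>g (y v)\<close> and \<open>g (y u)\<close> would both be \<open>g y\<close> divided by
  \<open>g u\<close>, against injectivity.\<close>

lemma reflected_chain:
  assumes x: "x \<in> carrier H" "x \<notin> Units H" and u: "infinite_order H u" "u \<in> Units H"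
    and bad: "g (x \<cdot> u) \<star> g u = g x"
  shows "g (x \<cdot> inv\<^bsub>H\<^esub> u [^]\<^bsub>H\<^esub> k) = g x \<star> g u [^]\<^bsub>K\<^esub> (k::nat)"
proof -
  define v where "v = inv\<^bsub>H\<^esub> u"
  have uc: "u \<in> carrier H" "v \<in> carrier H" "u \<cdot> v = \<one>\<^sub>H" and vU: "v \<in> Units H"
    using u by (auto simp: v_def)
  have vi: "infinite_order H v" unfolding v_def using u H.infinite_order_inv by blast
  have ab: "g u \<star> g v = \<one>\<^sub>K" unfolding v_def using g_inv_infinite u by blast
  have uv: "u \<noteq> v"
  proof
    assume "u = v"
    then have "u [^]\<^bsub>H\<^esub> (2::nat) = \<one>\<^sub>H" using uc by (simp add: numeral_2_eq_2)
    then show False using H.infinite_order_pow_one[OF u(1), of 2] by simp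
  qed
  have "g (x \<cdot> v [^]\<^bsub>H\<^esub> k) = g x \<star> g u [^]\<^bsub>K\<^esub> k \<and>
      g (x \<cdot> v [^]\<^bsub>H\<^esub> k \<cdot> u) \<star> g u = g (x \<cdot> v [^]\<^bsub>H\<^esub> k)"
  proof (induction k)
    case 0
    then show ?case using x bad by simp
  next
    case (Suc k)
    define y where "y = x \<cdot> v [^]\<^bsub>H\<^esub> k"
    have y: "y \<in> carrier H" "y \<notin> Units H"
      using x uc H.mult_unit_iff[of x "v [^]\<^bsub>H\<^esub> k"] by (auto simp: y_def)
    have IH: "g y = g x \<star> g u [^]\<^bsub>K\<^esub> k" "g (y \<cdot> u) \<star> g u = g y" using Suc unfolding y_def by auto
    have yv: "x \<cdot> v [^]\<^bsub>H\<^esub> Suc k = y \<cdot> v" unfolding y_def using x uc by (simp add: H.m_assoc)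
    have "y \<cdot> v \<cdot> u = (u \<cdot> v) \<cdot> y" using y uc(1,2) by (simp add: H.m_ac)
    then have yvu: "y \<cdot> v \<cdot> u = y" using y uc by simp
    have "g (y \<cdot> v) \<noteq> g y \<star> g v"
    proof
      assume "g (y \<cdot> v) = g y \<star> g v"
      then have "g (y \<cdot> v) \<star> g u = g y \<star> (g u \<star> g v)" using y uc by (simp add: K.m_ac)
      then have "g (y \<cdot> v) \<star> g u = g y" using ab y by simp
      then have "g (y \<cdot> v) \<star> g u = g (y \<cdot> u) \<star> g u" using IH(2) by simp
      then have "y \<cdot> v = y \<cdot> u" using y uc by (simp add: K.mult_right_cancel g_inj)
      then show False using y uc uv by (simp add: H.mult_left_cancel)
    qed
    then have "g (y \<cdot> v) \<star> g v = g y" using nonunit_unit_sign[OF y vi vU] by blast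
    then have "g y \<star> g u = g (y \<cdot> v) \<star> (g u \<star> g v)" using y uc by (metis K.m_assoc K.m_comm H.m_closed g_closed)
    then have new: "g (y \<cdot> v) = g y \<star> g u" using ab y uc by simp
    have "g (y \<cdot> v) = g x \<star> g u [^]\<^bsub>K\<^esub> Suc k" unfolding new IH(1) using x uc by (simp add: K.m_assoc)
    then show ?case unfolding yv yvu using new by simp
  qed
  then show ?thesis unfolding v_def by blast
qed

text \<open>The decisive asymmetry: \<open>{1, u, u\<^sup>3, x}\<close> and \<open>{1, u, u\<^sup>2, u\<^sup>3, x}\<close> have the same product with
  \<open>{1, u, x inv u\<^sup>2}\<close>, but the mirrored sets on the side of \<open>K\<close> do not.\<close>

lemma not_reflected:
  assumes x: "x \<in> carrier H" "x \<notin> Units H" and u: "infinite_order H u" "u \<in> Units H"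
    and bad: "g (x \<cdot> u) \<star> g u = g x"
  shows False
proof -
  define v where "v = inv\<^bsub>H\<^esub> u"
  define a where "a = g u"
  define p where "p = g x"
  define L where "L = (\<lambda>(i, j). p [^]\<^bsub>K\<^esub> (i::nat) \<star> a [^]\<^bsub>K\<^esub> (j::nat))"
  define U where "U i = u [^]\<^bsub>H\<^esub> (i::nat)" for i
  have uc: "u \<in> carrier H" "v \<in> carrier H" "u \<cdot> v = \<one>\<^sub>H" and vU: "v \<in> Units H"
    using u by (auto simp: v_def)
  have pc: "p \<in> carrier K" "p \<notin> Units K" unfolding p_def using x g_nonunit by auto
  have aU: "a \<in> Units K" "infinite_order K a" unfolding a_def using u g_unit_infinite g_infinite_imp by auto
  have ac: "a \<in> carrier K" using aU by blast
  have L_inj: "L m = L n \<longleftrightarrow> m = n" for m n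
    unfolding L_def using K.level_pow_unique[OF pc aU] by (cases m; cases n) auto
  have L_mem: "L x \<in> L ` A \<longleftrightarrow> x \<in> A" for x A using L_inj by (auto simp: image_iff)
  have L_mult: "L (i, j) \<star> L (k, l) = L (i + k, j + l)" for i j k l
    unfolding L_def using K.level_pow_mult[OF pc(1) ac] by simp
  have L_a: "L (0, j) = a [^]\<^bsub>K\<^esub> j" for j unfolding L_def using ac by simp
  have L_p: "L (1, j) = p \<star> a [^]\<^bsub>K\<^esub> j" for j unfolding L_def using pc by simp
  have L_one: "L (0, 0) = \<one>\<^sub>K" using L_a[of 0] by simp
  have L_a1: "L (0, 1) = a" using L_a[of 1] ac by simp
  have Uc: "U i \<in> carrier H" for i unfolding U_def using uc by simp
  have UU: "U i \<cdot> U j = U (i + j)" for i j unfolding U_def using uc by (simp add: H.pow_add)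
  have U0: "U 0 = \<one>\<^sub>H" "U 1 = u" using uc by (simp_all add: U_def)
  have U_inj: "U i = U j \<longleftrightarrow> i = j" for i j unfolding U_def using H.infinite_order_inj[OF u(1)] .
  have gU: "g (U i) = L (0, i)" for i unfolding U_def L_a a_def using g_pow[OF u(1)] .
  have U_unit: "U i \<in> Units H" for i unfolding U_def using u H.pow_unit by blast
  have U_inf: "infinite_order H (U i)" if "i > 0" for i unfolding U_def using u H.infinite_order_pow that by blast
  have Ux: "U i \<noteq> x" for i using U_unit x by metis
  have mem: "L (0, i) \<in> f X \<longleftrightarrow> U i \<in> X" if "X \<in> PH" for X i
  proof (cases "i = 0")
    case True
    then show ?thesis using that f_closed[OF that] by (simp add: U0 L_one mem_Pfin1)
  next
    case False
    then show ?thesis using infinite_unit_mem_iff[OF U_inf U_unit that] gU by simp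
  qed
  have chain: "g (x \<cdot> v [^]\<^bsub>H\<^esub> k) = L (1, k)" for k :: nat
    unfolding L_p v_def a_def p_def by (rule reflected_chain[OF assms])
  have Uv: "U k \<cdot> v [^]\<^bsub>H\<^esub> k = \<one>\<^sub>H" for k unfolding U_def v_def using H.inv_pow[OF u(2)] .
  have inv3: "inv\<^bsub>H\<^esub> (U 3) = v [^]\<^bsub>H\<^esub> (3::nat)"
    using Uv[of 3] U_unit[of 3] uc by (metis H.Units_closed H.Units_l_inv H.inv_unique H.Units_inv_closed H.nat_pow_closed)
  \<comment> \<open>The chain at 3 supplies the reflected hypothesis of the triple lemma for
    \<open>w = u^3\<close>.\<close>
  have f3: "f {\<one>\<^sub>H, U 3, x} = {L (0, 0), L (0, 3), L (1, 3)}"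
  proof -
    have eq: "g x \<star> g (U 3) = L (1, 3)" using L_p[of 3] L_a[of 3] gU[of 3] by (simp add: p_def)
    then have "g (x \<cdot> inv\<^bsub>H\<^esub> (U 3)) = g x \<star> g (U 3)" using chain[of 3] by (simp add: inv3)
    then show ?thesis using f_triple_reflected[OF x U_inf[of 3] U_unit[of 3]] eq gU L_one by simp
  qed
  define X1 where "X1 = {U 0, U 1, U 3, x}"
  define X3 where "X3 = {U 0, U 1, U 2, U 3, x}"
  define xv where "xv = x \<cdot> v [^]\<^bsub>H\<^esub> (2::nat)"
  define X2 where "X2 = {\<one>\<^sub>H, u, xv}"
  have xvc: "xv \<in> carrier H" "xv \<notin> Units H"
    using x uc H.mult_unit_iff[of x "v [^]\<^bsub>H\<^esub> (2::nat)"] by (auto simp: xv_def)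
  have X: "X1 \<in> PH" "X2 \<in> PH" "X3 \<in> PH"
    unfolding X1_def X2_def X3_def using U0 Uc x xvc uc by (auto simp: mem_Pfin1)
  have f2: "f X2 = {L (0, 0), L (0, 1), L (1, 3)}"
  proof -
    have "xv \<cdot> v = x \<cdot> v [^]\<^bsub>H\<^esub> (3::nat)"
      unfolding xv_def using x uc by (simp add: H.m_assoc numeral_3_eq_3 numeral_2_eq_2)
    then have "g (xv \<cdot> inv\<^bsub>H\<^esub> u) = L (1, 3)" using chain[of 3] by (simp add: v_def)
    moreover have "g xv \<star> g u = L (1, 3)"
      using chain[of 2] L_mult[of 1 2 0 1] L_a1 by (simp add: xv_def a_def)
    ultimately show ?thesis using f_triple_reflected[OF xvc u] unfolding X2_def
      by (simp add: L_one L_a1[symmetric] a_def[symmetric])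
  qed
  have fill: "X1 \<odot> seg H u 2 = {\<one>\<^sub>H, U 3, x} \<odot> seg H u 2"
    unfolding U_def
  proof (rule seg_fill)
    show "{\<one>\<^sub>H, u [^]\<^bsub>H\<^esub> (3::nat), x} \<subseteq> X1" unfolding X1_def using U0 by (auto simp: U_def)
    have "U i \<in> seg H u 3" if "i \<le> 3" for i unfolding U_def using that by (rule H.seg_in)
    then show "X1 \<subseteq> insert x (seg H u 3)" unfolding X1_def by auto
  qed (use uc x in auto)
  have segK: "seg K a 2 = {L (0, 0), L (0, 1), L (0, 2)}"
    unfolding L_a seg_def by (auto simp: atMost_Suc numeral_2_eq_2)
  have tri: "{\<one>\<^sub>H, U 3, x} \<in> PH" using Uc x by (simp add: mem_Pfin1)
  have "f X1 \<circledast> seg K a 2 = {L (0, 0), L (0, 3), L (1, 3)} \<circledast> seg K a 2"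
    using arg_cong[OF fill, of f] X f3 f_mult[of X1 "seg H u 2"]
      f_mult[OF _ H.seg_Pfin1[OF uc(1)], of "{\<one>\<^sub>H, U 3, x}" 2] x uc Uc tri
    by (simp add: H.seg_Pfin1 f_seg_g a_def[symmetric])
  then have prod1: "f X1 \<circledast> seg K a 2 = L ` {(0,0), (0,1), (0,2), (0,3), (0,4), (0,5), (1,3), (1,4), (1,5)}"
    unfolding segK by (simp add: set_mult_def L_mult insert_commute numeral_2_eq_2)
  have fX1: "f X1 \<in> PK" using X f_closed by blast
  have inX1: "L (0, 0) \<in> f X1" "L (0, 1) \<in> f X1" "L (0, 3) \<in> f X1"
    using mem[OF X(1)] by (auto simp: X1_def)
  have "card X1 = 4" unfolding X1_def using U_inj Ux by (simp add: card_insert_if)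
  then have "card (f X1) = 4" using card_image_f X by simp
  then have "card (f X1 - {L (0, 0), L (0, 1), L (0, 3)}) = 1"
    using inX1 L_inj by (subst card_Diff_subset) auto
  then obtain q where q': "f X1 - {L (0, 0), L (0, 1), L (0, 3)} = {q}" by (auto simp: card_1_singleton_iff)
  then have q: "f X1 = {L (0, 0), L (0, 1), L (0, 3), q}" "q \<in> f X1"
    and qn: "q \<noteq> L (0, 0)" "q \<noteq> L (0, 1)" "q \<noteq> L (0, 3)" using inX1 by blast+
  have qc: "q \<in> carrier K" using q fX1 by (auto simp: mem_Pfin1)
  have "q \<star> L (0, 0) \<in> f X1 \<circledast> seg K a 2" "q \<star> L (0, 2) \<in> f X1 \<circledast> seg K a 2"
    using q(2) unfolding segK by (auto intro: set_multI)
  then have q2: "q \<in> L ` {(0,0), (0,1), (0,2), (0,3), (0,4), (0,5), (1,3), (1,4), (1,5)}"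
    "q \<star> L (0, 2) \<in> L ` {(0,0), (0,1), (0,2), (0,3), (0,4), (0,5), (1,3), (1,4), (1,5)}"
    unfolding prod1 using qc by (simp_all add: L_one)
  then obtain i j where ij: "q = L (i, j)"
    "(i, j) \<in> {(0,0), (0,1), (0,2), (0,3), (0,4), (0,5), (1,3), (1,4), (1,5)}" by blast
  \<comment> \<open>The powers of \<open>a\<close> in \<open>f X1\<close> are known from
    \<open>mem\<close>, so the fourth element is on level 1. Both \<open>q\<close> and
    \<open>q a^2\<close> must have exponents between 3 and 5, which leaves exponent 3.\<close>
  have "i \<noteq> 0"
  proof
    assume "i = 0"
    then have "U j \<in> X1" using mem[OF X(1), of j] q ij by simp
    then have "j = 0 \<or> j = 1 \<or> j = 3" unfolding X1_def using U_inj Ux by auto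
    then show False using qn ij \<open>i = 0\<close> by auto
  qed
  moreover have "(i, j + 2) \<in> {(0,0), (0,1), (0,2), (0,3), (0,4), (0,5), (1,3), (1,4), (1,5)}"
    using q2(2) L_mult[of i j 0 2] unfolding ij(1) by (simp only: L_mem add_0_right)
  ultimately have "(i, j) = (1, 3)" using ij(2) by auto
  then have q: "f X1 = {L (0, 0), L (0, 1), L (0, 3), L (1, 3)}" using q(1) ij(1) by simp
  \<comment> \<open>The extra element \<open>u^2\<close> is absorbed: \<open>u^2 = u u\<close>,
    \<open>u^2 u = u^3\<close>, and \<open>u^2\<close> times \<open>x u^(-2)\<close> is
    \<open>x\<close>.\<close>
  have "X1 \<odot> X2 = X3 \<odot> X2"
  proof (rule equalityI)
    show "X1 \<odot> X2 \<subseteq> X3 \<odot> X2" unfolding set_mult_def X1_def X3_def by blast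
    have X13: "X3 = insert (U 2) X1" unfolding X1_def X3_def by blast
    have "U 2 \<cdot> e \<in> X1 \<odot> X2" if "e \<in> X2" for e
    proof -
      consider "e = \<one>\<^sub>H" | "e = u" | "e = xv" using \<open>e \<in> X2\<close> unfolding X2_def by blast
      then show ?thesis
      proof cases
        case 1
        then have "U 2 \<cdot> e = U 1 \<cdot> u" using UU[of 1 1] Uc[of 2] U0 by (simp add: numeral_2_eq_2)
        then show ?thesis unfolding X1_def X2_def by (auto intro: set_multI)
      next
        case 2
        then have "U 2 \<cdot> e = U 3 \<cdot> \<one>\<^sub>H" using UU[of 2 1] Uc[of 3] U0 by simp
        then show ?thesis unfolding X1_def X2_def by (auto intro: set_multI)
      next
        case 3
        have "U 2 \<cdot> e = (U 2 \<cdot> v [^]\<^bsub>H\<^esub> (2::nat)) \<cdot> x"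
          unfolding 3 xv_def using x Uc uc by (simp add: H.m_ac)
        then have "U 2 \<cdot> e = x \<cdot> \<one>\<^sub>H" using Uv[of 2] x by simp
        then show ?thesis unfolding X1_def X2_def by (auto intro: set_multI)
      qed
    qed
    then show "X3 \<odot> X2 \<subseteq> X1 \<odot> X2" unfolding X13 by (auto simp: mem_set_mult)
  qed
  then have "f X1 \<circledast> f X2 = f X3 \<circledast> f X2" using f_mult X by metis
  moreover have "L (0, 2) \<in> f X3" using mem[OF X(3)] by (simp add: X3_def)
  then have "L (0, 2) \<star> L (1, 3) \<in> f X3 \<circledast> f X2" unfolding f2 by (intro set_multI) auto
  \<comment> \<open>On level 1 the right-hand product has only the exponents 3, 4 and 6.\<close>
  ultimately have "L (1, 5) \<in> {L (0, 0), L (0, 1), L (0, 3), L (1, 3)} \<circledast> {L (0, 0), L (0, 1), L (1, 3)}"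
    unfolding q f2 using L_mult[of 0 2 1 3] by simp
  then show False by (auto simp: set_mult_def L_mult L_inj)
qed

lemma g_mult_nonunit_infinite_unit:
  assumes "x \<in> carrier H" "x \<notin> Units H" "infinite_order H u" "u \<in> Units H"
  shows "g (x \<cdot> u) = g x \<star> g u"
  using nonunit_unit_sign[OF assms] not_reflected[OF assms] by blast

lemma g_mult_unit:
  assumes ex: "\<exists>u. infinite_order H u \<and> u \<in> Units H" and x: "x \<in> carrier H" and t: "t \<in> Units H"
  shows "g (x \<cdot> t) = g x \<star> g t"
proof -
  have tc: "t \<in> carrier H" using t by blast
  consider "x \<in> Units H" | "x \<notin> Units H" "infinite_order H t" | "x \<notin> Units H" "\<not> infinite_order H t" by blast
  then show ?thesis
  proof cases
    case 1
    then show ?thesis using g_mult_units ex t by blast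
  next
    case 2
    then show ?thesis using g_mult_nonunit_infinite_unit x t by blast
  next
    case 3
    obtain u where u: "infinite_order H u" "u \<in> Units H" using ex by blast
    \<comment> \<open>A torsion \<open>t\<close> is split as \<open>w u\<close> with both factors
      units of infinite order, for which multiplicativity is known.\<close>
    define w where "w = inv\<^bsub>H\<^esub> u \<cdot> t"
    have uc: "u \<in> carrier H" "inv\<^bsub>H\<^esub> u \<in> carrier H" using u by auto
    have w: "infinite_order H w" "w \<in> Units H"
      unfolding w_def using H.infinite_order_mult_torsion[OF H.infinite_order_inv[OF u] tc 3(2)] u t by auto
    have wc: "w \<in> carrier H" using w by blast
    have wu: "w \<cdot> u = t"
    proof -
      have "w \<cdot> u = (u \<cdot> inv\<^bsub>H\<^esub> u) \<cdot> t" unfolding w_def using uc tc by (simp add: H.m_ac del: H.Units_r_inv)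
      then show ?thesis using u tc by simp
    qed
    have xw: "x \<cdot> w \<in> carrier H" "x \<cdot> w \<notin> Units H" using x wc 3 H.mult_unit_iff by auto
    have "g (x \<cdot> t) = g (x \<cdot> w \<cdot> u)" using x wc uc by (simp add: H.m_assoc wu)
    also have "\<dots> = (g x \<star> g w) \<star> g u"
      using g_mult_nonunit_infinite_unit[OF xw u] g_mult_nonunit_infinite_unit[OF x 3(1) w] by simp
    also have "\<dots> = g x \<star> g (w \<cdot> u)"
      using g_mult_units[OF ex w(2) u(2)] x wc uc by (simp add: K.m_assoc)
    finally show ?thesis using wu by simp
  qed
qed

text \<open>The power relation is applied to \<open>x u^k\<close> and \<open>y u^k\<close>. In the
  alternatives \<open>B\<close> and \<open>C\<close> the shift cancels on the left but not in the
  power of \<open>g (x y)\<close>, so together they can hold for at most one \<open>k\<close>.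
  Alternative \<open>A\<close> for two values of \<open>k\<close> forces the exponent to be
  1.\<close>

lemma g_mult_nonunits:
  assumes ex: "\<exists>u. infinite_order H u \<and> u \<in> Units H"
    and x: "x \<in> carrier H" "x \<notin> Units H" and y: "y \<in> carrier H" "y \<notin> Units H"
  shows "g (x \<cdot> y) = g x \<star> g y"
proof -
  obtain u where u: "infinite_order H u" "u \<in> Units H" using ex by blast
  have uc: "u \<in> carrier H" using u by blast
  define a where "a = g u"
  define c where "c = x \<cdot> y"
  define p where "p = g c"
  have aU: "a \<in> Units K" "infinite_order K a" unfolding a_def using u g_unit_infinite g_infinite_imp by auto
  have ac: "a \<in> carrier K" using aU by blast
  have c: "c \<in> carrier H" "c \<notin> Units H" unfolding c_def using x y H.mult_unit_iff by auto
  have pc: "p \<in> carrier K" "p \<notin> Units K" unfolding p_def using c g_nonunit by auto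
  have gc: "g x \<in> carrier K" "g y \<in> carrier K" using x y by auto
  note lev = K.level_pow_unique[OF pc aU]
  have shift: "g (z \<cdot> u [^]\<^bsub>H\<^esub> k) = g z \<star> a [^]\<^bsub>K\<^esub> k" if "z \<in> carrier H" for z and k :: nat
    using g_mult_unit[OF ex that H.pow_unit[OF u(2), of k]] g_pow[OF u(1), of k] by (simp add: a_def)
  define A where "A k i \<longleftrightarrow> g x \<star> g y \<star> a [^]\<^bsub>K\<^esub> (2 * k) = p [^]\<^bsub>K\<^esub> i \<star> a [^]\<^bsub>K\<^esub> (2 * k * i)" for k i :: nat
  define B where "B k i \<longleftrightarrow> g y = g x \<star> (p [^]\<^bsub>K\<^esub> i \<star> a [^]\<^bsub>K\<^esub> (2 * k * i))" for k i :: nat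
  define C where "C k i \<longleftrightarrow> g x = g y \<star> (p [^]\<^bsub>K\<^esub> i \<star> a [^]\<^bsub>K\<^esub> (2 * k * i))" for k i :: nat
  have step: "\<exists>i>0. A k i \<or> B k i \<or> C k i" for k
  proof -
    define z w where "z = x \<cdot> u [^]\<^bsub>H\<^esub> k" and "w = y \<cdot> u [^]\<^bsub>H\<^esub> k"
    have zw: "z \<in> carrier H" "w \<in> carrier H" "z \<notin> Units H" "w \<notin> Units H"
      unfolding z_def w_def using x y uc H.mult_unit_iff by auto
    have prod: "z \<cdot> w = c \<cdot> u [^]\<^bsub>H\<^esub> (2 * k)"
      unfolding z_def w_def c_def mult_2 H.pow_add[OF uc] using x y uc by (simp add: H.m_ac)
    have "g (z \<cdot> w) = p \<star> a [^]\<^bsub>K\<^esub> (2 * k)" unfolding prod p_def using shift c by simp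
    then have pow: "g (z \<cdot> w) [^]\<^bsub>K\<^esub> i = p [^]\<^bsub>K\<^esub> i \<star> a [^]\<^bsub>K\<^esub> (2 * k * i)" for i :: nat
      using pc ac by (simp add: K.nat_pow_distrib K.nat_pow_pow)
    have "z \<noteq> \<one>\<^sub>H" "w \<noteq> \<one>\<^sub>H" "z \<cdot> w \<notin> Units H" using zw H.mult_unit_iff by auto
    from nonunit_product_step[OF zw(1,2) this] obtain i :: nat where i: "i > 0"
      "g z \<star> g w = p [^]\<^bsub>K\<^esub> i \<star> a [^]\<^bsub>K\<^esub> (2 * k * i)
        \<or> g w = g z \<star> (p [^]\<^bsub>K\<^esub> i \<star> a [^]\<^bsub>K\<^esub> (2 * k * i))
        \<or> g z = g w \<star> (p [^]\<^bsub>K\<^esub> i \<star> a [^]\<^bsub>K\<^esub> (2 * k * i))"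
      unfolding pow by blast
    have gz: "g z = g x \<star> a [^]\<^bsub>K\<^esub> k" "g w = g y \<star> a [^]\<^bsub>K\<^esub> k"
      unfolding z_def w_def using shift x y by auto
    define s where "s = p [^]\<^bsub>K\<^esub> i \<star> a [^]\<^bsub>K\<^esub> (2 * k * i)"
    have sc: "s \<in> carrier K" unfolding s_def using pc ac by simp
    have "g z \<star> g w = g x \<star> g y \<star> a [^]\<^bsub>K\<^esub> (2 * k)"
      unfolding gz mult_2 K.pow_add[OF ac] using gc ac by (simp add: K.m_ac)
    moreover have "g z \<star> s = (g x \<star> s) \<star> a [^]\<^bsub>K\<^esub> k" "g w \<star> s = (g y \<star> s) \<star> a [^]\<^bsub>K\<^esub> k"
      unfolding gz using gc ac sc by (simp_all add: K.m_ac)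
    ultimately have "A k i \<or> B k i \<or> C k i"
      using i(2) gc sc ac unfolding A_def B_def C_def s_def[symmetric] gz
      by (simp add: K.mult_right_cancel)
    then show ?thesis using i(1) by blast
  qed
  have BB: "k = l" if "B k i" "B l j" "i > 0" for k l i j
  proof -
    have "p [^]\<^bsub>K\<^esub> i \<star> a [^]\<^bsub>K\<^esub> (2 * k * i) = p [^]\<^bsub>K\<^esub> j \<star> a [^]\<^bsub>K\<^esub> (2 * l * j)"
      using that gc pc ac unfolding B_def by (metis K.l_cancel K.m_closed K.nat_pow_closed)
    then show ?thesis using lev \<open>i > 0\<close> by auto
  qed
  have CC: "k = l" if "C k i" "C l j" "i > 0" for k l i j
  proof -
    have "p [^]\<^bsub>K\<^esub> i \<star> a [^]\<^bsub>K\<^esub> (2 * k * i) = p [^]\<^bsub>K\<^esub> j \<star> a [^]\<^bsub>K\<^esub> (2 * l * j)"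
      using that gc pc ac unfolding C_def by (metis K.l_cancel K.m_closed K.nat_pow_closed)
    then show ?thesis using lev \<open>i > 0\<close> by auto
  qed
  have BC: "\<not> (B k i \<and> C l j)" if "i > 0" for k l i j
  proof
    assume *: "B k i \<and> C l j"
    define s t where "s = p [^]\<^bsub>K\<^esub> i \<star> a [^]\<^bsub>K\<^esub> (2 * k * i)" and "t = p [^]\<^bsub>K\<^esub> j \<star> a [^]\<^bsub>K\<^esub> (2 * l * j)"
    have st: "s \<in> carrier K" "t \<in> carrier K" unfolding s_def t_def using pc ac by auto
    have gy: "g y = g x \<star> s" and gx: "g x = g y \<star> t" using * unfolding B_def C_def s_def t_def by blast+
    have "g y \<star> (t \<star> s) = (g y \<star> t) \<star> s" using gc st by (simp add: K.m_assoc)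
    also have "\<dots> = g x \<star> s" by (simp only: gx[symmetric])
    also have "\<dots> = g y" by (simp only: gy[symmetric])
    finally have "t \<star> s = \<one>\<^sub>K" using gc st by (simp add: K.mult_eq_self_right)
    then have "s \<in> Units K" using st K.mult_unit_iff[of t s] by simp
    then have "p [^]\<^bsub>K\<^esub> i \<in> Units K" unfolding s_def using pc ac K.mult_unit_iff by simp
    moreover obtain m where "i = Suc m" using \<open>i > 0\<close> gr0_implies_Suc by blast
    ultimately show False using pc by (simp add: K.mult_unit_iff)
  qed
  have AA: "g x \<star> g y = p" if "A k i" "A l j" "k < l" for k l i j
  proof -
    have "p [^]\<^bsub>K\<^esub> i \<star> a [^]\<^bsub>K\<^esub> (2 * k * i + 2 * l) = g x \<star> g y \<star> a [^]\<^bsub>K\<^esub> (2 * k) \<star> a [^]\<^bsub>K\<^esub> (2 * l)"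
      using that(1) pc ac unfolding A_def by (simp add: K.pow_add K.m_assoc)
    also have "\<dots> = g x \<star> g y \<star> a [^]\<^bsub>K\<^esub> (2 * l) \<star> a [^]\<^bsub>K\<^esub> (2 * k)" using gc ac by (simp add: K.m_ac)
    also have "\<dots> = p [^]\<^bsub>K\<^esub> j \<star> a [^]\<^bsub>K\<^esub> (2 * l * j + 2 * k)"
      using that(2) pc ac unfolding A_def by (simp add: K.pow_add K.m_assoc)
    finally have eq: "i = j" "2 * k * i + 2 * l = 2 * l * j + 2 * k" using lev by auto
    \<comment> \<open>Comparing exponents of \<open>p\<close> and of \<open>a\<close> gives
      \<open>i = j\<close> and \<open>k i + l = l i + k\<close>.\<close>
    then have "(int l - int k) * (int i - 1) = 0"
      by (simp add: algebra_simps flip: of_nat_mult of_nat_add)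
    then have "i = 1" using that(3) by auto
    then have "g x \<star> g y \<star> a [^]\<^bsub>K\<^esub> (2 * k) = p \<star> a [^]\<^bsub>K\<^esub> (2 * k)"
      using that(1) pc unfolding A_def by simp
    then show ?thesis using gc pc ac by (simp add: K.mult_right_cancel)
  qed
  \<comment> \<open>Three shifts suffice: at most one is lost to \<open>B\<close> or
    \<open>C\<close>, leaving two instances of \<open>A\<close>.\<close>
  obtain i0 i1 i2 where i: "i0 > 0" "A 0 i0 \<or> B 0 i0 \<or> C 0 i0" "i1 > 0" "A 1 i1 \<or> B 1 i1 \<or> C 1 i1"
    "i2 > 0" "A 2 i2 \<or> B 2 i2 \<or> C 2 i2"
    using step[of 0] step[of 1] step[of 2] by blast
  have two: "A k i \<or> A l j" if "k \<noteq> l" "i > 0" "j > 0" "A k i \<or> B k i \<or> C k i" "A l j \<or> B l j \<or> C l j" for k l i j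
    using that BB[of k i l j] CC[of k i l j] BC[of i k l j] BC[of j l k i] by blast
  have "A 0 i0 \<or> A 1 i1" using two[of 0 1 i0 i1] i by simp
  moreover have "A 0 i0 \<or> A 2 i2" using two[of 0 2 i0 i2] i by simp
  moreover have "A 1 i1 \<or> A 2 i2" using two[of 1 2 i1 i2] i by simp
  ultimately have "g x \<star> g y = p" using AA[of 0 i0 1 i1] AA[of 0 i0 2 i2] AA[of 1 i1 2 i2] by auto
  then show ?thesis by (simp add: p_def c_def)
qed

lemma g_mult_infinite_unit_case:
  assumes ex: "\<exists>u. infinite_order H u \<and> u \<in> Units H" and "x \<in> carrier H" "y \<in> carrier H"
  shows "g (x \<cdot> y) = g x \<star> g y"
proof -
  consider "y \<in> Units H" | "x \<in> Units H" | "x \<notin> Units H" "y \<notin> Units H" by blast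
  then show ?thesis
  proof cases
    case 1
    then show ?thesis using g_mult_unit assms by blast
  next
    case 2
    then show ?thesis using g_mult_unit[OF ex assms(3) 2] assms by (simp add: H.m_comm K.m_comm)
  next
    case 3
    then show ?thesis using g_mult_nonunits assms by blast
  qed
qed

subsection \<open>Torsion units\<close>

lemma f_submonoid: "finite_submonoid H V \<Longrightarrow> finite_submonoid K (f V)"
proof -
  assume "finite_submonoid H V"
  then have V: "V \<in> PH" "V \<odot> V = V"
    by (auto simp: finite_submonoid_def finite_submonoid_axioms_def)
  then have "f V \<circledast> f V = f V" using f_mult[of V V] by simp
  then show ?thesis using f_closed[OF V(1)]
    by (intro finite_submonoid.intro finite_submonoid_axioms.intro K.comm_monoid_cancel_axioms)
qed

text \<open>Membership of \<open>v\<close> in \<open>V\<close> amounts to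
  \<open>{1, v} V = V\<close>, an identity that \<open>f\<close> preserves.\<close>

lemma g_submonoid:
  assumes "finite_submonoid H V" and v: "v \<in> V" shows "g v \<in> f V"
proof -
  interpret V: finite_submonoid H V by fact
  have vc: "v \<in> carrier H" using v V.V_closed by blast
  have "{\<one>\<^sub>H, v} \<odot> V = V"
    using V.V_translate[OF v] by (simp add: V.pair_mult_V[OF vc])
  then have "f ({\<one>\<^sub>H, v} \<odot> V) = f V" by simp
  then have eq: "{\<one>\<^sub>K, g v} \<circledast> f V = f V"
    using V.V_Pfin1 vc by (simp add: f_mult H.pair_Pfin1 g_pair)
  have "\<one>\<^sub>K \<in> f V" using f_closed[OF V.V_Pfin1] by (simp add: mem_Pfin1)
  then have "g v \<star> \<one>\<^sub>K \<in> {\<one>\<^sub>K, g v} \<circledast> f V" by (intro set_multI) auto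
  then show ?thesis using eq vc by simp
qed

lemma g_submonoid_image:
  assumes "finite_submonoid H V" shows "g ` V = f V"
proof -
  interpret V: finite_submonoid H V by fact
  have "finite (f V)" using f_closed[OF V.V_Pfin1] by (simp add: mem_Pfin1)
  moreover have "g ` V \<subseteq> f V" using g_submonoid assms by blast
  moreover have "inj_on g V" using g_inj V.V_closed by (auto simp: inj_on_def)
  then have "card (g ` V) = card (f V)" using card_image_f[OF V.V_Pfin1] by (simp add: card_image)
  ultimately show ?thesis by (rule card_subset_eq)
qed

lemma thick_imp_f:
  assumes V: "finite_submonoid H V" and x: "x \<in> carrier H" and X: "thick H V x X"
  shows "thick K (f V) (g x) (f X)"
proof -
  interpret V: finite_submonoid H V by fact
  have X': "X \<in> PH" "X \<odot> V = {\<one>\<^sub>H, x} \<odot> V" "card X = Suc (card V)" using X by (auto simp: thick_def)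
  have pair: "f ({\<one>\<^sub>H, x} \<odot> V) = {\<one>\<^sub>K, g x} \<circledast> f V"
    using x V.V_Pfin1 by (simp add: f_mult H.pair_Pfin1 g_pair)
  have "f X \<circledast> f V = {\<one>\<^sub>K, g x} \<circledast> f V"
    using f_mult[OF X'(1) V.V_Pfin1] pair X'(2) by simp
  moreover have "card (f X) = Suc (card (f V))" using X' V.V_Pfin1 by (simp add: card_image_f)
  moreover have "W = f V"
    if W: "W \<in> PK" "W \<circledast> f V = f V" "f X \<circledast> W = {\<one>\<^sub>K, g x} \<circledast> f V" for W
  proof -
    obtain Z where Z: "Z \<in> PH" "f Z = W" using f_surj W(1) by blast
    have "f (Z \<odot> V) = f V" "f (X \<odot> Z) = f ({\<one>\<^sub>H, x} \<odot> V)"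
      using W Z X' V.V_Pfin1 pair by (simp_all add: f_mult)
    then have "Z \<odot> V = V" "X \<odot> Z = {\<one>\<^sub>H, x} \<odot> V"
      using f_inj Z X' V.V_Pfin1 x H.Pfin1_mult_closed H.pair_Pfin1 by metis+
    then have "Z = V" using X Z unfolding thick_def by blast
    then show ?thesis using Z by simp
  qed
  ultimately show ?thesis using f_closed[OF X'(1)] unfolding thick_def by blast
qed

lemma thick_f:
  assumes V: "finite_submonoid H V" and x: "x \<in> carrier H" and X: "X \<in> PH"
  shows "thick K (f V) (g x) (f X) \<longleftrightarrow> thick H V x X"
proof
  interpret S: pfin_iso K H "inv_into PH f" by (rule swap)
  assume "thick K (f V) (g x) (f X)"
  moreover have "V \<in> PH" using V by (auto simp: finite_submonoid_def finite_submonoid_axioms_def)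
  ultimately show "thick H V x X"
    using S.thick_imp_f[OF f_submonoid[OF V], of "g x" "f X"] x X inv_f swap_g by simp
qed (rule thick_imp_f[OF V x])

text \<open>The image is thick, so it has bottom or top shape. A top set has a square with another
  thick factor; pulling that factorization back would contradict
  \<open>thick_bottom_square\<close>.\<close>

lemma f_thick_bottom:
  assumes V: "finite_submonoid H V" and x: "infinite_order H x" and u: "u \<in> V" "u \<noteq> \<one>\<^sub>H"
  shows "f (insert \<one>\<^sub>H ((\<lambda>v. x \<cdot> v) ` V)) = insert \<one>\<^sub>K ((\<lambda>v. g x \<star> v) ` f V)"
proof -
  interpret V: finite_submonoid H V by fact
  interpret W: finite_submonoid K "f V" by (rule f_submonoid[OF V])
  define X where "X = insert \<one>\<^sub>H ((\<lambda>v. x \<cdot> v) ` V)"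
  have xc: "x \<in> carrier H" using x H.infinite_order_closed by blast
  have gx: "infinite_order K (g x)" using g_infinite_imp x by blast
  have X: "thick H V x X" unfolding X_def using V.thick_bottom[OF x] .
  then have XP: "X \<in> PH" by (simp add: thick_def)
  have fX: "thick K (f V) (g x) (f X)" using thick_f[OF V xc XP] X by simp
  have gu: "g u \<in> f V" "g u \<noteq> \<one>\<^sub>K" using g_submonoid V u g_eq_one V.V_closed by auto
  have "f X \<noteq> insert (g x \<star> v) (f V)" if v: "v \<in> f V" for v
  proof
    assume eq: "f X = insert (g x \<star> v) (f V)"
    obtain A B where AB: "thick K (f V) (g x) A" "thick K (f V) (g x) B" "A \<noteq> f X" "A \<circledast> B = f X \<circledast> f X"
      using W.thick_top_square[OF gx v gu] unfolding eq by blast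
    obtain A' B' where A': "A' \<in> PH" "f A' = A" and B': "B' \<in> PH" "f B' = B"
      using f_surj AB(1,2) unfolding thick_def by metis
    have tA: "thick H V x A'" using thick_f[OF V xc A'(1)] A' AB by simp
    have "f (A' \<odot> B') = f (X \<odot> X)" using AB(4) A' B' XP by (simp add: f_mult)
    then have "A' \<odot> B' = X \<odot> X" using f_inj A' B' XP H.Pfin1_mult_closed by metis
    then have "A' = X" using V.thick_bottom_square[OF x u tA B'(1)] unfolding X_def by blast
    then show False using AB(3) A' by simp
  qed
  then show ?thesis using W.thick_cases[OF gx fX gu] unfolding X_def by blast
qed

text \<open>By injectivity the image is a top set with some corner \<open>g x w\<close>. The
  identity \<open>D^2 = D {1, x}\<close> puts \<open>(g x)^2 w\<close> into the square of that set,
  whose only element in row 2 is \<open>(g x)^2 w^2\<close>; thus \<open>w = 1\<close>.\<close>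

lemma f_thick_top:
  assumes V: "finite_submonoid H V" and x: "infinite_order H x" and u: "u \<in> V" "u \<noteq> \<one>\<^sub>H"
  shows "f (insert x V) = insert (g x) (f V)"
proof -
  interpret V: finite_submonoid H V by fact
  interpret W: finite_submonoid K "f V" by (rule f_submonoid[OF V])
  define D where "D = insert x V"
  have xc: "x \<in> carrier H" using x H.infinite_order_closed by blast
  have gx: "infinite_order K (g x)" using g_infinite_imp x by blast
  have gu: "g u \<in> f V" "g u \<noteq> \<one>\<^sub>K" using g_submonoid V u g_eq_one V.V_closed by auto
  have D: "thick H V x D" unfolding D_def using V.thick_top[OF x V.V_one] xc by simp
  then have DP: "D \<in> PH" by (simp add: thick_def)
  have fD: "thick K (f V) (g x) (f D)" using thick_f[OF V xc DP] D by simp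
  have bot: "insert \<one>\<^sub>H ((\<lambda>v. x \<cdot> v) ` V) \<in> PH" using V.thick_bottom[OF x] by (simp add: thick_def)
  have "u \<in> D" "u \<notin> insert \<one>\<^sub>H ((\<lambda>v. x \<cdot> v) ` V)"
    using u V.row_unique0(1)[OF x _ u(1)] unfolding D_def by auto
  then have "D \<noteq> insert \<one>\<^sub>H ((\<lambda>v. x \<cdot> v) ` V)" by blast
  then have "f D \<noteq> insert \<one>\<^sub>K ((\<lambda>v. g x \<star> v) ` f V)"
    using f_thick_bottom[OF V x u] f_inj[OF DP bot] by simp
  then obtain w where w: "w \<in> f V" "f D = insert (g x \<star> w) (f V)"
    using W.thick_cases[OF gx fD gu] by blast
  have wc: "w \<in> carrier K" "g x \<in> carrier K" using w W.V_closed xc by auto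
  have DD: "D \<odot> D \<subseteq> D \<odot> {\<one>\<^sub>H, x}"
  proof
    fix z assume "z \<in> D \<odot> D"
    then obtain p q where pq: "p \<in> D" "q \<in> D" "z = p \<cdot> q" by (auto simp: mem_set_mult)
    consider "q = x" | "q \<in> V" "p = x" | "q \<in> V" "p \<in> V" using pq unfolding D_def by blast
    then show "z \<in> D \<odot> {\<one>\<^sub>H, x}"
    proof cases
      case 1
      then show ?thesis using pq by (auto intro: set_multI)
    next
      case 2
      then have "z = q \<cdot> x" using pq V.V_closed xc by (simp add: H.m_comm)
      then show ?thesis using 2 unfolding D_def by (auto intro: set_multI)
    next
      case 3
      then have "p \<cdot> q \<in> D" unfolding D_def using V.V_mult by blast
      then have "(p \<cdot> q) \<cdot> \<one>\<^sub>H \<in> D \<odot> {\<one>\<^sub>H, x}" by (intro set_multI) auto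
      then show ?thesis using pq 3 V.V_closed by simp
    qed
  qed
  moreover have "D \<odot> {\<one>\<^sub>H, x} \<subseteq> D \<odot> D" unfolding D_def set_mult_def using V.V_one by blast
  ultimately have "D \<odot> {\<one>\<^sub>H, x} = D \<odot> D" by blast
  then have "f (D \<odot> {\<one>\<^sub>H, x}) = f (D \<odot> D)" by simp
  then have "f D \<circledast> {\<one>\<^sub>K, g x} = f D \<circledast> f D" using DP xc by (simp add: f_mult H.pair_Pfin1 g_pair)
  moreover have "(g x \<star> w) \<star> g x \<in> f D \<circledast> {\<one>\<^sub>K, g x}" unfolding w(2) by (intro set_multI) auto
  ultimately obtain p q where pq: "p \<in> f D" "q \<in> f D" "(g x \<star> w) \<star> g x = p \<star> q"
    by (auto simp: mem_set_mult)
  have lhs: "(g x \<star> w) \<star> g x = g x [^]\<^bsub>K\<^esub> (2::nat) \<star> w" using wc by (simp add: numeral_2_eq_2 K.m_ac)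
  consider "p \<in> f V" "q \<in> f V" | "p \<in> f V" "q = g x \<star> w" | "p = g x \<star> w" "q \<in> f V"
    | "p = g x \<star> w" "q = g x \<star> w" using pq unfolding w(2) by blast
  then have "w = \<one>\<^sub>K"
  proof cases
    case 1
    then have "g x [^]\<^bsub>K\<^esub> (2::nat) \<star> w = g x [^]\<^bsub>K\<^esub> (0::nat) \<star> (p \<star> q)"
      using pq lhs W.V_closed by simp
    then show ?thesis using W.row_unique[OF gx w(1) W.V_mult[OF 1]] by fastforce
  next
    case 2
    then have "g x [^]\<^bsub>K\<^esub> (2::nat) \<star> w = g x [^]\<^bsub>K\<^esub> (1::nat) \<star> (p \<star> w)"
      using pq lhs W.V_closed wc by (simp add: K.m_ac)
    then show ?thesis using W.row_unique[OF gx w(1) W.V_mult[OF 2(1) w(1)]] by fastforce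
  next
    case 3
    then have "g x [^]\<^bsub>K\<^esub> (2::nat) \<star> w = g x [^]\<^bsub>K\<^esub> (1::nat) \<star> (w \<star> q)"
      using pq lhs W.V_closed wc by (simp add: K.m_ac)
    then show ?thesis using W.row_unique[OF gx w(1) W.V_mult[OF w(1) 3(2)]] by fastforce
  next
    case 4
    then have "g x [^]\<^bsub>K\<^esub> (2::nat) \<star> w = g x [^]\<^bsub>K\<^esub> (2::nat) \<star> (w \<star> w)"
      using pq lhs wc by (simp add: numeral_2_eq_2 K.m_ac)
    then have "w = w \<star> w" using W.row_unique[OF gx w(1) W.V_mult[OF w(1) w(1)]] by blast
    then show ?thesis using wc K.mult_eq_self_right by metis
  qed
  then show ?thesis using w wc unfolding D_def by simp
qed

text \<open>Three equations locate the image: multiplying by \<open>V\<close> confines it to rows 0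
  and 1, multiplying by the bottom set \<open>B\<close> controls row 0, and multiplying by the top
  set \<open>D\<close> controls row 1. The cardinality 3 then leaves no choice.\<close>

lemma f_torsion_triple:
  assumes V: "finite_submonoid H V" and x: "infinite_order H x" and u: "u \<in> V" "u \<noteq> \<one>\<^sub>H"
  shows "f {\<one>\<^sub>H, u, x} = {\<one>\<^sub>K, g u, g x}"
proof -
  interpret V: finite_submonoid H V by fact
  interpret W: finite_submonoid K "f V" by (rule f_submonoid[OF V])
  have xc: "x \<in> carrier H" and uc: "u \<in> carrier H" using x H.infinite_order_closed u V.V_closed by auto
  have gx: "infinite_order K (g x)" using g_infinite_imp x by blast
  define a where "a = g u"
  define p where "p = g x"
  have a: "a \<in> f V" unfolding a_def using g_submonoid V u by blast
  have pc: "p \<in> carrier K" "a \<in> carrier K" unfolding p_def a_def using xc uc by auto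
  define T where "T = {\<one>\<^sub>H, u, x}"
  have T: "T \<in> PH" using xc uc by (simp add: T_def mem_Pfin1)
  define B where "B = insert \<one>\<^sub>H ((\<lambda>v. x \<cdot> v) ` V)"
  define D where "D = insert x V"
  have B: "B \<in> PH" "f B = insert \<one>\<^sub>K ((\<lambda>v. p \<star> v) ` f V)"
    using V.thick_bottom[OF x] f_thick_bottom[OF V x u] by (auto simp: B_def thick_def p_def)
  have D: "D \<in> PH" "f D = insert p (f V)"
    using V.thick_top[OF x V.V_one] xc f_thick_top[OF V x u] by (auto simp: D_def thick_def p_def)
  have fT: "f T \<in> PK" using T f_closed by blast
  then have fTc: "q \<in> carrier K" if "q \<in> f T" for q using that by (auto simp: mem_Pfin1)
  have "T \<odot> V \<subseteq> {\<one>\<^sub>H, x} \<odot> V"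
  proof
    fix z assume "z \<in> T \<odot> V"
    then obtain v where v: "v \<in> V" "z = \<one>\<^sub>H \<cdot> v \<or> z = u \<cdot> v \<or> z = x \<cdot> v" by (auto simp: T_def mem_set_mult)
    then have "z \<in> V \<or> z = x \<cdot> v" using V.V_mult u V.V_closed by auto
    then show "z \<in> {\<one>\<^sub>H, x} \<odot> V" using v by (auto simp: V.pair_mult_V[OF xc])
  qed
  moreover have "{\<one>\<^sub>H, x} \<odot> V \<subseteq> T \<odot> V" unfolding T_def set_mult_def by blast
  ultimately have "f (T \<odot> V) = f ({\<one>\<^sub>H, x} \<odot> V)" by (metis subset_antisym)
  then have TV: "f T \<circledast> f V = {\<one>\<^sub>K, p} \<circledast> f V"
    using T xc V.V_Pfin1 by (simp add: f_mult H.pair_Pfin1 g_pair p_def)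
  have row: "q \<in> f V \<or> (\<exists>b\<in>f V. q = p \<star> b)" if q: "q \<in> f T" for q
  proof -
    have "q \<star> \<one>\<^sub>K \<in> f T \<circledast> f V" using q W.V_one by (intro set_multI)
    then have "q \<in> {\<one>\<^sub>K, p} \<circledast> f V" using fTc[OF q] TV by simp
    then show ?thesis unfolding W.pair_mult_V[OF pc(1)] by blast
  qed
  \<comment> \<open>The additional element \<open>x u\<close> is absorbed because \<open>B\<close>
    contains the whole row \<open>x V\<close>: \<open>x u = (x u) 1\<close>, and
    \<open>(x v)(x u) = (x v u) x\<close>.\<close>
  have BT: "B \<odot> T = B \<odot> ({\<one>\<^sub>H, u} \<odot> {\<one>\<^sub>H, x})"
  proof
    have *: "{\<one>\<^sub>H, u} \<odot> {\<one>\<^sub>H, x} = insert (x \<cdot> u) T"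
      using xc uc by (auto simp: H.pair_mult T_def H.m_comm)
    show "B \<odot> T \<subseteq> B \<odot> ({\<one>\<^sub>H, u} \<odot> {\<one>\<^sub>H, x})" unfolding * by (intro mono_set_mult) auto
    have "b \<cdot> (x \<cdot> u) \<in> B \<odot> T" if b: "b \<in> B" for b
    proof (cases "b = \<one>\<^sub>H")
      case True
      have "(x \<cdot> u) \<cdot> \<one>\<^sub>H \<in> B \<odot> T" unfolding B_def T_def using u by (intro set_multI) auto
      then show ?thesis using True xc uc by simp
    next
      case False
      then obtain v where v: "v \<in> V" "b = x \<cdot> v" using b unfolding B_def by blast
      then have "b \<cdot> (x \<cdot> u) = (x \<cdot> (v \<cdot> u)) \<cdot> x" using xc uc V.V_closed by (simp add: H.m_ac)
      moreover have "(x \<cdot> (v \<cdot> u)) \<cdot> x \<in> B \<odot> T"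
        unfolding B_def T_def using u v V.V_mult by (intro set_multI) auto
      ultimately show ?thesis by simp
    qed
    moreover have "b \<cdot> t \<in> B \<odot> T" if "b \<in> B" "t \<in> T" for b t using that by (rule set_multI)
    ultimately have "b \<cdot> t \<in> B \<odot> T" if "b \<in> B" "t \<in> insert (x \<cdot> u) T" for b t using that by blast
    then show "B \<odot> ({\<one>\<^sub>H, u} \<odot> {\<one>\<^sub>H, x}) \<subseteq> B \<odot> T"
      unfolding * set_mult_def[of H B "insert (x \<cdot> u) T"] by blast
  qed
  have pairP: "{\<one>\<^sub>H, u} \<odot> {\<one>\<^sub>H, x} \<in> PH" using xc uc by (simp add: H.Pfin1_mult_closed H.pair_Pfin1)
  have BT': "f B \<circledast> f T = f B \<circledast> {\<one>\<^sub>K, a, p, a \<star> p}"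
    using arg_cong[OF BT, of f] f_mult[OF B(1) T] f_mult[OF B(1) pairP] f_pair_mult[OF uc xc] pc
    by (simp add: K.pair_mult a_def p_def)
  \<comment> \<open>The only row-0 element of \<open>f B\<close> is 1, so row 0 of the product
    consists of 1 and \<open>a\<close>.\<close>
  have bottom: "q \<in> {\<one>\<^sub>K, a}" if q: "q \<in> f T" "q \<in> f V" for q
  proof -
    have "\<one>\<^sub>K \<star> q \<in> f B \<circledast> f T" unfolding B(2) using q by (intro set_multI) auto
    then have "q \<in> f B \<circledast> {\<one>\<^sub>K, a, p, a \<star> p}" using fTc[OF q(1)] BT' by simp
    then obtain s t where st: "s \<in> f B" "t \<in> {\<one>\<^sub>K, a, p, a \<star> p}" "q = s \<star> t" by (auto simp: mem_set_mult)
    have q0: "q = p [^]\<^bsub>K\<^esub> (0::nat) \<star> q" using fTc[OF q(1)] by simp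
    obtain i :: nat and c where s: "i \<le> 1" "c \<in> f V" "s = p [^]\<^bsub>K\<^esub> i \<star> c" "i = 0 \<longrightarrow> c = \<one>\<^sub>K"
    proof (cases "s = \<one>\<^sub>K")
      case True
      then show ?thesis using that[of 0 "\<one>\<^sub>K"] W.V_one by simp
    next
      case False
      then obtain c where "c \<in> f V" "s = p \<star> c" using st(1) unfolding B(2) by blast
      then show ?thesis using that[of 1 c] pc by simp
    qed
    obtain j :: nat and d where t: "d \<in> {\<one>\<^sub>K, a}" "t = p [^]\<^bsub>K\<^esub> j \<star> d"
    proof -
      have "t = p [^]\<^bsub>K\<^esub> (0::nat) \<star> \<one>\<^sub>K \<or> t = p [^]\<^bsub>K\<^esub> (0::nat) \<star> a \<or> t = p [^]\<^bsub>K\<^esub> (1::nat) \<star> \<one>\<^sub>K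
          \<or> t = p [^]\<^bsub>K\<^esub> (1::nat) \<star> a" using st(2) pc by (auto simp: K.m_comm)
      then show ?thesis using that by blast
    qed
    have dV: "d \<in> f V" using t a W.V_one by blast
    have cd: "c \<in> carrier K" "d \<in> carrier K" using s dV W.V_closed by auto
    have "p [^]\<^bsub>K\<^esub> (0::nat) \<star> q = p [^]\<^bsub>K\<^esub> (i + j) \<star> (c \<star> d)"
      using st(3) s t cd pc q0 by (simp add: K.pow_add K.m_ac)
    then have "0 = i + j \<and> q = c \<star> d"
      using W.row_unique[OF gx q(2) W.V_mult[OF s(2) dV]] unfolding p_def by blast
    then have "q = d" using s cd by simp
    then show ?thesis using t by blast
  qed
  have DT: "D \<odot> T = D \<odot> D"
  proof
    show "D \<odot> T \<subseteq> D \<odot> D" using V.V_one u by (intro mono_set_mult) (auto simp: D_def T_def)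
    show "D \<odot> D \<subseteq> D \<odot> T"
    proof
      fix z assume "z \<in> D \<odot> D"
      then obtain r q where rq: "r \<in> D" "q \<in> D" "z = r \<cdot> q" by (auto simp: mem_set_mult)
      consider "q = x" | "q \<in> V" "r = x" | "q \<in> V" "r \<in> V" using rq unfolding D_def by blast
      then show "z \<in> D \<odot> T"
      proof cases
        case 1
        then show ?thesis using rq unfolding T_def by (auto intro: set_multI)
      next
        case 2
        then have "z = q \<cdot> x" using rq V.V_closed xc by (simp add: H.m_comm)
        then show ?thesis using 2 unfolding D_def T_def by (auto intro: set_multI)
      next
        case 3
        then have "r \<cdot> q \<in> D" unfolding D_def using V.V_mult by blast
        then have "(r \<cdot> q) \<cdot> \<one>\<^sub>H \<in> D \<odot> T" unfolding T_def by (intro set_multI) auto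
        then show ?thesis using rq 3 V.V_closed by simp
      qed
    qed
  qed
  have DT': "f D \<circledast> f T = f D \<circledast> f D" using arg_cong[OF DT, of f] f_mult D T by simp
  \<comment> \<open>The only row-2 element of \<open>f D f D\<close> is \<open>p^2\<close>.\<close>
  have top: "b = \<one>\<^sub>K" if b: "b \<in> f V" "p \<star> b \<in> f T" for b
  proof -
    have bc: "b \<in> carrier K" using b W.V_closed by blast
    have "p \<star> (p \<star> b) \<in> f D \<circledast> f T" unfolding D(2) using b by (intro set_multI) auto
    then have "p \<star> (p \<star> b) \<in> f D \<circledast> f D" unfolding DT' .
    then obtain s t where st: "s \<in> insert p (f V)" "t \<in> insert p (f V)" "p \<star> (p \<star> b) = s \<star> t"
      unfolding D(2) mem_set_mult by blast
    have lhs: "p \<star> (p \<star> b) = p [^]\<^bsub>K\<^esub> (2::nat) \<star> b" using pc bc by (simp add: numeral_2_eq_2 K.m_assoc)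
    have lev: "\<exists>i::nat. \<exists>c\<in>f V. s = p [^]\<^bsub>K\<^esub> i \<star> c \<and> i \<le> 1 \<and> (i = 1 \<longrightarrow> c = \<one>\<^sub>K)"
      if "s \<in> insert p (f V)" for s
    proof (cases "s \<in> f V")
      case True
      then show ?thesis using W.V_closed by (intro exI[of _ "0::nat"] bexI[of _ s]) auto
    next
      case False
      then show ?thesis using \<open>s \<in> insert p (f V)\<close> W.V_one pc
        by (intro exI[of _ "1::nat"] bexI[of _ "\<one>\<^sub>K"]) auto
    qed
    obtain i :: nat and c where s: "c \<in> f V" "s = p [^]\<^bsub>K\<^esub> i \<star> c" "i \<le> 1" "i = 1 \<longrightarrow> c = \<one>\<^sub>K"
      using lev[OF st(1)] by blast
    obtain j :: nat and d where t: "d \<in> f V" "t = p [^]\<^bsub>K\<^esub> j \<star> d" "j \<le> 1" "j = 1 \<longrightarrow> d = \<one>\<^sub>K"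
      using lev[OF st(2)] by blast
    have cd: "c \<in> carrier K" "d \<in> carrier K" using s t W.V_closed by auto
    have "p [^]\<^bsub>K\<^esub> (2::nat) \<star> b = p [^]\<^bsub>K\<^esub> (i + j) \<star> (c \<star> d)"
      using lhs st(3) s t cd pc by (simp add: K.pow_add K.m_ac)
    then have "2 = i + j \<and> b = c \<star> d"
      using W.row_unique[OF gx b(1) W.V_mult[OF s(1) t(1)]] unfolding p_def by blast
    moreover then have "i = 1" "j = 1" using s(3) t(3) by auto
    ultimately show ?thesis using s t by simp
  qed
  have "f T \<subseteq> {\<one>\<^sub>K, a, p}"
  proof
    fix q assume q: "q \<in> f T"
    then consider "q \<in> f V" | b where "b \<in> f V" "q = p \<star> b" using row by blast
    then show "q \<in> {\<one>\<^sub>K, a, p}"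
    proof cases
      case 1
      then show ?thesis using bottom q by blast
    next
      case 2
      then show ?thesis using top[of b] q pc by simp
    qed
  qed
  moreover have "card (f T) = card {\<one>\<^sub>K, a, p}"
  proof -
    have "x \<noteq> u" "x \<noteq> \<one>\<^sub>H" using V.V_torsion u x H.infinite_order_not_one by auto
    then have "card T = 3" using u by (simp add: T_def card_insert_if)
    moreover have "p \<noteq> a" "p \<noteq> \<one>\<^sub>K" "a \<noteq> \<one>\<^sub>K"
      unfolding p_def a_def using \<open>x \<noteq> u\<close> \<open>x \<noteq> \<one>\<^sub>H\<close> u xc uc by (auto simp: g_inj g_eq_one)
    then have "card {\<one>\<^sub>K, a, p} = 3" by (simp add: card_insert_if)
    ultimately show ?thesis using card_image_f[OF T] by simp
  qed
  ultimately have "f T = {\<one>\<^sub>K, a, p}" by (intro card_subset_eq) auto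
  then show ?thesis by (simp add: T_def a_def p_def)
qed
text \<open>With \<open>v\<close> the inverse of \<open>u\<close> and \<open>y = x v\<close>, one
  has \<open>{1, u, x}{1, v} = {1, v, y}{1, u}\<close>, where all images are known. On the right,
  \<open>g x\<close> can only be \<open>g y g u\<close>: it is not torsion, and it differs from
  \<open>g y\<close>.\<close>

lemma g_divide_torsion:
  assumes V: "finite_submonoid H V" and x: "infinite_order H x" and u: "u \<in> V" "u \<noteq> \<one>\<^sub>H"
  shows "g (x \<cdot> inv\<^bsub>H\<^esub> u) \<star> g u = g x"
proof -
  interpret V: finite_submonoid H V by fact
  interpret W: finite_submonoid K "f V" by (rule f_submonoid[OF V])
  define v where "v = inv\<^bsub>H\<^esub> u"
  have uU: "u \<in> Units H" using u V.V_units by blast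
  have xc: "x \<in> carrier H" and uc: "u \<in> carrier H" "v \<in> carrier H"
    using x H.infinite_order_closed uU by (auto simp: v_def)
  have vV: "v \<in> V" unfolding v_def using V.V_inv u by blast
  have uv: "u \<cdot> v = \<one>\<^sub>H" unfolding v_def using uU by simp
  have v1: "v \<noteq> \<one>\<^sub>H" using uv u uc by auto
  define y where "y = x \<cdot> v"
  have y: "infinite_order H y" unfolding y_def using H.infinite_order_mult_torsion x V.V_torsion vV uc by blast
  have yc: "y \<in> carrier H" using xc uc by (simp add: y_def)
  have yu: "y \<cdot> u = x"
  proof -
    have "y \<cdot> u = (u \<cdot> v) \<cdot> x" unfolding y_def using xc uc by (simp add: H.m_ac)
    then show ?thesis using uv xc by simp
  qed
  have gc: "g x \<in> carrier K" "g y \<in> carrier K" "g u \<in> carrier K" "g v \<in> carrier K" using xc yc uc by auto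
  have "{\<one>\<^sub>H, u, x} \<odot> {\<one>\<^sub>H, v} = {\<one>\<^sub>H, v, y} \<odot> {\<one>\<^sub>H, u}"
  proof -
    have "v \<cdot> u = \<one>\<^sub>H" using uv uc by (simp add: H.m_comm)
    then show ?thesis using xc yc uc uv yu y_def by (auto simp: set_mult_def)
  qed
  then have "f ({\<one>\<^sub>H, u, x} \<odot> {\<one>\<^sub>H, v}) = f ({\<one>\<^sub>H, v, y} \<odot> {\<one>\<^sub>H, u})" by simp
  moreover have "{\<one>\<^sub>H, u, x} \<in> PH" "{\<one>\<^sub>H, v, y} \<in> PH" using xc yc uc by (auto simp: mem_Pfin1)
  ultimately have "{\<one>\<^sub>K, g u, g x} \<circledast> {\<one>\<^sub>K, g v} = {\<one>\<^sub>K, g v, g y} \<circledast> {\<one>\<^sub>K, g u}"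
    using uc f_torsion_triple[OF V x u] f_torsion_triple[OF V y vV v1]
    by (simp add: f_mult H.pair_Pfin1 g_pair)
  then have eq: "{\<one>\<^sub>K, g u, g x, g v, g u \<star> g v, g x \<star> g v} = {\<one>\<^sub>K, g v, g y, g u, g v \<star> g u, g y \<star> g u}"
    using gc by (simp add: set_mult_def insert_commute)
  have gV: "g u \<in> f V" "g v \<in> f V" using g_submonoid V u vV by auto
  have inf: "infinite_order K (g x)" using g_infinite_imp x by blast
  have "g x \<in> {\<one>\<^sub>K, g v, g y, g u, g v \<star> g u, g y \<star> g u}" using eq by blast
  moreover have "g x \<noteq> w" if "w \<in> f V" for w using inf W.V_torsion[OF that] by blast
  then have "g x \<noteq> \<one>\<^sub>K" "g x \<noteq> g v" "g x \<noteq> g u" "g x \<noteq> g v \<star> g u"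
    using gV W.V_one W.V_mult by blast+
  moreover have "g x \<noteq> g y" using xc yc uc v1 by (simp add: g_inj y_def H.mult_eq_self_right)
  ultimately have "g x = g y \<star> g u" by blast
  then show ?thesis by (simp add: y_def v_def)
qed

lemma g_mult_torsion:
  assumes x: "infinite_order H x" and t: "t \<in> carrier H" "\<not> infinite_order H t"
  shows "g (x \<cdot> t) = g x \<star> g t"
proof (cases "t = \<one>\<^sub>H")
  case True
  then show ?thesis using x H.infinite_order_closed by simp
next
  case False
  have tU: "t \<in> Units H" using t H.torsion_unit by blast
  have xc: "x \<in> carrier H" using x H.infinite_order_closed by blast
  have "t \<in> range (\<lambda>i::nat. t [^]\<^bsub>H\<^esub> i)" using t rangeI[of "\<lambda>i::nat. t [^]\<^bsub>H\<^esub> i" 1] by simp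
  then have "g (x \<cdot> t \<cdot> inv\<^bsub>H\<^esub> t) \<star> g t = g (x \<cdot> t)"
    using g_divide_torsion[OF H.torsion_powers_submonoid[OF t] _ _ False] H.infinite_order_mult_torsion[OF x t]
    by blast
  moreover have "x \<cdot> t \<cdot> inv\<^bsub>H\<^esub> t = x" using tU t xc by (simp add: H.m_assoc)
  ultimately show ?thesis by simp
qed

lemma product_mod_submonoid:
  assumes V: "finite_submonoid H V" and u: "u \<in> V" "u \<noteq> \<one>\<^sub>H"
    and x: "x \<in> carrier H" "x \<notin> Units H" and y: "y \<in> carrier H" "y \<notin> Units H"
  shows "\<exists>s\<in>f V. g (x \<cdot> y) = g x \<star> g y \<star> s"
proof -
  interpret V: finite_submonoid H V by fact
  interpret W: finite_submonoid K "f V" by (rule f_submonoid[OF V])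
  define c where "c = x \<cdot> y"
  have c: "c \<in> carrier H" "c \<notin> Units H" unfolding c_def using x y H.mult_unit_iff by auto
  have inf: "infinite_order H x" "infinite_order H y" "infinite_order H c"
    using x y c H.nonunit_infinite_order by auto
  define a where "a = g u"
  have a: "a \<in> f V" "a \<noteq> \<one>\<^sub>K" unfolding a_def using g_submonoid V u g_eq_one V.V_closed by auto
  have aU: "a \<in> Units K" using a W.V_units by blast
  have D: "insert z V \<in> PH" if "z \<in> carrier H" for z
    using V.V_finite V.V_closed V.V_one that by (auto simp: mem_Pfin1)
  define R where "R = insert x V \<odot> insert y V"
  have R: "R \<in> PH" unfolding R_def using D x y by (intro H.Pfin1_mult_closed) auto
  \<comment> \<open>A factor \<open>d\<close> from \<open>V\<close> is absorbed by \<open>R\<close>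
    unless both other factors are \<open>x\<close> and \<open>y\<close>; then \<open>x y d\<close>
    is read as \<open>d c\<close>.\<close>
  have "R \<odot> insert c V = R \<odot> {\<one>\<^sub>H, c}"
  proof
    show "R \<odot> {\<one>\<^sub>H, c} \<subseteq> R \<odot> insert c V" using V.V_one by (intro mono_set_mult) auto
    show "R \<odot> insert c V \<subseteq> R \<odot> {\<one>\<^sub>H, c}"
    proof
      fix z assume "z \<in> R \<odot> insert c V"
      then obtain r d where rd: "r \<in> R" "d \<in> insert c V" "z = r \<cdot> d" by (auto simp: mem_set_mult)
      show "z \<in> R \<odot> {\<one>\<^sub>H, c}"
      proof (cases "d = c")
        case True
        then show ?thesis using rd by (auto intro: set_multI)
      next
        case False
        then have d: "d \<in> V" "d \<in> carrier H" using rd V.V_closed by auto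
        obtain p q where pq: "p \<in> insert x V" "q \<in> insert y V" "r = p \<cdot> q"
          using rd(1) unfolding R_def by (auto simp: mem_set_mult)
        have cl: "p \<in> carrier H" "q \<in> carrier H" using pq x y V.V_closed by auto
        have inR: "z \<in> R \<Longrightarrow> ?thesis"
        proof -
          assume "z \<in> R"
          then have "z \<cdot> \<one>\<^sub>H \<in> R \<odot> {\<one>\<^sub>H, c}" by (intro set_multI) auto
          then show ?thesis using rd cl pq d by simp
        qed
        consider "p \<in> V" | "q \<in> V" | "p = x" "q = y" using pq by blast
        then show ?thesis
        proof cases
          case 1
          then have "(p \<cdot> d) \<cdot> q \<in> R" unfolding R_def using V.V_mult d pq by (intro set_multI) auto
          moreover have "(p \<cdot> d) \<cdot> q = z" using rd pq cl d by (simp add: H.m_ac)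
          ultimately show ?thesis using inR by simp
        next
          case 2
          then have "p \<cdot> (q \<cdot> d) \<in> R" unfolding R_def using V.V_mult d pq by (intro set_multI) auto
          moreover have "p \<cdot> (q \<cdot> d) = z" using rd pq cl d by (simp add: H.m_ac)
          ultimately show ?thesis using inR by simp
        next
          case 3
          have "d \<cdot> \<one>\<^sub>H \<in> R" unfolding R_def using d V.V_one by (intro set_multI) auto
          then have "d \<cdot> c \<in> R \<odot> {\<one>\<^sub>H, c}" using d by (intro set_multI) auto
          moreover have "d \<cdot> c = z" using 3 rd pq d c by (simp add: c_def H.m_comm)
          ultimately show ?thesis by simp
        qed
      qed
    qed
  qed
  then have "f (R \<odot> insert c V) = f (R \<odot> {\<one>\<^sub>H, c})" by simp
  then have "f R \<circledast> f (insert c V) = f R \<circledast> {\<one>\<^sub>K, g c}"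
    using R D c by (simp add: f_mult H.pair_Pfin1 g_pair)
  then have eq: "f R \<circledast> insert (g c) (f V) = f R \<circledast> {\<one>\<^sub>K, g c}"
    using f_thick_top[OF V inf(3) u] by simp
  have fR: "f R = insert (g x) (f V) \<circledast> insert (g y) (f V)"
    unfolding R_def using f_mult[OF D[OF x(1)] D[OF y(1)]] f_thick_top[OF V inf(1) u] f_thick_top[OF V inf(2) u]
    by simp
  have gc: "g x \<in> carrier K" "g y \<in> carrier K" "g c \<in> carrier K" "a \<in> carrier K"
    using x y c aU by auto
  have gU: "g x \<notin> Units K" "g y \<notin> Units K" "g c \<notin> Units K" using x y c g_nonunit by auto
  \<comment> \<open>Since \<open>a\<close> is not 1, \<open>g x g y a\<close> falls outside
    \<open>f R\<close>, so its factorization must use \<open>g c\<close>. This ties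
    \<open>g c\<close> to \<open>g x g y\<close>.\<close>
  have "g x \<star> g y \<in> f R" unfolding fR by (intro set_multI) auto
  then have "(g x \<star> g y) \<star> a \<in> f R \<circledast> {\<one>\<^sub>K, g c}" unfolding eq[symmetric] using a by (intro set_multI) auto
  then obtain r e where re: "r \<in> f R" "e \<in> {\<one>\<^sub>K, g c}" "(g x \<star> g y) \<star> a = r \<star> e"
    unfolding mem_set_mult by blast
  obtain p q where pq: "p \<in> insert (g x) (f V)" "q \<in> insert (g y) (f V)" "r = p \<star> q"
    using re(1) unfolding fR mem_set_mult by blast
  have pqc: "p \<in> carrier K" "q \<in> carrier K" using pq gc W.V_closed by auto
  \<comment> \<open>Here \<open>g z\<close> would be \<open>g c\<close> times an element of
    \<open>f V = g V\<close>, so \<open>z = c t\<close> for some \<open>t\<close> in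
    \<open>V\<close>, making the cofactor \<open>w\<close> a unit.\<close>
  have absorb: False
    if z: "z \<in> carrier H" "w \<in> carrier H" "z \<cdot> w = c" "w \<notin> Units H" and s: "s \<in> f V" "g z \<star> a = s \<star> g c" for z w s
  proof -
    have sc: "s \<in> carrier K" "s \<in> Units K" using s W.V_closed W.V_units by auto
    obtain b where b: "b \<in> f V" "s = a \<star> b" using W.V_divide[OF a(1) s(1)] by blast
    have bc: "b \<in> carrier K" using b W.V_closed by blast
    have "g z \<star> a = (g c \<star> b) \<star> a" unfolding s(2) b(2) using gc bc by (simp add: K.m_ac)
    then have gz: "g z = g c \<star> b" using gc bc z by (simp add: K.mult_right_cancel)
    have "b \<in> g ` V" using b(1) g_submonoid_image[OF V] by simp
    then obtain t where t: "t \<in> V" "g t = b" by (elim imageE) simp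
    have tc: "t \<in> carrier H" using t V.V_closed by blast
    have "g z = g (c \<cdot> t)" using g_mult_torsion[OF inf(3) tc V.V_torsion[OF t(1)]] gz t by simp
    then have "z = c \<cdot> t" using z c tc by (simp add: g_inj)
    also have "\<dots> = z \<cdot> (w \<cdot> t)" unfolding z(3)[symmetric] using z(1,2) tc by (simp add: H.m_assoc)
    finally have "w \<cdot> t = \<one>\<^sub>H" using z tc H.mult_eq_self_right(2)[of z "w \<cdot> t"] by simp
    then show False using z tc H.mult_unit_iff[of w t] by simp
  qed
  have VU: "w \<in> Units K" if "w \<in> f V" for w using W.V_units that by blast
  consider "e = \<one>\<^sub>K" "p \<in> f V" "q \<in> f V" | "e = \<one>\<^sub>K" "p = g x" "q \<in> f V"
    | "e = \<one>\<^sub>K" "p \<in> f V" "q = g y" | "e = \<one>\<^sub>K" "p = g x" "q = g y"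
    | "e = g c" "p \<in> f V" "q \<in> f V" | "e = g c" "p = g x" "q \<in> f V"
    | "e = g c" "p \<in> f V" "q = g y" | "e = g c" "p = g x" "q = g y"
    using re pq by blast
  then show ?thesis
  proof cases
    case 1
    then have "g x \<star> (g y \<star> a) \<in> Units K" using re pq VU pqc gc by (simp add: K.m_assoc)
    then show ?thesis using gU gc K.mult_unit_iff[of "g x" "g y \<star> a"] by simp
  next
    case 2
    then have "g x \<star> (g y \<star> a) = g x \<star> q" using re pq pqc gc by (simp add: K.m_assoc)
    then have "g y \<star> a = q" using gc pqc by (simp add: K.mult_left_cancel)
    then have "g y \<star> a \<in> Units K" using VU 2 by blast
    then show ?thesis using gU gc K.mult_unit_iff[of "g y" a] by simp
  next
    case 3
    then have "g y \<star> (g x \<star> a) = g y \<star> p" using re pq pqc gc by (simp add: K.m_ac)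
    then have "g x \<star> a = p" using gc pqc K.l_cancel[of "g y" "g x \<star> a" p] by simp
    then have "g x \<star> a \<in> Units K" using VU 3 by blast
    then show ?thesis using gU gc K.mult_unit_iff[of "g x" a] by simp
  next
    case 4
    then have "(g x \<star> g y) \<star> a = g x \<star> g y" using re pq gc by simp
    then show ?thesis using gc a K.mult_eq_self_right(1)[of "g x \<star> g y" a] by simp
  next
    case 5
    have pqV: "p \<star> q \<in> f V" using 5 W.V_mult by blast
    obtain s where s: "s \<in> f V" "a = (p \<star> q) \<star> s" using W.V_divide[OF pqV a(1)] by blast
    have sc: "s \<in> carrier K" using s W.V_closed by blast
    have "(p \<star> q) \<star> (g x \<star> g y \<star> s) = (g x \<star> g y) \<star> ((p \<star> q) \<star> s)" using gc pqc sc by (simp add: K.m_ac)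
    also have "\<dots> = (g x \<star> g y) \<star> a" using s by simp
    also have "\<dots> = (p \<star> q) \<star> g c" using re pq 5 by simp
    finally have "g x \<star> g y \<star> s = g c" using gc pqc sc K.l_cancel[of "p \<star> q" "g x \<star> g y \<star> s" "g c"] by simp
    then show ?thesis using s unfolding c_def by (intro bexI[of _ s]) auto
  next
    case 6
    then have "g x \<star> (g y \<star> a) = g x \<star> (q \<star> g c)" using re pq pqc gc by (simp add: K.m_assoc)
    then have "g y \<star> a = q \<star> g c" using gc pqc K.l_cancel[of "g x" "g y \<star> a" "q \<star> g c"] by simp
    then show ?thesis using absorb[of y x q] x y 6 by (simp add: c_def H.m_comm)
  next
    case 7
    then have "g y \<star> (g x \<star> a) = g y \<star> (p \<star> g c)" using re pq pqc gc by (simp add: K.m_ac)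
    then have "g x \<star> a = p \<star> g c" using gc pqc K.l_cancel[of "g y" "g x \<star> a" "p \<star> g c"] by simp
    then show ?thesis using absorb[of x y p] x y 7 by (simp add: c_def)
  next
    case 8
    then have "a = g c" using re pq pqc gc K.l_cancel[of "g x \<star> g y" a "g c"] by simp
    then show ?thesis using aU gU by simp
  qed
qed

text \<open>Inserting \<open>g c = g x g y s\<close> into the quotient alternatives makes
  \<open>g x\<close> or \<open>g y\<close> a unit. In the remaining one,
  \<open>g c = (g c)^i s\<close> with a unit \<open>s\<close>, and uniqueness of levels gives
  \<open>s = 1\<close>.\<close>

lemma g_mult_nonunits_torsion:
  assumes V: "finite_submonoid H V" and u: "u \<in> V" "u \<noteq> \<one>\<^sub>H"
    and x: "x \<in> carrier H" "x \<notin> Units H" and y: "y \<in> carrier H" "y \<notin> Units H"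
  shows "g (x \<cdot> y) = g x \<star> g y"
proof -
  interpret W: finite_submonoid K "f V" by (rule f_submonoid[OF V])
  define c where "c = x \<cdot> y"
  have c: "c \<in> carrier H" "c \<notin> Units H" unfolding c_def using x y H.mult_unit_iff by auto
  obtain s where s: "s \<in> f V" "g c = g x \<star> g y \<star> s" using product_mod_submonoid[OF assms] unfolding c_def by blast
  have sU: "s \<in> Units K" "s \<in> carrier K" using s W.V_units W.V_closed by auto
  have gc: "g x \<in> carrier K" "g y \<in> carrier K" "g c \<in> carrier K" using x y c by auto
  have gU: "g x \<notin> Units K" "g y \<notin> Units K" "g c \<notin> Units K" using x y c g_nonunit by auto
  have "x \<noteq> \<one>\<^sub>H" "y \<noteq> \<one>\<^sub>H" using x y by auto
  then obtain i :: nat where i: "i > 0" "g x \<star> g y = g c [^]\<^bsub>K\<^esub> i \<or> g y = g x \<star> g c [^]\<^bsub>K\<^esub> i \<or> g x = g y \<star> g c [^]\<^bsub>K\<^esub> i"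
    using nonunit_product_step[of x y] x y c unfolding c_def by blast
  obtain j where j: "i = Suc j" using i(1) gr0_implies_Suc by blast
  have bad: False if w: "w \<in> carrier K" "z \<in> carrier K" "w \<notin> Units K" "g c = w \<star> z \<star> s" "z = w \<star> g c [^]\<^bsub>K\<^esub> i" for w z
  proof -
    define r where "r = w \<star> (g c [^]\<^bsub>K\<^esub> j \<star> s)"
    have rc: "r \<in> carrier K" unfolding r_def using w(1) gc sU by simp
    have "w \<star> z \<star> s = g c \<star> (w \<star> r)"
      unfolding w(5) j r_def using w(1) gc sU by (simp add: K.m_ac)
    then have "g c = g c \<star> (w \<star> r)" by (rule trans[OF w(4)])
    then have "w \<star> r = \<one>\<^sub>K" using gc(3) w(1) rc K.mult_eq_self_right(2)[of "g c" "w \<star> r"] by blast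
    then show False using w(1,3) rc K.mult_unit_iff[of w r] by simp
  qed
  have s2: "g c = g y \<star> g x \<star> s" using s(2) K.m_comm[OF gc(1,2)] by simp
  have "g x \<star> g y = g c [^]\<^bsub>K\<^esub> i"
    using i(2) bad[OF gc(1,2) gU(1) s(2)] bad[OF gc(2,1) gU(2) s2] by blast
  then have "(g x \<star> g y) \<star> s = g c [^]\<^bsub>K\<^esub> i \<star> s" by (simp only:)
  then have "g c = g c [^]\<^bsub>K\<^esub> i \<star> s" by (rule trans[OF s(2)])
  moreover have "g c [^]\<^bsub>K\<^esub> (1::nat) \<star> \<one>\<^sub>K = g c" using gc(3) by simp
  ultimately have "g c [^]\<^bsub>K\<^esub> (1::nat) \<star> \<one>\<^sub>K = g c [^]\<^bsub>K\<^esub> i \<star> s" by (rule trans[rotated])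
  then have "s = \<one>\<^sub>K" using K.level_unique[OF gc(3) gU(3) K.Units_one_closed sU(1)] by blast
  then show ?thesis using s(2) gc unfolding c_def by simp
qed

lemma g_mult_torsion_case:
  assumes tors: "\<And>u. u \<in> Units H \<Longrightarrow> \<not> infinite_order H u" and nontriv: "Units H \<noteq> {\<one>\<^sub>H}"
    and "x \<in> carrier H" "y \<in> carrier H"
  shows "g (x \<cdot> y) = g x \<star> g y"
proof -
  have inf: "infinite_order H z" if "z \<in> carrier H" "z \<notin> Units H" for z
    using H.nonunit_infinite_order that by blast
  consider "y \<in> Units H" "x \<notin> Units H" | "x \<in> Units H" "y \<notin> Units H"
    | "x \<in> Units H" "y \<in> Units H" | "x \<notin> Units H" "y \<notin> Units H" by blast
  then show ?thesis
  proof cases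
    case 1
    then show ?thesis using g_mult_torsion inf tors assms by blast
  next
    case 2
    then have "g (y \<cdot> x) = g y \<star> g x" using g_mult_torsion inf tors assms by blast
    then show ?thesis using assms by (simp add: H.m_comm K.m_comm)
  next
    case 3
    \<comment> \<open>For two torsion units, an auxiliary factor \<open>z\<close> of infinite order
      makes the mixed rule applicable and is cancelled afterwards.\<close>
    obtain z where z: "infinite_order H z" using ex_infinite_H by blast
    have zc: "z \<in> carrier H" using z H.infinite_order_closed by blast
    have xy: "\<not> infinite_order H x" "\<not> infinite_order H y" "\<not> infinite_order H (x \<cdot> y)" using 3 tors by auto
    have zx: "infinite_order H (z \<cdot> x)" using H.infinite_order_mult_torsion z assms xy by blast
    have "g z \<star> g (x \<cdot> y) = g (z \<cdot> (x \<cdot> y))" using g_mult_torsion[OF z _ xy(3)] assms by simp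
    also have "\<dots> = g ((z \<cdot> x) \<cdot> y)" using zc assms by (simp add: H.m_assoc)
    also have "\<dots> = (g z \<star> g x) \<star> g y"
      using g_mult_torsion[OF zx _ xy(2)] g_mult_torsion[OF z _ xy(1)] assms by simp
    also have "\<dots> = g z \<star> (g x \<star> g y)" using zc assms by (simp add: K.m_assoc)
    finally show ?thesis using zc assms K.l_cancel[of "g z" "g (x \<cdot> y)" "g x \<star> g y"] by simp
  next
    case 4
    obtain u where u: "u \<in> Units H" "u \<noteq> \<one>\<^sub>H" using nontriv by blast
    have uc: "u \<in> carrier H" using u by blast
    have "u \<in> range (\<lambda>i::nat. u [^]\<^bsub>H\<^esub> i)" using uc rangeI[of "\<lambda>i::nat. u [^]\<^bsub>H\<^esub> i" 1] by simp
    then show ?thesis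
      using g_mult_nonunits_torsion[OF H.torsion_powers_submonoid[OF uc tors[OF u(1)]] _ u(2)] 4 assms by blast
  qed
qed

lemma g_iso:
  assumes "Units H \<noteq> {\<one>\<^sub>H}" shows "g \<in> iso H K"
proof -
  have "g (x \<cdot> y) = g x \<star> g y" if "x \<in> carrier H" "y \<in> carrier H" for x y
  proof (cases "\<exists>u. infinite_order H u \<and> u \<in> Units H")
    case True
    then show ?thesis using g_mult_infinite_unit_case that by blast
  next
    case False
    then show ?thesis using g_mult_torsion_case[OF _ assms that] by blast
  qed
  then show ?thesis using bij_g by (intro isoI homI) auto
qed

text \<open>The pullback of the inverse of \<open>f\<close> is the inverse of \<open>g\<close>, so
  multiplicativity carries over from it.\<close>

lemma g_iso_swap:
  assumes "Units K \<noteq> {\<one>\<^sub>K}" shows "g \<in> iso H K"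
proof -
  interpret S: pfin_iso K H "inv_into PH f" by (rule swap)
  have S: "S.g \<in> iso K H" using S.g_iso[OF assms] .
  have "g (x \<cdot> y) = g x \<star> g y" if xy: "x \<in> carrier H" "y \<in> carrier H" for x y
  proof -
    have "S.g (g x \<star> g y) = x \<cdot> y"
      using S xy swap_g hom_mult[of S.g K H "g x" "g y"] by (simp add: iso_def)
    moreover have "S.g (g (x \<cdot> y)) = x \<cdot> y" using xy swap_g by simp
    ultimately show ?thesis using S.g_inj[of "g (x \<cdot> y)" "g x \<star> g y"] xy by simp
  qed
  then show ?thesis using bij_g by (intro isoI homI) auto
qed

end

theorem theorem14:
  fixes H :: "('a, 'm) monoid_scheme" and K :: "('b, 'n) monoid_scheme"
  assumes "comm_monoid_cancel H" and "comm_monoid_cancel K"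
    and "\<exists>x. infinite_order H x" and "\<exists>y. infinite_order K y"
  shows "(\<forall>f \<in> iso (Pfin1 H) (Pfin1 K).
            Units H \<noteq> {\<one>\<^bsub>H\<^esub>} \<or> Units K \<noteq> {\<one>\<^bsub>K\<^esub>} \<longrightarrow> pullback H K f \<in> iso H K)
       \<and> (Units H \<noteq> {\<one>\<^bsub>H\<^esub>} \<and> Units K \<noteq> {\<one>\<^bsub>K\<^esub>} \<and> Pfin1 H \<cong> Pfin1 K \<longrightarrow> H \<cong> K)"
proof -
  have main: "pullback H K f \<in> iso H K"
    if f: "f \<in> iso (Pfin1 H) (Pfin1 K)" and units: "Units H \<noteq> {\<one>\<^bsub>H\<^esub>} \<or> Units K \<noteq> {\<one>\<^bsub>K\<^esub>}" for f
  proof -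
    interpret pfin_iso H K f
      using assms f by (intro pfin_iso.intro pfin_iso_axioms.intro)
    show ?thesis using units g_iso g_iso_swap by blast
  qed
  moreover have "H \<cong> K" if "Units H \<noteq> {\<one>\<^bsub>H\<^esub>}" "Pfin1 H \<cong> Pfin1 K"
    using that main unfolding is_iso_def by blast
  ultimately show ?thesis by blast
qed

end
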